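(* Let $N\geq 2$ be an integer, $q>1$, $\alpha\geq 0$, $-1<\varrho<0$, and set $\delta=\alpha\left(1-\frac1q\right)$. Suppose that $\delta<\frac2N$, that $$p\geq\frac{N-2\varrho-N\delta}{N-2\varrho-2},$$ and that $\frac{N(p-1)}{2}\leq q\leq p$. Define $$p_c=\frac{N\big((p-1)(q-1)+\delta q\big)}{2(q-1)+N\delta},\qquad \ell=\frac{N\big((p-1)(q-1)+\delta q\big)}{2(q-1)+N\delta+2(\varrho+1)(p-1)(q-1)+2(\varrho+1)\delta q}.$$ Then there exists $\epsilon>0$ such that for any $u_0\in L^{p_c}(\mathbb{R}^N)$ and $\mathbf{w}\in L^{\ell}(\mathbb{R}^N)$ with $\|u_0\|_{L^{p_c}}+\|\mathbf{w}\|_{L^{\ell}}<\epsilon$, the problem $$\partial_t u-\Delta u=\|u(t)\|_q^{\alpha}|u|^p+t^{\varrho}\,\mathbf{w}(x)\ \text{ in }\mathbb{R}^N\times(0,\infty),\qquad u(x,0)=u_0(x)\ \text{ in }\mathbb{R}^N,$$ admits a global-in-time solution $u$.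
   Context: Here $\|u(t)\|_q=\|u(\cdot,t)\|_{L^q(\mathbb{R}^N)}$. Let $\mathbf{S}(t)=e^{t\Delta}$ be the heat semigroup on $\mathbb{R}^N$: $\mathbf{S}(t)\varphi=G(\cdot,t)\star\varphi$ with $G(x,t)=(4\pi t)^{-N/2}e^{-|x|^2/(4t)}$ for $t>0$. A global solution is understood in the mild sense, i.e. as a function $u$ on $\mathbb{R}^N\times(0,\infty)$ satisfying the integral (Duhamel) equation $$u(t)=\mathbf{S}(t)u_0+\int_0^t\mathbf{S}(t-\tau)\big(\|u(\tau)\|_q^{\alpha}|u(\tau)|^p\big)\,d\tau+\int_0^t\tau^{\varrho}\,\mathbf{S}(t-\tau)\mathbf{w}\,d\tau\qquad\text{for all } t>0.$$
   Formalization: The claim is proved for ℓ ≥ 1 (L^ℓ a normed space); for α > 0 the stated bounds also allow ℓ < 1, where it fails: w = c|x|^{-N} on |x| < 1 lies in L^ℓ with small quasi-norm but is not locally integrable, so S(t)w is infinite. *)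

theory Defs
  imports "HOL-Analysis.Analysis"
begin

definition Lp_norm :: "real \<Rightarrow> ('a::euclidean_space \<Rightarrow> real) \<Rightarrow> real" where
  "Lp_norm r f = (LINT x|lborel. \<bar>f x\<bar> powr r) powr (1 / r)"

(* Elements of L^r are represented by functions; every almost-everywhere class of Lebesgue
   measurable functions has a Borel representative.  L^r is taken to be a normed space, as
   usual, so the exponent is required to satisfy 1 <= r, and Lp r is empty for r < 1.  This
   matters for the exponent l of the forcing term w: for alpha > 0 the inequalities
   relating p, q, alpha, rho do not by themselves exclude l < 1, a range in which functions
   with finite integral of |w|^l need not be locally integrable, so that S(t)w need not make
   sense. *)
definition Lp :: "real \<Rightarrow> ('a::euclidean_space \<Rightarrow> real) set" where
  "Lp r = {f. 1 \<le> r \<and> f \<in> borel_measurable lborel \<and>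
              integrable lborel (\<lambda>x. \<bar>f x\<bar> powr r)}"

definition heat_kernel :: "real \<Rightarrow> 'a::euclidean_space \<Rightarrow> real" where
  "heat_kernel t x =
     (4 * pi * t) powr (- (real DIM('a) / 2)) * exp (- (norm x)\<^sup>2 / (4 * t))"

definition heat_semigroup ::
    "real \<Rightarrow> ('a::euclidean_space \<Rightarrow> real) \<Rightarrow> 'a \<Rightarrow> real" where
  "heat_semigroup t \<phi> x = (LINT y|lborel. heat_kernel t (x - y) * \<phi> y)"

(* The Bochner integral is 0 on non-integrable functions; this says that the integral
   defining (S(t) phi)(x) really converges. *)
definition heat_semigroup_defined ::
    "real \<Rightarrow> ('a::euclidean_space \<Rightarrow> real) \<Rightarrow> 'a \<Rightarrow> bool" where
  "heat_semigroup_defined t \<phi> x \<longleftrightarrow> integrable lborel (\<lambda>y. heat_kernel t (x - y) * \<phi> y)"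

(* The source term ||u(t)||_q^alpha |u(t)|^p.  Since 0 powr 0 = 0 in HOL, the first factor
   deviates from the convention 0^0 = 1 when alpha = 0 and u(t) = 0 almost everywhere, but
   then |u(t)|^p = 0 almost everywhere, so the product is unaffected up to a null set. *)
definition nonlocal_source ::
    "real \<Rightarrow> real \<Rightarrow> real \<Rightarrow> ('a::euclidean_space \<Rightarrow> real) \<Rightarrow> 'a \<Rightarrow> real" where
  "nonlocal_source q \<alpha> p v = (\<lambda>x. Lp_norm q v powr \<alpha> * \<bar>v x\<bar> powr p)"

(* u t x stands for u(x,t); only the values for t > 0 are relevant.  For every t > 0 the
   Duhamel equation holds for almost every x, with all integrals in it convergent. *)
definition global_mild_solution ::
    "real \<Rightarrow> real \<Rightarrow> real \<Rightarrow> real \<Rightarrow> ('a::euclidean_space \<Rightarrow> real) \<Rightarrow> ('a \<Rightarrow> real)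
      \<Rightarrow> (real \<Rightarrow> 'a \<Rightarrow> real) \<Rightarrow> bool" where
  "global_mild_solution q \<alpha> p \<rho> u0 w u \<longleftrightarrow>
     set_borel_measurable borel ({0<..} \<times> UNIV) (\<lambda>(t, x). u t x) \<and>
     (\<forall>t>0. u t \<in> Lp q) \<and>
     (\<forall>t>0. AE x in lborel.
        heat_semigroup_defined t u0 x \<and>
        (AE \<tau> in lborel. \<tau> \<in> {0<..<t} \<longrightarrow>
           heat_semigroup_defined (t - \<tau>) (nonlocal_source q \<alpha> p (u \<tau>)) x \<and>
           heat_semigroup_defined (t - \<tau>) w x) \<and>
        set_integrable lborel {0<..<t}
          (\<lambda>\<tau>. heat_semigroup (t - \<tau>) (nonlocal_source q \<alpha> p (u \<tau>)) x) \<and>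
        set_integrable lborel {0<..<t} (\<lambda>\<tau>. \<tau> powr \<rho> * heat_semigroup (t - \<tau>) w x) \<and>
        u t x = heat_semigroup t u0 x
          + (LINT \<tau>:{0<..<t}|lborel.
               heat_semigroup (t - \<tau>) (nonlocal_source q \<alpha> p (u \<tau>)) x)
          + (LINT \<tau>:{0<..<t}|lborel. \<tau> powr \<rho> * heat_semigroup (t - \<tau>) w x))"

end

theory Submission
  imports Defs "HOL-Complex_Analysis.Great_Picard" "HOL-Probability.Distributions"
begin

text \<open>
  For small data one works in the set of functions with
  \<open>\<parallel>u(t)\<parallel>\<^sub>q \<le> M t\<^sup>-\<^sup>b\<close> and \<open>\<parallel>u(t)\<parallel>\<^sub>r \<le> M t\<^sup>-\<^sup>\<beta>\<close>, where \<open>r \<ge> p\<close> is an auxiliary exponent and the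
  rates are those given by scaling; since \<open>p\<^sub>c \<le> q \<le> p\<close>, the space \<open>L\<^sup>q\<close> alone does not control
  \<open>|u|\<^sup>p\<close>.

  For \<open>\<alpha> < 1\<close> the map \<open>u \<mapsto> \<parallel>u\<parallel>\<^sub>q\<^sup>\<alpha> |u|\<^sup>p\<close> need not be Lipschitz in these norms, so the contraction
  principle is applied only after freezing the scalar coefficient \<open>a(t)\<close> that replaces
  \<open>\<parallel>u(t)\<parallel>\<^sub>q\<^sup>\<alpha>\<close>. All solutions obtained in this way, for all admissible \<open>a\<close>, lie below one common
  majorant \<open>V\<close>, the solution of the problem with absolute values everywhere and the largest
  admissible coefficient. A coefficient with \<open>a(t) = \<parallel>u(t - h)\<parallel>\<^sub>q\<^sup>\<alpha>\<close> is found step by step in time.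
  The majorant makes the functions \<open>t \<mapsto> \<parallel>u(t)\<parallel>\<^sub>q\<close> equicontinuous on \<open>(0,\<infinity>)\<close>, hence for a sequence
  \<open>h \<rightarrow> 0\<close> they converge pointwise; dominated convergence under \<open>V\<close> and the contraction estimate
  then give convergence of the solutions themselves.
\<close>


section \<open>Powers of extended nonnegative reals and bounds in Lebesgue spaces\<close>

text \<open>The function s^\<open>\<alpha>\<close> has no Lipschitz constant near s = 0 when
  \<open>\<alpha>\<close> < 1. For a frozen coefficient a <= c, differences of sources below V are
  bounded by p c V^(p-1) |u - v|. So one linear operator, built from V alone, controls every frozen
  problem at once, and its constants do not depend on a. Compactness is then needed only for scalar
  functions of t; convergence of the solutions in x comes from the contraction.

  With K = N / (2 p_c), scaling forces the decay rates K - N/(2q) in L^q and K - N/(2r) in L^r, and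
  every condition on r becomes linear in y = N / (2 r). In the relevant case l >= 1 one has K +
  \<open>\<rho>\<close> + 1 <= N/2; this supplies most of the room for choosing y.

  Majorants and oscillations take values in the extended nonnegative reals: the equation for V then
  holds at every point, monotone limits need no integrability, and finiteness is used only almost
  everywhere.\<close>

definition epow :: "real \<Rightarrow> ennreal \<Rightarrow> ennreal" where
  "epow p x = (if x = \<infinity> then \<infinity> else ennreal (enn2real x powr p))"

lemma epow_ennreal [simp]: "0 \<le> x \<Longrightarrow> epow p (ennreal x) = ennreal (x powr p)"
  by (simp add: epow_def)

lemma epow_0 [simp]: "epow p 0 = 0"
  by (simp add: epow_def)

lemma epow_infinity [simp]: "epow p \<infinity> = \<infinity>" "epow p top = top"
  by (simp_all add: epow_def)

lemma epow_1 [simp]: "epow 1 x = x"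
  by (cases x) auto

lemma epow_eq_0_iff: "epow p x = 0 \<longleftrightarrow> x = 0"
  by (cases x) (auto simp: ennreal_eq_0_iff)

lemma epow_mono: "0 \<le> p \<Longrightarrow> x \<le> y \<Longrightarrow> epow p x \<le> epow p y"
  by (cases x; cases y) (auto simp: top_unique intro!: powr_mono2)

lemma epow_measurable [measurable]: "epow p \<in> borel_measurable borel"
  unfolding epow_def by measurable

text \<open>The values of \<open>epow\<close> at 0 and at infinity are chosen so that this law and
  the two after it hold for all real exponents, without side conditions.\<close>

lemma epow_epow: "epow a (epow b x) = epow (a * b) x"
  by (cases x) (auto simp: powr_powr mult.commute)

lemma epow_add: "epow (a + b) x = epow a x * epow b x"
  by (cases x) (auto simp: powr_add ennreal_mult)

lemma epow_mult: "epow p (x * y) = epow p x * epow p y"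
  by (cases x; cases y)
    (auto simp: powr_mult ennreal_mult[symmetric] ennreal_mult_top ennreal_top_mult ennreal_eq_0_iff)

text \<open>For p > 0 the map \<open>epow p\<close> is an order isomorphism with inverse
  \<open>epow (1/p)\<close>, so it preserves arbitrary suprema.\<close>

lemma epow_SUP:
  assumes p: "0 < p"
  shows "epow p (SUP i\<in>I. f i) = (SUP i\<in>I. epow p (f i))"
proof (rule antisym)
  have "f i \<le> epow (1/p) (SUP i\<in>I. epow p (f i))" if "i \<in> I" for i
  proof -
    have "f i = epow (1/p) (epow p (f i))" using p by (simp add: epow_epow)
    also have "\<dots> \<le> epow (1/p) (SUP i\<in>I. epow p (f i))"
      using p that by (intro epow_mono SUP_upper) auto
    finally show ?thesis .
  qed
  then have "epow p (SUP i\<in>I. f i) \<le> epow p (epow (1/p) (SUP i\<in>I. epow p (f i)))"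
    using p by (intro epow_mono SUP_least) auto
  then show "epow p (SUP i\<in>I. f i) \<le> (SUP i\<in>I. epow p (f i))"
    using p by (simp add: epow_epow)
qed (use p in \<open>auto intro!: SUP_least epow_mono SUP_upper\<close>)

section \<open>Convexity: weighted means, tangent lines and Jensen's inequality\<close>

lemma weighted_AM_GM:
  fixes a b :: real
  assumes "0 \<le> a" "0 \<le> b" "0 \<le> \<alpha>" "0 \<le> \<beta>" "\<alpha> + \<beta> = 1"
  shows "a powr \<alpha> * b powr \<beta> \<le> \<alpha> * a + \<beta> * b"
  using assms Youngs_inequality_0[of \<alpha> \<beta> a b] by (cases "a = 0 \<or> b = 0") auto

(* The tangent line of the power function at lambda lies below its graph. *)
lemma epow_tangent:
  assumes m: "1 \<le> m" and l: "0 < l"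
  shows "x \<le> ennreal (l powr (1 - m) / m) * epow m x + ennreal ((1 - 1 / m) * l)"
proof (cases x)
  case (real r)
  \<comment> \<open>Weighted AM-GM with weights 1/m and 1 - 1/m for the numbers l^(1-m) r^m and l,
    whose weighted geometric mean is r.\<close>
  have "(l powr (1 - m) * r powr m) powr (1/m) * l powr (1 - 1/m)
      \<le> 1/m * (l powr (1 - m) * r powr m) + (1 - 1/m) * l"
    using m l real by (intro weighted_AM_GM) auto
  moreover have "(l powr (1 - m) * r powr m) powr (1/m) * l powr (1 - 1/m) = r"
  proof -
    have "(l powr (1 - m) * r powr m) powr (1/m) * l powr (1 - 1/m) =
      r powr (m * (1/m)) * (l powr ((1 - m) * (1/m)) * l powr (1 - 1/m))"
      using l real by (simp add: powr_mult powr_powr)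
    also have "l powr ((1 - m) * (1/m)) * l powr (1 - 1/m) = l powr ((1 - m) * (1/m) + (1 - 1/m))"
      by (simp only: powr_add)
    also have "(1 - m) * (1/m) + (1 - 1/m) = 0" using m by (simp add: field_simps)
    finally show ?thesis using m l real by simp
  qed
  ultimately show ?thesis using m l real
    by (simp add: ennreal_mult[symmetric] ennreal_plus[symmetric] del: ennreal_plus)
next
  case top
  have "0 < l powr (1 - m) / m" using m l by simp
  then show ?thesis using top by (simp add: ennreal_mult_top ennreal_eq_0_iff not_le[symmetric] del: zero_less_divide_iff divide_le_0_iff)
qed

text \<open>The tangent inequality is integrated against k and then optimised over the point of
  tangency. The measure k dM need not have mass 1; only the bound A for its mass enters.\<close>

lemma Jensen_epow:
  assumes [measurable]: "k \<in> borel_measurable M" "g \<in> borel_measurable M"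
    and A: "(\<integral>\<^sup>+x. k x \<partial>M) \<le> ennreal A" "0 < A" and m: "1 \<le> m"
  shows "epow m (\<integral>\<^sup>+x. k x * g x \<partial>M) \<le> ennreal (A powr (m - 1)) * (\<integral>\<^sup>+x. k x * epow m (g x) \<partial>M)"
proof -
  let ?I = "\<integral>\<^sup>+x. k x * g x \<partial>M" and ?J = "\<integral>\<^sup>+x. k x * epow m (g x) \<partial>M"
  have key: "?I \<le> ennreal (l powr (1 - m) / m) * ?J + ennreal ((1 - 1 / m) * l * A)" if l: "0 < l" for l
  proof -
    have "?I \<le> (\<integral>\<^sup>+x. ennreal (l powr (1 - m) / m) * (k x * epow m (g x)) + ennreal ((1 - 1 / m) * l) * k x \<partial>M)"
      using epow_tangent[OF m l] by (intro nn_integral_mono)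
        (metis (no_types, lifting) mult.commute mult.left_commute distrib_left mult_left_mono zero_le)
    also have "\<dots> = ennreal (l powr (1 - m) / m) * ?J + ennreal ((1 - 1 / m) * l) * (\<integral>\<^sup>+x. k x \<partial>M)"
      by (subst nn_integral_add) (auto simp: nn_integral_cmult)
    also have "\<dots> \<le> ennreal (l powr (1 - m) / m) * ?J + ennreal ((1 - 1 / m) * l) * ennreal A"
      by (intro add_left_mono mult_left_mono A) auto
    finally show ?thesis using l m A by (simp add: ennreal_mult[symmetric])
  qed
  consider "?J = \<infinity>" | "?J = 0" | J where "?J = ennreal J" "0 < J"
    by (cases ?J) (auto simp: le_less)
  then show ?thesis
  proof cases
    case 1
    then show ?thesis using A by (simp add: ennreal_mult_top ennreal_eq_0_iff)
  next
    case 2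
    then have "AE x in M. k x * epow m (g x) = 0" by (subst (asm) nn_integral_0_iff_AE) auto
    then have "AE x in M. k x * g x = 0" by eventually_elim (auto simp: epow_eq_0_iff)
    then have "?I = 0" by (subst nn_integral_0_iff_AE) auto
    then show ?thesis by simp
  next
    case 3
    \<comment> \<open>The optimal point of tangency: J = l^m A, and the two terms of
      \<open>key\<close> add up to l A.\<close>
    define l where "l = (J / A) powr (1/m)"
    have l: "0 < l" using 3 A by (simp add: l_def)
    have lm: "l powr m = J / A" using 3 A m by (simp add: l_def powr_powr)
    have J: "J = l powr m * A" using lm A by simp
    have "?I \<le> ennreal (l powr (1 - m) / m * J + (1 - 1 / m) * l * A)"
      using key[OF l] 3 m l A by (simp add: ennreal_mult[symmetric] ennreal_plus[symmetric] del: ennreal_plus)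
    also have "l powr (1 - m) / m * J + (1 - 1 / m) * l * A = l * A"
      unfolding J using l m by (simp add: powr_diff field_simps)
    finally have "epow m ?I \<le> epow m (ennreal (l * A))" using m by (intro epow_mono) auto
    also have "\<dots> = ennreal (A powr (m - 1) * J)"
      using l A m unfolding J by (simp add: powr_mult powr_diff field_simps)
    finally show ?thesis using 3 by (simp add: ennreal_mult)
  qed
qed

text \<open>An upper bound C for the L^m norm instead of the norm itself: no root is taken, f may be
  infinite on a null set, and bounds pass directly to monotone suprema and to smaller
  functions.\<close>

definition Lp_bound :: "real \<Rightarrow> real \<Rightarrow> ('a::euclidean_space \<Rightarrow> ennreal) \<Rightarrow> bool" where
  "Lp_bound m C f \<longleftrightarrow> f \<in> borel_measurable lborel \<and> (\<integral>\<^sup>+x. epow m (f x) \<partial>lborel) \<le> ennreal (C powr m)"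

lemma Lp_bound_measurable: "Lp_bound m C f \<Longrightarrow> f \<in> borel_measurable lborel"
  by (simp add: Lp_bound_def)

lemma Lp_bound_mono_AE:
  assumes "Lp_bound m C f" "C \<le> D" "0 \<le> C" "0 \<le> m" "g \<in> borel_measurable lborel" "AE x in lborel. g x \<le> f x"
  shows "Lp_bound m D g"
proof -
  have "(\<integral>\<^sup>+x. epow m (g x) \<partial>lborel) \<le> (\<integral>\<^sup>+x. epow m (f x) \<partial>lborel)"
    using assms(6) by (intro nn_integral_mono_AE) (auto elim!: eventually_mono intro!: epow_mono assms)
  also have "\<dots> \<le> ennreal (C powr m)" using assms(1) by (simp add: Lp_bound_def)
  also have "\<dots> \<le> ennreal (D powr m)" using assms by (intro ennreal_leI powr_mono2) auto
  finally show ?thesis using assms by (simp add: Lp_bound_def)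
qed

lemma Lp_bound_epow:
  assumes "Lp_bound r A f" "0 \<le> A" "0 < p"
  shows "Lp_bound (r / p) (A powr p) (\<lambda>x. epow p (f x))"
  using assms unfolding Lp_bound_def by (auto simp: epow_epow powr_powr)

lemma Lp_bound_cmult:
  assumes "Lp_bound m A f" "0 \<le> A" "0 \<le> c"
  shows "Lp_bound m (c * A) (\<lambda>x. ennreal c * f x)"
proof -
  have [measurable]: "f \<in> borel_measurable lborel" using assms by (simp add: Lp_bound_def)
  have "(\<integral>\<^sup>+x. epow m (ennreal c * f x) \<partial>lborel) = ennreal (c powr m) * (\<integral>\<^sup>+x. epow m (f x) \<partial>lborel)"
    using assms by (subst nn_integral_cmult[symmetric]) (auto simp: epow_mult)
  also have "\<dots> \<le> ennreal (c powr m) * ennreal (A powr m)"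
    using assms by (intro mult_left_mono) (auto simp: Lp_bound_def)
  finally show ?thesis using assms by (simp add: Lp_bound_def ennreal_mult[symmetric] powr_mult)
qed

lemma Lp_bound_AE_finite:
  assumes "Lp_bound m A f"
  shows "AE x in lborel. f x < \<infinity>"
proof -
  have [measurable]: "f \<in> borel_measurable lborel" using assms by (simp add: Lp_bound_def)
  have "(\<integral>\<^sup>+x. epow m (f x) \<partial>lborel) \<noteq> \<infinity>"
    using assms by (auto simp: Lp_bound_def top_unique)
  then have "AE x in lborel. epow m (f x) \<noteq> \<infinity>" by (intro nn_integral_noteq_infinite) auto
  then show ?thesis by eventually_elim (metis epow_infinity(1) infinity_ennreal_def less_top)
qed

lemma Lp_bound_SUP:
  assumes "\<And>i::nat. Lp_bound m A (f i)" "incseq f" "0 < m"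
  shows "Lp_bound m A (\<lambda>x. SUP i. f i x)"
proof -
  have [measurable]: "f i \<in> borel_measurable lborel" for i using assms(1) by (simp add: Lp_bound_def)
  have "(\<integral>\<^sup>+x. epow m (SUP i. f i x) \<partial>lborel) = (\<integral>\<^sup>+x. (SUP i. epow m (f i x)) \<partial>lborel)"
    using assms by (simp add: epow_SUP)
  also have "\<dots> = (SUP i. \<integral>\<^sup>+x. epow m (f i x) \<partial>lborel)"
    using assms by (intro nn_integral_monotone_convergence_SUP)
      (auto simp: incseq_def le_fun_def intro!: epow_mono)
  also have "\<dots> \<le> ennreal (A powr m)" using assms(1) by (auto simp: Lp_bound_def intro!: SUP_least)
  finally show ?thesis by (simp add: Lp_bound_def)
qed

lemma Lp_bound_tendsto_0_imp_AE_0: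
  assumes "\<And>i::nat. Lp_bound m (A i) f" "\<And>i. 0 \<le> A i" "A \<longlonglongrightarrow> 0" "0 < m"
  shows "AE x in lborel. f x = 0"
proof -
  have [measurable]: "f \<in> borel_measurable lborel" using assms(1) by (simp add: Lp_bound_def)
  have "(\<lambda>i. ennreal (A i powr m)) \<longlonglongrightarrow> ennreal (0 powr m)"
    using assms by (intro tendsto_ennrealI tendsto_powr') auto
  then have "(\<integral>\<^sup>+x. epow m (f x) \<partial>lborel) \<le> ennreal (0 powr m)"
    using assms(1) by (intro LIMSEQ_le_const) (auto simp: Lp_bound_def)
  then have "AE x in lborel. epow m (f x) = 0" by (subst nn_integral_0_iff_AE[symmetric]) auto
  then show ?thesis by eventually_elim (simp add: epow_eq_0_iff)
qed

text \<open>Jensen's inequality for the measure c dM, of mass at most C, applied to F / c, followed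
  by Tonelli. Here c(\<open>\<tau>\<close>) is a bound for the L^q norm of the slice; F has to
  vanish where c does, so that c (F / c) = F everywhere.\<close>

lemma Minkowski_integral:
  fixes F :: "'b \<Rightarrow> 'a::euclidean_space \<Rightarrow> ennreal"
  assumes "sigma_finite_measure M"
    and [measurable]: "case_prod F \<in> borel_measurable (M \<Otimes>\<^sub>M lborel)"
      "c \<in> borel_measurable M"
    and c0: "\<And>\<tau>. \<tau> \<in> space M \<Longrightarrow> 0 \<le> c \<tau>" "\<And>\<tau> x. \<tau> \<in> space M \<Longrightarrow> c \<tau> = 0 \<Longrightarrow> F \<tau> x = 0"
    and F: "\<And>\<tau>. \<tau> \<in> space M \<Longrightarrow> c \<tau> \<noteq> 0 \<Longrightarrow> Lp_bound q (c \<tau>) (F \<tau>)"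
    and C: "(\<integral>\<^sup>+\<tau>. ennreal (c \<tau>) \<partial>M) \<le> ennreal C" "0 < C" and q: "1 \<le> q"
  shows "Lp_bound q C (\<lambda>x. \<integral>\<^sup>+\<tau>. F \<tau> x \<partial>M)"
proof -
  interpret M: sigma_finite_measure M by fact
  interpret P: pair_sigma_finite M lborel ..
  have 1: "epow q (\<integral>\<^sup>+\<tau>. F \<tau> x \<partial>M)
      \<le> ennreal (C powr (q - 1)) * (\<integral>\<^sup>+\<tau>. ennreal (c \<tau> powr (1 - q)) * epow q (F \<tau> x) \<partial>M)" for x
  proof -
    have "epow q (\<integral>\<^sup>+\<tau>. ennreal (c \<tau>) * (ennreal (1 / c \<tau>) * F \<tau> x) \<partial>M)
      \<le> ennreal (C powr (q - 1)) * (\<integral>\<^sup>+\<tau>. ennreal (c \<tau>) * epow q (ennreal (1 / c \<tau>) * F \<tau> x) \<partial>M)"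
      by (intro Jensen_epow C q) measurable
    also have "(\<integral>\<^sup>+\<tau>. ennreal (c \<tau>) * epow q (ennreal (1 / c \<tau>) * F \<tau> x) \<partial>M)
       = (\<integral>\<^sup>+\<tau>. ennreal (c \<tau> powr (1 - q)) * epow q (F \<tau> x) \<partial>M)"
    proof (intro nn_integral_cong)
      fix \<tau> assume t: "\<tau> \<in> space M"
      show "ennreal (c \<tau>) * epow q (ennreal (1 / c \<tau>) * F \<tau> x) = ennreal (c \<tau> powr (1 - q)) * epow q (F \<tau> x)"
      proof (cases "c \<tau> = 0")
        case False
        then have "0 < c \<tau>" using c0(1)[OF t] by simp
        then have "c \<tau> * (1 / c \<tau>) powr q = c \<tau> powr (1 - q)"
          by (simp add: powr_diff powr_divide)
        then have "ennreal (c \<tau>) * ennreal ((1 / c \<tau>) powr q) = ennreal (c \<tau> powr (1 - q))"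
          using \<open>0 < c \<tau>\<close> by (simp add: ennreal_mult[symmetric])
        then show ?thesis using \<open>0 < c \<tau>\<close> by (simp add: epow_mult mult.assoc[symmetric] del: divide_eq_1_iff)
      qed (use c0(2)[OF t] in auto)
    qed
    also have "(\<integral>\<^sup>+\<tau>. ennreal (c \<tau>) * (ennreal (1 / c \<tau>) * F \<tau> x) \<partial>M) = (\<integral>\<^sup>+\<tau>. F \<tau> x \<partial>M)"
    proof (intro nn_integral_cong)
      fix \<tau> assume t: "\<tau> \<in> space M"
      have "ennreal (c \<tau>) * ennreal (1 / c \<tau>) = 1" if "c \<tau> \<noteq> 0"
        using c0(1)[OF t] that by (simp add: ennreal_mult[symmetric])
      then show "ennreal (c \<tau>) * (ennreal (1 / c \<tau>) * F \<tau> x) = F \<tau> x"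
        using c0(2)[OF t] by (cases "c \<tau> = 0") (auto simp: mult.assoc[symmetric])
    qed
    finally show ?thesis .
  qed
  have "(\<integral>\<^sup>+x. epow q (\<integral>\<^sup>+\<tau>. F \<tau> x \<partial>M) \<partial>lborel)
    \<le> (\<integral>\<^sup>+x. ennreal (C powr (q - 1)) * (\<integral>\<^sup>+\<tau>. ennreal (c \<tau> powr (1 - q)) * epow q (F \<tau> x) \<partial>M) \<partial>lborel)"
    by (intro nn_integral_mono 1)
  also have "\<dots> = ennreal (C powr (q - 1)) * (\<integral>\<^sup>+x. (\<integral>\<^sup>+\<tau>. ennreal (c \<tau> powr (1 - q)) * epow q (F \<tau> x) \<partial>M) \<partial>lborel)"
    by (intro nn_integral_cmult) measurable
  also have "(\<integral>\<^sup>+x. (\<integral>\<^sup>+\<tau>. ennreal (c \<tau> powr (1 - q)) * epow q (F \<tau> x) \<partial>M) \<partial>lborel)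
    = (\<integral>\<^sup>+\<tau>. (\<integral>\<^sup>+x. ennreal (c \<tau> powr (1 - q)) * epow q (F \<tau> x) \<partial>lborel) \<partial>M)"
    by (intro P.Fubini') measurable
  also have "\<dots> \<le> (\<integral>\<^sup>+\<tau>. ennreal (c \<tau>) \<partial>M)"
  proof (intro nn_integral_mono)
    fix \<tau> assume t: "\<tau> \<in> space M"
    show "(\<integral>\<^sup>+x. ennreal (c \<tau> powr (1 - q)) * epow q (F \<tau> x) \<partial>lborel) \<le> ennreal (c \<tau>)"
    proof (cases "c \<tau> = 0")
      case False
      then have c: "0 < c \<tau>" using c0(1)[OF t] by simp
      from F[OF t False] have [measurable]: "F \<tau> \<in> borel_measurable lborel" by (simp add: Lp_bound_def)
      have "(\<integral>\<^sup>+x. ennreal (c \<tau> powr (1 - q)) * epow q (F \<tau> x) \<partial>lborel)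
        \<le> ennreal (c \<tau> powr (1 - q)) * ennreal (c \<tau> powr q)"
        using F[OF t False] by (subst nn_integral_cmult) (auto simp: Lp_bound_def intro!: mult_left_mono)
      also have "\<dots> = ennreal (c \<tau>)"
        using c by (simp add: ennreal_mult[symmetric] powr_add[symmetric])
      finally show ?thesis .
    qed simp
  qed
  also have "\<dots> \<le> ennreal C" by fact
  finally have "(\<integral>\<^sup>+x. epow q (\<integral>\<^sup>+\<tau>. F \<tau> x \<partial>M) \<partial>lborel) \<le> ennreal (C powr (q - 1)) * ennreal C"
    by (simp add: mult_left_mono)
  also have "\<dots> = ennreal (C powr q)" using C by (simp add: ennreal_mult[symmetric] powr_diff)
  finally show ?thesis unfolding Lp_bound_def by simp
qed

text \<open>The triangle inequality as the integral inequality over a two-point space. The bounds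
  have to be positive.\<close>

lemma Lp_bound_add:
  assumes f: "Lp_bound q A f" and g: "Lp_bound q B g" and "0 < A" "0 < B" "1 \<le> q"
  shows "Lp_bound q (A + B) (\<lambda>x. f x + g x)"
proof -
  have [measurable]: "f \<in> borel_measurable lborel" "g \<in> borel_measurable lborel"
    using f g by (auto simp: Lp_bound_def)
  let ?M = "count_space (UNIV :: bool set)"
  have "sigma_finite_measure ?M" by (intro sigma_finite_measure_count_space_countable) auto
  then have "Lp_bound q (A + B) (\<lambda>x. \<integral>\<^sup>+b. (if b then f x else g x) \<partial>?M)"
  proof (rule Minkowski_integral[where c="\<lambda>b. if b then A else B"])
    show "(\<lambda>(b, x). if b then f x else g x) \<in> borel_measurable (?M \<Otimes>\<^sub>M lborel)"
      by measurable
  qed (use assms in \<open>auto simp: nn_integral_count_space_finite UNIV_bool add.commute\<close>)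
  then show ?thesis by (simp add: nn_integral_count_space_finite UNIV_bool add.commute)
qed

text \<open>Young's inequality with weights 1 - 1/p and 1/p for (f/A)^r and (g/B)^r, integrated. It
  estimates the linearised source, where f is the majorant and g a difference of solutions.\<close>

lemma Lp_bound_Holder:
  assumes f: "Lp_bound r A f" and g: "Lp_bound r B g" and pos: "0 < A" "0 < B" and p: "1 < p" "p \<le> r"
  shows "Lp_bound (r / p) (A powr (p - 1) * B) (\<lambda>x. epow (p - 1) (f x) * g x)"
proof -
  have [measurable]: "f \<in> borel_measurable lborel" "g \<in> borel_measurable lborel"
    using f g by (auto simp: Lp_bound_def)
  define m where "m = r / p"
  have m: "0 < m" "m * p = r" using p by (auto simp: m_def)
  define D where "D = (A powr (p - 1) * B) powr m"
  have D: "0 < D" using pos by (simp add: D_def)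
  have coeff: "0 < (1 - 1 / p) / A powr r" "0 < p * B powr r" using p pos by auto
  have pt: "epow m (epow (p - 1) (x::ennreal) * y) \<le> ennreal D *
      (ennreal ((1 - 1 / p) / A powr r) * epow r x + ennreal (1 / (p * B powr r)) * epow r y)" for x y
  proof (cases x; cases y)
    fix a b assume ab: "x = ennreal a" "0 \<le> a" "y = ennreal b" "0 \<le> b"
    have "((a / A) powr r) powr (1 - 1/p) * ((b / B) powr r) powr (1 / p)
       \<le> (1 - 1/p) * (a / A) powr r + 1/p * (b / B) powr r"
      using p ab pos by (intro weighted_AM_GM) auto
    moreover have "((a / A) powr r) powr (1 - 1/p) * ((b / B) powr r) powr (1 / p)
       = (a powr (p - 1) * b) powr m / D"
    proof -
      have "r * (1 - 1/p) = (p - 1) * m" "r * (1/p) = m" using p by (auto simp: m_def field_simps)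
      then show ?thesis using ab pos
        by (simp only: powr_powr D_def) (simp add: powr_mult powr_divide powr_powr)
    qed
    ultimately have "(a powr (p - 1) * b) powr m / D \<le> (1 - 1/p) * (a / A) powr r + 1/p * (b / B) powr r"
      by simp
    then have "(a powr (p - 1) * b) powr m \<le> D * ((1 - 1/p) * (a / A) powr r + 1/p * (b / B) powr r)"
      using D by (simp add: divide_le_eq mult.commute)
    also have "\<dots> = D * ((1 - 1 / p) / A powr r * a powr r + 1 / (p * B powr r) * b powr r)"
      using ab pos by (simp add: powr_divide)
    finally show ?thesis using ab p D
      by (simp add: ennreal_mult[symmetric] ennreal_plus[symmetric] del: ennreal_plus)
  qed (use p pos D coeff in \<open>auto simp: ennreal_mult_top ennreal_top_mult ennreal_eq_0_iff not_le[symmetric] simp del: divide_le_0_iff\<close>)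
  have "(\<integral>\<^sup>+x. epow m (epow (p - 1) (f x) * g x) \<partial>lborel) \<le>
      (\<integral>\<^sup>+x. ennreal D * (ennreal ((1 - 1 / p) / A powr r) * epow r (f x) + ennreal (1 / (p * B powr r)) * epow r (g x)) \<partial>lborel)"
    by (intro nn_integral_mono pt)
  also have "\<dots> = ennreal D * (ennreal ((1 - 1 / p) / A powr r) * (\<integral>\<^sup>+x. epow r (f x) \<partial>lborel)
      + ennreal (1 / (p * B powr r)) * (\<integral>\<^sup>+x. epow r (g x) \<partial>lborel))"
    by (simp add: nn_integral_cmult nn_integral_add)
  also have "\<dots> \<le> ennreal D * (ennreal ((1 - 1 / p) / A powr r) * ennreal (A powr r)
      + ennreal (1 / (p * B powr r)) * ennreal (B powr r))"
    using f g by (intro mult_left_mono add_mono) (auto simp: Lp_bound_def)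
  also have "\<dots> = ennreal D"
    using p pos D by (simp add: ennreal_mult[symmetric] ennreal_plus[symmetric] field_simps del: ennreal_plus)
  finally show ?thesis unfolding Lp_bound_def D_def m_def by simp
qed

text \<open>Jensen's inequality bounds g^m by A^(m-1) times the integral of k f^m. Estimating k by B
  there gives a uniform bound, Tonelli gives an integral bound, and g^q interpolates between the
  two. The result serves both the heat kernel and the difference of two heat kernels.\<close>

lemma Schur_test:
  fixes k :: "'a::euclidean_space \<Rightarrow> 'a \<Rightarrow> ennreal"
  assumes [measurable]: "case_prod k \<in> borel_measurable (lborel \<Otimes>\<^sub>M lborel)"
    and k1: "\<And>x. (\<integral>\<^sup>+y. k x y \<partial>lborel) \<le> ennreal A" and k2: "\<And>y. (\<integral>\<^sup>+x. k x y \<partial>lborel) \<le> ennreal A"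
    and kB: "\<And>x y. k x y \<le> ennreal B" and pos: "0 < A" "0 < B" "0 < C"
    and f: "Lp_bound m C f" and m: "1 \<le> m" "m \<le> q"
  shows "Lp_bound q (A powr (1 - (1/m - 1/q)) * B powr (1/m - 1/q) * C) (\<lambda>x. \<integral>\<^sup>+y. k x y * f y \<partial>lborel)"
proof -
  have [measurable]: "f \<in> borel_measurable lborel" using f by (auto simp: Lp_bound_def)
  define g where "g x = (\<integral>\<^sup>+y. k x y * f y \<partial>lborel)" for x
  have [measurable]: "g \<in> borel_measurable lborel" unfolding g_def by measurable
  have f': "(\<integral>\<^sup>+y. epow m (f y) \<partial>lborel) \<le> ennreal (C powr m)" using f by (simp add: Lp_bound_def)
  have J: "epow m (g x) \<le> ennreal (A powr (m - 1)) * (\<integral>\<^sup>+y. k x y * epow m (f y) \<partial>lborel)" for x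
    unfolding g_def using pos m by (intro Jensen_epow k1) auto
  have sup: "epow m (g x) \<le> ennreal (A powr (m - 1) * (B * C powr m))" for x
  proof -
    have "(\<integral>\<^sup>+y. k x y * epow m (f y) \<partial>lborel) \<le> (\<integral>\<^sup>+y. ennreal B * epow m (f y) \<partial>lborel)"
      by (intro nn_integral_mono mult_right_mono kB) auto
    also have "\<dots> \<le> ennreal B * ennreal (C powr m)"
      by (subst nn_integral_cmult) (auto intro!: mult_left_mono f')
    finally have "epow m (g x) \<le> ennreal (A powr (m - 1)) * (ennreal B * ennreal (C powr m))"
      using J[of x] by (meson mult_left_mono order_trans zero_le)
    then show ?thesis using pos by (simp add: ennreal_mult[symmetric])
  qed
  have int: "(\<integral>\<^sup>+x. epow m (g x) \<partial>lborel) \<le> ennreal (A powr m * C powr m)"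
  proof -
    have "(\<integral>\<^sup>+x. epow m (g x) \<partial>lborel) \<le> (\<integral>\<^sup>+x. ennreal (A powr (m - 1)) * (\<integral>\<^sup>+y. k x y * epow m (f y) \<partial>lborel) \<partial>lborel)"
      by (intro nn_integral_mono J)
    also have "\<dots> = ennreal (A powr (m - 1)) * (\<integral>\<^sup>+x. (\<integral>\<^sup>+y. k x y * epow m (f y) \<partial>lborel) \<partial>lborel)"
      by (intro nn_integral_cmult) measurable
    also have "(\<integral>\<^sup>+x. (\<integral>\<^sup>+y. k x y * epow m (f y) \<partial>lborel) \<partial>lborel) = (\<integral>\<^sup>+y. (\<integral>\<^sup>+x. k x y * epow m (f y) \<partial>lborel) \<partial>lborel)"
      by (intro lborel_pair.Fubini') measurable
    also have "\<dots> = (\<integral>\<^sup>+y. (\<integral>\<^sup>+x. k x y \<partial>lborel) * epow m (f y) \<partial>lborel)"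
      by (intro nn_integral_cong nn_integral_multc) measurable
    also have "\<dots> \<le> (\<integral>\<^sup>+y. ennreal A * epow m (f y) \<partial>lborel)"
      by (intro nn_integral_mono mult_right_mono k2) auto
    also have "\<dots> \<le> ennreal A * ennreal (C powr m)"
      by (subst nn_integral_cmult) (auto intro!: mult_left_mono f')
    finally show ?thesis using pos
      by (simp add: ennreal_mult[symmetric] mult_left_mono powr_diff)
  qed
  have "(\<integral>\<^sup>+x. epow q (g x) \<partial>lborel) \<le> ennreal ((A powr (1 - (1/m - 1/q)) * B powr (1/m - 1/q) * C) powr q)"
  proof -
    define D where "D = A powr (m - 1) * (B * C powr m)"
    \<comment> \<open>The exponent m is kept for the integral bound, the surplus q - m is spent on
      the uniform bound.\<close>
    have "epow q (g x) \<le> ennreal (D powr ((q - m) / m)) * epow m (g x)" for x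
    proof -
      have "epow q (g x) = epow ((q - m) / m) (epow m (g x)) * epow m (g x)"
        using m by (simp add: epow_epow epow_add[symmetric])
      also have "\<dots> \<le> epow ((q - m) / m) (ennreal D) * epow m (g x)"
        unfolding D_def using m by (intro mult_right_mono epow_mono sup) auto
      finally show ?thesis using pos by (simp add: D_def)
    qed
    then have "(\<integral>\<^sup>+x. epow q (g x) \<partial>lborel) \<le> (\<integral>\<^sup>+x. ennreal (D powr ((q - m) / m)) * epow m (g x) \<partial>lborel)"
      by (intro nn_integral_mono)
    also have "\<dots> \<le> ennreal (D powr ((q - m) / m)) * ennreal (A powr m * C powr m)"
      by (subst nn_integral_cmult) (auto intro!: mult_left_mono int)
    also have "\<dots> = ennreal (D powr ((q - m) / m) * (A powr m * C powr m))" by (simp add: ennreal_mult)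
    also have "D powr ((q - m) / m) * (A powr m * C powr m)
      = A powr ((m - 1) * ((q - m) / m) + m) * B powr ((q - m) / m) * C powr (m * ((q - m) / m) + m)"
      using pos unfolding D_def by (simp add: powr_mult powr_powr powr_add mult_ac)
    also have "(m - 1) * ((q - m) / m) + m = (1 - (1/m - 1/q)) * q" using m by (simp add: field_simps)
    also have "(q - m) / m = (1/m - 1/q) * q" using m by (simp add: field_simps)
    also have "m * ((1/m - 1/q) * q) + m = q" using m by (simp add: field_simps)
    also have "A powr ((1 - (1/m - 1/q)) * q) * B powr ((1/m - 1/q) * q) * C powr q
       = (A powr (1 - (1/m - 1/q)) * B powr (1/m - 1/q) * C) powr q"
      using pos by (simp add: powr_mult powr_powr)
    finally show ?thesis .
  qed
  then show ?thesis unfolding Lp_bound_def g_def[symmetric] by simp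
qed


section \<open>The heat kernel\<close>

lemma heat_kernel_measurable [measurable]:
  fixes g :: "'b \<Rightarrow> 'a::euclidean_space"
  assumes [measurable]: "f \<in> borel_measurable M" "g \<in> borel_measurable M"
  shows "(\<lambda>z. heat_kernel (f z) (g z)) \<in> borel_measurable M"
  unfolding heat_kernel_def by measurable

lemma heat_kernel_nonneg [simp]: "0 \<le> heat_kernel t x"
  by (simp add: heat_kernel_def)

lemma heat_kernel_uminus: "heat_kernel t (y - x) = heat_kernel t (x - y)"
  by (simp add: heat_kernel_def norm_minus_commute)

lemma heat_kernel_le:
  fixes x :: "'a::euclidean_space"
  assumes "0 < t"
  shows "heat_kernel t x \<le> (4 * pi * t) powr (- (real DIM('a) / 2))"
  using assms unfolding heat_kernel_def by (intro mult_left_le) auto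

text \<open>The kernel is the product over the coordinates of centred normal densities of variance 2
  t.\<close>

lemma nn_integral_heat_kernel:
  assumes t: "0 < t"
  shows "(\<integral>\<^sup>+(x::'a::euclidean_space). ennreal (heat_kernel t x) \<partial>lborel) = 1"
proof -
  let ?\<sigma> = "sqrt (2 * t)"
  have s: "0 < ?\<sigma>" using t by simp
  have "heat_kernel t x = (\<Prod>b\<in>Basis. normal_density 0 ?\<sigma> (x \<bullet> b))" for x :: 'a
  proof -
    have "(\<Prod>b\<in>Basis. normal_density 0 ?\<sigma> (x \<bullet> b))
        = (\<Prod>b\<in>(Basis::'a set). 1 / sqrt (4 * pi * t)) * (\<Prod>b\<in>Basis. exp (- ((x \<bullet> b)\<^sup>2 / (4 * t))))"
    proof -
      have "normal_density 0 ?\<sigma> z = 1 / sqrt (4 * pi * t) * exp (- (z\<^sup>2 / (4 * t)))" for z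
        using t by (simp add: normal_density_def mult_ac)
      then show ?thesis by (simp only: prod.distrib)
    qed
    also have "(\<Prod>b\<in>Basis. exp (- ((x \<bullet> b)\<^sup>2 / (4 * t)))) = exp (- (\<Sum>b\<in>Basis. (x \<bullet> b)\<^sup>2) / (4 * t))"
      by (simp add: exp_sum[symmetric] sum_negf sum_divide_distrib)
    also have "(\<Sum>b\<in>Basis. (x \<bullet> b)\<^sup>2) = (norm x)\<^sup>2"
    proof -
      have "(\<Sum>b\<in>Basis. (x \<bullet> b)\<^sup>2) = (\<Sum>b\<in>Basis. (x \<bullet> b) * (x \<bullet> b))"
        by (rule sum.cong) (auto simp: power2_eq_square)
      also have "\<dots> = x \<bullet> x" by (rule euclidean_inner[symmetric])
      also have "\<dots> = (norm x)\<^sup>2" by (rule dot_square_norm)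
      finally show ?thesis .
    qed
    also have "(\<Prod>b\<in>(Basis::'a set). 1 / sqrt (4 * pi * t)) = (4 * pi * t) powr (- (real DIM('a) / 2))"
    proof -
      have "1 / sqrt (4 * pi * t) = (4 * pi * t) powr (- (1 / 2))"
        using t by (simp add: powr_minus_divide powr_half_sqrt)
      moreover have "((4 * pi * t) powr (- (1 / 2))) ^ DIM('a) = ((4 * pi * t) powr (- (1 / 2))) powr real DIM('a)"
        by (rule powr_realpow[symmetric]) (use t in auto)
      ultimately show ?thesis by (simp add: powr_powr)
    qed
    finally show ?thesis by (simp add: heat_kernel_def)
  qed
  then have "(\<integral>\<^sup>+(x::'a). ennreal (heat_kernel t x) \<partial>lborel)
      = (\<integral>\<^sup>+(x::'a). (\<Prod>b\<in>Basis. ennreal (normal_density 0 ?\<sigma> (x \<bullet> b))) \<partial>lborel)"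
    by (simp add: prod_ennreal)
  also have "\<dots> = (\<Prod>b\<in>(Basis::'a set). (\<integral>\<^sup>+x. ennreal (normal_density 0 ?\<sigma> x) \<partial>lborel))"
    by (intro nn_integral_lborel_prod) auto
  also have "(\<integral>\<^sup>+x. ennreal (normal_density 0 ?\<sigma> x) \<partial>lborel) = 1"
    using s by (subst nn_integral_eq_integral) (auto simp: integrable_normal_density integral_normal_density)
  finally show ?thesis by simp
qed

lemma nn_integral_lborel_shift:
  fixes f :: "'a::euclidean_space \<Rightarrow> ennreal"
  assumes [measurable]: "f \<in> borel_measurable borel"
  shows "(\<integral>\<^sup>+x. f (x - y) \<partial>lborel) = (\<integral>\<^sup>+x. f x \<partial>lborel)"
  by (subst lborel_distr_plus[of "- y", symmetric], subst nn_integral_distr) auto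

text \<open>The prefactor turns the normalising constant for s into that for t; what remains is that
  exp(-|x|^2/(4t)) increases with t.\<close>

lemma heat_kernel_comparison:
  fixes x :: "'a::euclidean_space"
  assumes s: "0 < s" "s \<le> t"
  shows "(s / t) powr (real DIM('a) / 2) * heat_kernel s x \<le> heat_kernel t x"
proof -
  let ?d = "real DIM('a) / 2"
  have "(s / t) powr ?d * (4 * pi * s) powr (- ?d) = (4 * pi * t) powr (- ?d)"
    using s by (simp add: powr_mult powr_divide powr_minus field_simps)
  then have "(s / t) powr ?d * heat_kernel s x = (4 * pi * t) powr (- ?d) * exp (- (norm x)\<^sup>2 / (4 * s))"
    by (simp add: heat_kernel_def mult.assoc[symmetric])
  also have "\<dots> \<le> (4 * pi * t) powr (- ?d) * exp (- (norm x)\<^sup>2 / (4 * t))"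
    using s by (intro mult_left_mono) (auto intro!: divide_left_mono)
  finally show ?thesis by (simp add: heat_kernel_def)
qed

lemma smoothing_exponent_nonneg:
  fixes m q n :: real
  assumes "1 \<le> m" "m \<le> q" "\<gamma> = n / 2 * (1 / m - 1 / q)" "0 \<le> n"
  shows "0 \<le> 1 / m - 1 / q" "0 \<le> \<gamma>"
proof -
  show *: "0 \<le> 1 / m - 1 / q" using assms by (simp add: divide_left_mono)
  show "0 \<le> \<gamma>" unfolding assms using * assms by (intro mult_nonneg_nonneg) auto
qed

text \<open>Schur's test with row and column masses 1 and the supremum (4 \<open>pi\<close>
  t)^(-N/2) of the kernel. The power of 4 \<open>pi\<close> may be dropped because 4
  \<open>pi\<close> >= 1 and \<open>\<gamma>\<close> >= 0, so the constant is 1.\<close>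

lemma heat_smoothing:
  fixes f :: "'a::euclidean_space \<Rightarrow> ennreal"
  assumes t: "0 < t" and C: "0 < C" "Lp_bound m C f" and m: "1 \<le> m" "m \<le> q"
    and g: "\<gamma> = real DIM('a) / 2 * (1 / m - 1 / q)"
  shows "Lp_bound q (t powr - \<gamma> * C) (\<lambda>x. \<integral>\<^sup>+y. ennreal (heat_kernel t (x - y)) * f y \<partial>lborel)"
proof -
  have [measurable]: "f \<in> borel_measurable lborel" using C by (simp add: Lp_bound_def)
  have "Lp_bound q (1 powr (1 - (1/m - 1/q)) * ((4 * pi * t) powr (- (real DIM('a) / 2))) powr (1/m - 1/q) * C)
     (\<lambda>x. \<integral>\<^sup>+y. ennreal (heat_kernel t (x - y)) * f y \<partial>lborel)"
  proof (rule Schur_test)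
    show "(\<integral>\<^sup>+x. ennreal (heat_kernel t (x - y)) \<partial>lborel) \<le> ennreal 1" for y :: 'a
      using t by (subst nn_integral_lborel_shift) (auto simp: nn_integral_heat_kernel)
    then show "(\<integral>\<^sup>+y. ennreal (heat_kernel t (x - y)) \<partial>lborel) \<le> ennreal 1" for x :: 'a
      by (subst heat_kernel_uminus)
  qed (use t C m in \<open>auto intro!: ennreal_leI heat_kernel_le\<close>)
  moreover have "((4 * pi * t) powr (- (real DIM('a) / 2))) powr (1/m - 1/q) \<le> t powr - \<gamma>"
  proof -
    have "0 \<le> \<gamma>" by (rule smoothing_exponent_nonneg[OF m g]) simp
    have "t \<le> 4 * pi * t" using t pi_gt3 by simp
    then have "(4 * pi * t) powr - \<gamma> \<le> t powr - \<gamma>"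
      using t \<open>0 \<le> \<gamma>\<close> by (intro powr_mono2') auto
    then show ?thesis using t by (simp add: powr_powr g)
  qed
  ultimately show ?thesis using C m by (elim Lp_bound_mono_AE) auto
qed

lemma one_minus_powr_ratio_le:
  fixes s t :: real
  assumes "0 < s" "s < t" "0 < n"
  shows "0 < 1 - (s / t) powr (real n / 2)" "1 - (s / t) powr (real n / 2) < 1"
    "1 - (s / t) powr (real n / 2) \<le> real n * ((t - s) / s)"
proof -
  have st: "0 < s / t" "s / t < 1" using assms by auto
  show "0 < 1 - (s / t) powr (real n / 2)"
    using st assms powr_less_mono2[of "real n / 2" "s / t" 1] by simp
  show "1 - (s / t) powr (real n / 2) < 1" using st assms by simp
  \<comment> \<open>The exponent n/2 may be half of an odd number, so Bernoulli's inequality is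
    applied to the n-th power, which is smaller because s/t < 1.\<close>
  have "1 + real n * (- (1 - s / t)) \<le> (1 + - (1 - s / t)) ^ n"
    using st by (intro Bernoulli_inequality) auto
  also have "\<dots> = (s / t) powr real n" using st by (simp add: powr_realpow)
  also have "\<dots> \<le> (s / t) powr (real n / 2)" using st by (intro powr_mono') auto
  finally have "1 - (s / t) powr (real n / 2) \<le> real n * (1 - s / t)" by (simp add: algebra_simps)
  also have "1 - s / t \<le> (t - s) / s"
  proof -
    have "1 - s / t = (t - s) / t" using assms by (simp add: diff_divide_distrib)
    also have "\<dots> \<le> (t - s) / s" using assms by (intro divide_left_mono) auto
    finally show ?thesis .
  qed
  finally show "1 - (s / t) powr (real n / 2) \<le> real n * ((t - s) / s)"
    by (simp add: mult_left_mono)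
qed

(* With lambda = (s/t)^(n/2), the kernel at time t minus lambda times the kernel at time s is
   nonnegative and has mass 1 - lambda; this controls the difference without any derivative. *)
lemma heat_time_difference:
  fixes f :: "'a::euclidean_space \<Rightarrow> ennreal"
  assumes s: "0 < s" "s < t" and C: "0 < C" "Lp_bound m C f" and m: "1 \<le> m" "m \<le> q"
    and g: "\<gamma> = real DIM('a) / 2 * (1 / m - 1 / q)"
    and w: "0 \<le> \<omega>" "\<omega> \<le> 1 - (1 / m - 1 / q)"
  shows "Lp_bound q (2 * real DIM('a) powr \<omega> * (t - s) powr \<omega> * s powr (- \<gamma> - \<omega>) * C)
    (\<lambda>x. \<integral>\<^sup>+y. ennreal \<bar>heat_kernel t (x - y) - heat_kernel s (x - y)\<bar> * f y \<partial>lborel)"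
proof -
  have [measurable]: "f \<in> borel_measurable lborel" using C by (simp add: Lp_bound_def)
  let ?n = "real DIM('a)" and ?\<sigma> = "1 / m - 1 / q"
  define l where "l = (s / t) powr (?n / 2)"
  note l = one_minus_powr_ratio_le[OF s, of "DIM('a)", folded l_def, simplified]
  let ?k = "\<lambda>z::'a. \<bar>heat_kernel t z - heat_kernel s z\<bar>"
  have int: "(\<integral>\<^sup>+z. ennreal (?k z) \<partial>lborel) \<le> ennreal (2 * (1 - l))"
  proof -
    have cmp: "l * heat_kernel s z \<le> heat_kernel t z" for z :: 'a
      unfolding l_def using s by (intro heat_kernel_comparison) auto
    have "(\<integral>\<^sup>+(z::'a). ennreal (heat_kernel t z - l * heat_kernel s z) \<partial>lborel) + ennreal l
      = (\<integral>\<^sup>+(z::'a). ennreal (heat_kernel t z - l * heat_kernel s z) \<partial>lborel)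
          + (\<integral>\<^sup>+(z::'a). ennreal l * ennreal (heat_kernel s z) \<partial>lborel)"
      using s by (simp add: nn_integral_cmult nn_integral_heat_kernel)
    also have "\<dots> = (\<integral>\<^sup>+(z::'a). ennreal (heat_kernel t z) \<partial>lborel)"
      using cmp l by (subst nn_integral_add[symmetric])
        (auto simp: ennreal_mult[symmetric] ennreal_plus[symmetric] simp del: ennreal_plus)
    also have "\<dots> = ennreal (1 - l) + ennreal l"
      using s l by (simp add: nn_integral_heat_kernel ennreal_plus[symmetric] del: ennreal_plus)
    finally have 1: "(\<integral>\<^sup>+(z::'a). ennreal (heat_kernel t z - l * heat_kernel s z) \<partial>lborel) = ennreal (1 - l)"
      by simp
    have "(\<integral>\<^sup>+z. ennreal (?k z) \<partial>lborel)
       \<le> (\<integral>\<^sup>+(z::'a). ennreal (heat_kernel t z - l * heat_kernel s z) + ennreal (1 - l) * ennreal (heat_kernel s z) \<partial>lborel)"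
    proof (intro nn_integral_mono)
      fix z :: 'a
      have "0 \<le> (1 - l) * heat_kernel s z" using l by simp
      then have "?k z \<le> (heat_kernel t z - l * heat_kernel s z) + (1 - l) * heat_kernel s z"
        using cmp[of z] unfolding abs_le_iff by (simp add: algebra_simps)
      then show "ennreal (?k z) \<le> ennreal (heat_kernel t z - l * heat_kernel s z) + ennreal (1 - l) * ennreal (heat_kernel s z)"
        using cmp[of z] l by (simp add: ennreal_mult[symmetric] ennreal_plus[symmetric] ennreal_leI del: ennreal_plus)
    qed
    also have "\<dots> = ennreal (1 - l) + ennreal (1 - l)"
      using s by (simp add: nn_integral_add nn_integral_cmult nn_integral_heat_kernel 1)
    also have "\<dots> = ennreal (2 * (1 - l))" using l by (simp add: ennreal_plus[symmetric] del: ennreal_plus)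
    finally show ?thesis .
  qed
  have "Lp_bound q ((2 * (1 - l)) powr (1 - ?\<sigma>) * ((4 * pi * s) powr (- (?n / 2))) powr ?\<sigma> * C)
     (\<lambda>x. \<integral>\<^sup>+y. ennreal (?k (x - y)) * f y \<partial>lborel)"
  proof (rule Schur_test)
    show *: "(\<integral>\<^sup>+x. ennreal (?k (x - y)) \<partial>lborel) \<le> ennreal (2 * (1 - l))" for y :: 'a
      using int by (subst nn_integral_lborel_shift) auto
    show "(\<integral>\<^sup>+y. ennreal (?k (x - y)) \<partial>lborel) \<le> ennreal (2 * (1 - l))" for x :: 'a
      using *[of x] by (simp add: heat_kernel_uminus[of _ x])
    fix x y :: 'a
    have "heat_kernel t (x - y) \<le> (4 * pi * s) powr (- (?n / 2))"
      using s by (intro order_trans[OF heat_kernel_le] powr_mono2') auto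
    moreover have "heat_kernel s (x - y) \<le> (4 * pi * s) powr (- (?n / 2))"
      using s by (intro heat_kernel_le)
    ultimately show "ennreal (?k (x - y)) \<le> ennreal ((4 * pi * s) powr (- (?n / 2)))"
      by (intro ennreal_leI) (smt (verit) heat_kernel_nonneg)
  qed (use s C m l in auto)
  moreover have "(2 * (1 - l)) powr (1 - ?\<sigma>) * ((4 * pi * s) powr (- (?n / 2))) powr ?\<sigma> * C
      \<le> (2 * ?n powr \<omega> * (t - s) powr \<omega> * s powr (- \<omega>)) * s powr - \<gamma> * C"
  proof (intro mult_mono mult_nonneg_nonneg)
    have "0 \<le> ?\<sigma>" using m by (simp add: divide_left_mono)
    have "0 \<le> \<gamma>" by (rule smoothing_exponent_nonneg[OF m g]) simp
    have "s \<le> 4 * pi * s" using s pi_gt3 by simp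
    then have "(4 * pi * s) powr - \<gamma> \<le> s powr - \<gamma>"
      using s \<open>0 \<le> \<gamma>\<close> by (intro powr_mono2') auto
    then show "((4 * pi * s) powr (- (?n / 2))) powr ?\<sigma> \<le> s powr - \<gamma>"
      using s by (simp add: powr_powr g)
    \<comment> \<open>As 0 < 1 - l < 1, lowering the exponent from 1 - \<open>?\<sigma>\<close> to
      \<open>\<omega>\<close> enlarges the power of 1 - l. Then 1 - l <= n (t - s) / s turns it into
      Hoelder continuity in time of order \<open>\<omega>\<close>, at the cost of
      s^-\<open>\<omega>\<close>.\<close>
    have "(2 * (1 - l)) powr (1 - ?\<sigma>) = 2 powr (1 - ?\<sigma>) * (1 - l) powr (1 - ?\<sigma>)"
      by (rule powr_mult)
    also have "\<dots> \<le> 2 powr 1 * (1 - l) powr \<omega>"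
      using l w \<open>0 \<le> ?\<sigma>\<close> by (intro mult_mono powr_mono powr_mono') auto
    also have "\<dots> \<le> 2 * (?n * ((t - s) / s)) powr \<omega>"
      using l w by (auto intro!: powr_mono2)
    also have "\<dots> = 2 * ?n powr \<omega> * (t - s) powr \<omega> * s powr (- \<omega>)"
      using s by (simp add: powr_mult powr_divide powr_minus_divide)
    finally show "(2 * (1 - l)) powr (1 - ?\<sigma>) \<le> 2 * ?n powr \<omega> * (t - s) powr \<omega> * s powr (- \<omega>)" .
  qed (use C in auto)
  moreover have "s powr (- \<omega>) * s powr - \<gamma> = s powr (- \<gamma> - \<omega>)"
    using powr_add[of s "- \<gamma>" "- \<omega>"] by simp
  then have "(2 * ?n powr \<omega> * (t - s) powr \<omega> * s powr (- \<omega>)) * s powr - \<gamma> * C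
    = 2 * ?n powr \<omega> * (t - s) powr \<omega> * s powr (- \<gamma> - \<omega>) * C"
    by (simp add: mult.assoc)
  ultimately show ?thesis using C m by (elim Lp_bound_mono_AE) auto
qed

section \<open>The Duhamel operator\<close>

text \<open>Extension by 0 outside 0 < \<open>\<tau>\<close> < t lets all Duhamel integrals, for
  different t, range over the same space.\<close>

definition duhamel_kernel :: "real \<Rightarrow> real \<Rightarrow> 'a::euclidean_space \<Rightarrow> real" where
  "duhamel_kernel t \<tau> z = (if 0 < \<tau> \<and> \<tau> < t then heat_kernel (t - \<tau>) z else 0)"

lemma duhamel_kernel_measurable [measurable]:
  fixes g :: "'b \<Rightarrow> 'a::euclidean_space"
  assumes [measurable]: "f \<in> borel_measurable M" "h \<in> borel_measurable M" "g \<in> borel_measurable M"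
  shows "(\<lambda>z. duhamel_kernel (h z) (f z) (g z)) \<in> borel_measurable M"
  unfolding duhamel_kernel_def by measurable

lemma duhamel_kernel_nonneg [simp]: "0 \<le> duhamel_kernel t \<tau> z"
  by (simp add: duhamel_kernel_def)

definition Duhamel_nn :: "(real \<Rightarrow> 'a::euclidean_space \<Rightarrow> ennreal) \<Rightarrow> real \<Rightarrow> 'a \<Rightarrow> ennreal" where
  "Duhamel_nn F t x = (\<integral>\<^sup>+\<tau>. (\<integral>\<^sup>+y. ennreal (duhamel_kernel t \<tau> (x - y)) * F \<tau> y \<partial>lborel) \<partial>lborel)"

text \<open>For s < t this dominates the change of a Duhamel integral between s and t. On s <=
  \<open>\<tau>\<close> < t the kernel for s vanishes, so the contribution of the new time interval
  is included.\<close>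

definition Duhamel_nn_diff :: "(real \<Rightarrow> 'a::euclidean_space \<Rightarrow> ennreal) \<Rightarrow> real \<Rightarrow> real \<Rightarrow> 'a \<Rightarrow> ennreal" where
  "Duhamel_nn_diff F s t x = (\<integral>\<^sup>+\<tau>. (\<integral>\<^sup>+y. ennreal \<bar>duhamel_kernel t \<tau> (x - y) - duhamel_kernel s \<tau> (x - y)\<bar> * F \<tau> y \<partial>lborel) \<partial>lborel)"

text \<open>Rescaling time by t extracts the power of t and leaves a Beta integral over (0,1),
  finite because both exponents are below 1.\<close>

lemma Beta_nn_integral_bound:
  fixes \<gamma> \<kappa> :: real
  assumes "\<gamma> < 1" "\<kappa> < 1"
  shows "\<exists>B>0. \<forall>t>0. (\<integral>\<^sup>+\<tau>. ennreal (indicator {0<..<t} \<tau> * ((t - \<tau>) powr - \<gamma> * \<tau> powr - \<kappa>)) \<partial>lborel)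
     \<le> ennreal (B * t powr (1 - \<gamma> - \<kappa>))"
proof -
  define B where "B = Beta (1 - \<kappa>) (1 - \<gamma>)"
  have B: "0 < B" using assms by (simp add: B_def Beta_def Gamma_real_pos)
  have hi: "((\<lambda>t. t powr - \<kappa> * (1 - t) powr - \<gamma>) has_integral B) {0..1}"
    using has_integral_Beta_real[of "1 - \<kappa>" "1 - \<gamma>"] assms by (simp add: B_def)
  have "(\<integral>\<^sup>+\<tau>. ennreal (indicator {0..1} \<tau> * (\<tau> powr - \<kappa> * (1 - \<tau>) powr - \<gamma>)) \<partial>lborel) = ennreal B"
    using hi by (intro nn_integral_has_integral_lebesgue) auto
  then have one: "(\<integral>\<^sup>+\<tau>. ennreal (indicator {0<..<1} \<tau> * ((1 - \<tau>) powr - \<gamma> * \<tau> powr - \<kappa>)) \<partial>lborel) \<le> ennreal B"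
    by (intro ord_le_eq_trans[OF nn_integral_mono]) (auto simp: indicator_def mult.commute intro!: ennreal_leI)
  have "(\<integral>\<^sup>+\<tau>. ennreal (indicator {0<..<t} \<tau> * ((t - \<tau>) powr - \<gamma> * \<tau> powr - \<kappa>)) \<partial>lborel)
     \<le> ennreal (B * t powr (1 - \<gamma> - \<kappa>))" if t: "0 < t" for t
  proof -
    have "(\<integral>\<^sup>+\<tau>. ennreal (indicator {0<..<t} \<tau> * ((t - \<tau>) powr - \<gamma> * \<tau> powr - \<kappa>)) \<partial>lborel)
      = ennreal t * (\<integral>\<^sup>+\<tau>. ennreal (indicator {0<..<t} (0 + t * \<tau>) * ((t - (0 + t * \<tau>)) powr - \<gamma> * (0 + t * \<tau>) powr - \<kappa>)) \<partial>lborel)"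
      using t by (subst nn_integral_real_affine[where c=t and t=0]) auto
    also have "\<dots> = ennreal t * (\<integral>\<^sup>+\<tau>. ennreal (t powr (- \<gamma> - \<kappa>)) * ennreal (indicator {0<..<1} \<tau> * ((1 - \<tau>) powr - \<gamma> * \<tau> powr - \<kappa>)) \<partial>lborel)"
    proof (intro arg_cong[where f="\<lambda>z. ennreal t * z"] nn_integral_cong)
      fix \<tau> :: real
      show "ennreal (indicator {0<..<t} (0 + t * \<tau>) * ((t - (0 + t * \<tau>)) powr - \<gamma> * (0 + t * \<tau>) powr - \<kappa>)) =
         ennreal (t powr (- \<gamma> - \<kappa>)) * ennreal (indicator {0<..<1} \<tau> * ((1 - \<tau>) powr - \<gamma> * \<tau> powr - \<kappa>))"
      proof (cases "0 < \<tau> \<and> \<tau> < 1")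
        case True
        have "(t - t * \<tau>) powr - \<gamma> * (t * \<tau>) powr - \<kappa> = t powr (- \<gamma> - \<kappa>) * ((1 - \<tau>) powr - \<gamma> * \<tau> powr - \<kappa>)"
        proof -
          have "t - t * \<tau> = t * (1 - \<tau>)" by (simp add: algebra_simps)
          then have "(t - t * \<tau>) powr - \<gamma> * (t * \<tau>) powr - \<kappa> = (t powr - \<gamma> * t powr - \<kappa>) * ((1 - \<tau>) powr - \<gamma> * \<tau> powr - \<kappa>)"
            using True t by (simp add: powr_mult)
          then show ?thesis by (simp add: powr_add[symmetric])
        qed
        then show ?thesis using True t by (simp add: ennreal_mult[symmetric] indicator_def)
      next
        case False
        then have "indicator {0<..<t} (t * \<tau>) = (0::real)" using t by (auto simp: indicator_def zero_less_mult_iff)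
        then show ?thesis using False by (auto simp: indicator_def)
      qed
    qed
    also have "\<dots> \<le> ennreal t * (ennreal (t powr (- \<gamma> - \<kappa>)) * ennreal B)"
      using one by (subst nn_integral_cmult) (auto intro!: mult_left_mono)
    also have "\<dots> = ennreal (B * t powr (1 - \<gamma> - \<kappa>))"
    proof -
      have "t * t powr (- \<gamma> - \<kappa>) = t powr (1 - \<gamma> - \<kappa>)" using t powr_add[of t 1 "- \<gamma> - \<kappa>"] by (simp add: algebra_simps)
      then show ?thesis using t B by (simp add: ennreal_mult[symmetric] mult_ac)
    qed
    finally show ?thesis .
  qed
  then show ?thesis using B by blast
qed

text \<open>Minkowski's inequality in time, smoothing from L^m to L^q at each \<open>\<tau>\<close>,
  and the Beta integral. B is fixed before C, F and t; the later choice of small constants rests on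
  this uniformity.\<close>

lemma Duhamel_bound:
  assumes m: "1 \<le> m" "m \<le> q" and g: "\<gamma> = real DIM('a::euclidean_space) / 2 * (1 / m - 1 / q)" "\<gamma> < 1" and k: "\<kappa> < 1"
  obtains B where "0 < B"
    "\<And>C (F :: real \<Rightarrow> 'a \<Rightarrow> ennreal) t. 0 < C \<Longrightarrow> case_prod F \<in> borel_measurable (lborel \<Otimes>\<^sub>M lborel) \<Longrightarrow>
      (\<And>\<tau>. 0 < \<tau> \<Longrightarrow> Lp_bound m (C * \<tau> powr - \<kappa>) (F \<tau>)) \<Longrightarrow> 0 < t \<Longrightarrow>
      Lp_bound q (B * C * t powr (1 - \<gamma> - \<kappa>)) (Duhamel_nn F t)"
proof -
  obtain B where B: "0 < B" "\<And>t. 0 < t \<Longrightarrow> (\<integral>\<^sup>+\<tau>. ennreal (indicator {0<..<t} \<tau> * ((t - \<tau>) powr - \<gamma> * \<tau> powr - \<kappa>)) \<partial>lborel)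
     \<le> ennreal (B * t powr (1 - \<gamma> - \<kappa>))"
    using Beta_nn_integral_bound[OF g(2) k] by blast
  have "Lp_bound q (B * C * t powr (1 - \<gamma> - \<kappa>)) (Duhamel_nn F t)"
    if C: "0 < C" and [measurable]: "case_prod F \<in> borel_measurable (lborel \<Otimes>\<^sub>M lborel)"
      and F: "\<And>\<tau>. 0 < \<tau> \<Longrightarrow> Lp_bound m (C * \<tau> powr - \<kappa>) (F \<tau>)" and t: "0 < t"
    for C t and F :: "real \<Rightarrow> 'a \<Rightarrow> ennreal"
    unfolding Duhamel_nn_def
  proof (rule Minkowski_integral)
    let ?c = "\<lambda>\<tau>. C * (indicator {0<..<t} \<tau> * ((t - \<tau>) powr - \<gamma> * \<tau> powr - \<kappa>))"
    show "?c \<in> borel_measurable lborel" by measurable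
    show "0 \<le> ?c \<tau>" for \<tau> using C by simp
    fix \<tau> x assume "?c \<tau> = 0"
    then have "\<not> (0 < \<tau> \<and> \<tau> < t)" using C by (auto simp: indicator_def)
    then show "(\<integral>\<^sup>+y. ennreal (duhamel_kernel t \<tau> (x - y)) * F \<tau> y \<partial>lborel) = 0" by (auto simp: duhamel_kernel_def)
  next
    let ?c = "\<lambda>\<tau>. C * (indicator {0<..<t} \<tau> * ((t - \<tau>) powr - \<gamma> * \<tau> powr - \<kappa>))"
    fix \<tau> assume "?c \<tau> \<noteq> 0"
    then have \<tau>: "0 < \<tau>" "\<tau> < t" by (auto simp: indicator_def split: if_splits)
    have "Lp_bound q ((t - \<tau>) powr - \<gamma> * (C * \<tau> powr - \<kappa>)) (\<lambda>x. \<integral>\<^sup>+y. ennreal (heat_kernel (t - \<tau>) (x - y)) * F \<tau> y \<partial>lborel)"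
      using \<tau> C F m g by (intro heat_smoothing) auto
    then show "Lp_bound q (?c \<tau>) (\<lambda>x. \<integral>\<^sup>+y. ennreal (duhamel_kernel t \<tau> (x - y)) * F \<tau> y \<partial>lborel)"
      using \<tau> by (simp add: duhamel_kernel_def indicator_def mult_ac)
  next
    have "(\<integral>\<^sup>+\<tau>. ennreal (C * (indicator {0<..<t} \<tau> * ((t - \<tau>) powr - \<gamma> * \<tau> powr - \<kappa>))) \<partial>lborel)
      = ennreal C * (\<integral>\<^sup>+\<tau>. ennreal (indicator {0<..<t} \<tau> * ((t - \<tau>) powr - \<gamma> * \<tau> powr - \<kappa>)) \<partial>lborel)"
      using C by (subst nn_integral_cmult[symmetric]) (auto simp: ennreal_mult[symmetric])
    also have "\<dots> \<le> ennreal C * ennreal (B * t powr (1 - \<gamma> - \<kappa>))"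
      using B(2)[OF t] by (intro mult_left_mono) auto
    finally show "(\<integral>\<^sup>+\<tau>. ennreal (C * (indicator {0<..<t} \<tau> * ((t - \<tau>) powr - \<gamma> * \<tau> powr - \<kappa>))) \<partial>lborel)
      \<le> ennreal (B * C * t powr (1 - \<gamma> - \<kappa>))"
      using C B by (simp add: ennreal_mult[symmetric] mult_ac)
  qed (use m C B t in \<open>auto intro: sigma_finite_lborel\<close>)
  from that[OF B(1) this] show thesis .
qed

text \<open>Before time s both kernels are present and \<open>heat_time_difference\<close> applies;
  from s on only the kernel for t is left. Each case costs an extra factor of order
  -\<open>\<omega>\<close> in the distance to the final time, so \<open>\<gamma>\<close> +
  \<open>\<omega>\<close> < 1 is what the Beta integrals require.\<close>

lemma Duhamel_time_difference:
  assumes m: "1 \<le> m" "m \<le> q" and g: "\<gamma> = real DIM('a::euclidean_space) / 2 * (1 / m - 1 / q)" and k: "\<kappa> < 1"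
    and w: "0 \<le> \<omega>" "\<omega> \<le> 1 - (1 / m - 1 / q)" "\<gamma> + \<omega> < 1"
  obtains B where "0 < B"
    "\<And>C (F :: real \<Rightarrow> 'a \<Rightarrow> ennreal) s t. 0 < C \<Longrightarrow> case_prod F \<in> borel_measurable (lborel \<Otimes>\<^sub>M lborel) \<Longrightarrow>
      (\<And>\<tau>. 0 < \<tau> \<Longrightarrow> Lp_bound m (C * \<tau> powr - \<kappa>) (F \<tau>)) \<Longrightarrow> 0 < s \<Longrightarrow> s < t \<Longrightarrow>
      Lp_bound q (B * C * (t - s) powr \<omega> * (s powr (1 - \<gamma> - \<omega> - \<kappa>) + t powr (1 - \<gamma> - \<omega> - \<kappa>))) (Duhamel_nn_diff F s t)"
proof -
  let ?n = "real DIM('a)"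
  let ?h = "\<lambda>t \<tau>. indicator {0<..<t} \<tau> * ((t - \<tau>) powr - (\<gamma> + \<omega>) * \<tau> powr - \<kappa>)"
  obtain B0 where B0: "0 < B0" "\<And>t. 0 < t \<Longrightarrow> (\<integral>\<^sup>+\<tau>. ennreal (?h t \<tau>) \<partial>lborel)
     \<le> ennreal (B0 * t powr (1 - (\<gamma> + \<omega>) - \<kappa>))"
    using Beta_nn_integral_bound[OF w(3) k] by blast
  \<comment> \<open>2 n^\<open>\<omega>\<close> is the constant of
    \<open>heat_time_difference\<close>; the added 1 covers the times after s, where only smoothing
    is used.\<close>
  define A where "A = 2 * ?n powr \<omega> + 1"
  have A: "1 \<le> A" "2 * ?n powr \<omega> \<le> A" by (auto simp: A_def)
  define B where "B = A * B0"
  have B: "0 < B" using A B0 by (simp add: B_def)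
  have "Lp_bound q (B * C * (t - s) powr \<omega> * (s powr (1 - \<gamma> - \<omega> - \<kappa>) + t powr (1 - \<gamma> - \<omega> - \<kappa>))) (Duhamel_nn_diff F s t)"
    if C: "0 < C" and [measurable]: "case_prod F \<in> borel_measurable (lborel \<Otimes>\<^sub>M lborel)"
      and F: "\<And>\<tau>. 0 < \<tau> \<Longrightarrow> Lp_bound m (C * \<tau> powr - \<kappa>) (F \<tau>)" and s: "0 < s" "s < t"
    for C s t and F :: "real \<Rightarrow> 'a \<Rightarrow> ennreal"
    unfolding Duhamel_nn_diff_def
  proof (rule Minkowski_integral)
    let ?c = "\<lambda>\<tau>. A * C * (t - s) powr \<omega> * (?h s \<tau> + ?h t \<tau>)"
    have h0: "0 \<le> ?h t \<tau>" for t \<tau> by simp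
    show "?c \<in> borel_measurable lborel" by measurable
    show c0: "0 \<le> ?c \<tau>" for \<tau> using C A by simp
    have AC: "0 < A * C * (t - s) powr \<omega>" using A C s by simp
    { fix \<tau> x assume "?c \<tau> = 0"
      then have "?h s \<tau> + ?h t \<tau> = 0" using AC by (metis less_irrefl mult_eq_0_iff)
      then have "?h t \<tau> = 0" using h0[of s \<tau>] h0[of t \<tau>] by linarith
      then have "\<not> (0 < \<tau> \<and> \<tau> < t)" by (auto simp: indicator_def)
      then show "(\<integral>\<^sup>+y. ennreal \<bar>duhamel_kernel t \<tau> (x - y) - duhamel_kernel s \<tau> (x - y)\<bar> * F \<tau> y \<partial>lborel) = 0"
        using s by (auto simp: duhamel_kernel_def) }
    { fix \<tau> assume "?c \<tau> \<noteq> 0"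
      moreover have "?h s \<tau> = 0 \<and> ?h t \<tau> = 0" if "\<not> (0 < \<tau> \<and> \<tau> < t)"
        using that s by (auto simp: indicator_def)
      ultimately have \<tau>: "0 < \<tau>" "\<tau> < t" by (metis add_0 mult_zero_right)+
      show "Lp_bound q (?c \<tau>) (\<lambda>x. \<integral>\<^sup>+y. ennreal \<bar>duhamel_kernel t \<tau> (x - y) - duhamel_kernel s \<tau> (x - y)\<bar> * F \<tau> y \<partial>lborel)"
      proof (cases "\<tau> < s")
        case True
        have "Lp_bound q (2 * ?n powr \<omega> * ((t - \<tau>) - (s - \<tau>)) powr \<omega> * (s - \<tau>) powr (- \<gamma> - \<omega>) * (C * \<tau> powr - \<kappa>))
          (\<lambda>x. \<integral>\<^sup>+y. ennreal \<bar>heat_kernel (t - \<tau>) (x - y) - heat_kernel (s - \<tau>) (x - y)\<bar> * F \<tau> y \<partial>lborel)"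
          using True \<tau> s C F m g w by (intro heat_time_difference) auto
        moreover have "2 * ?n powr \<omega> * ((t - \<tau>) - (s - \<tau>)) powr \<omega> * (s - \<tau>) powr (- \<gamma> - \<omega>) * (C * \<tau> powr - \<kappa>) \<le> ?c \<tau>"
        proof -
          have "2 * ?n powr \<omega> * ((t - \<tau>) - (s - \<tau>)) powr \<omega> * (s - \<tau>) powr (- \<gamma> - \<omega>) * (C * \<tau> powr - \<kappa>)
            = 2 * ?n powr \<omega> * (C * (t - s) powr \<omega> * ?h s \<tau>)" using True \<tau> by (simp add: indicator_def mult_ac)
          also have "\<dots> \<le> A * (C * (t - s) powr \<omega> * (?h s \<tau> + ?h t \<tau>))"
            using A C h0[of t \<tau>] h0[of s \<tau>] by (intro mult_mono) auto
          finally show ?thesis by (simp add: mult_ac)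
        qed
        ultimately show ?thesis using True \<tau> C m by (elim Lp_bound_mono_AE) (auto simp: duhamel_kernel_def)
      next
        case False
        have "Lp_bound q ((t - \<tau>) powr - \<gamma> * (C * \<tau> powr - \<kappa>)) (\<lambda>x. \<integral>\<^sup>+y. ennreal (heat_kernel (t - \<tau>) (x - y)) * F \<tau> y \<partial>lborel)"
          using \<tau> C F m g by (intro heat_smoothing) auto
        moreover have "(t - \<tau>) powr - \<gamma> * (C * \<tau> powr - \<kappa>) \<le> ?c \<tau>"
        proof -
          \<comment> \<open>For s <= \<open>\<tau>\<close> < t one has t - \<open>\<tau>\<close> <=
            t - s, so a factor of order \<open>\<omega>\<close> can be split off and bounded by (t -
            s)^\<open>\<omega>\<close>.\<close>
          have "(t - \<tau>) powr - \<gamma> = (t - \<tau>) powr \<omega> * (t - \<tau>) powr - (\<gamma> + \<omega>)"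
            by (simp add: powr_add[symmetric])
          also have "\<dots> \<le> (t - s) powr \<omega> * (t - \<tau>) powr - (\<gamma> + \<omega>)"
            using False \<tau> s w by (intro mult_right_mono powr_mono2) auto
          finally have "(t - \<tau>) powr - \<gamma> * (C * \<tau> powr - \<kappa>) \<le> (t - s) powr \<omega> * (t - \<tau>) powr - (\<gamma> + \<omega>) * (C * \<tau> powr - \<kappa>)"
            using C by (intro mult_right_mono) auto
          also have "\<dots> = 1 * (C * (t - s) powr \<omega> * ?h t \<tau>)" using \<tau> by (simp add: indicator_def mult_ac)
          also have "\<dots> \<le> A * (C * (t - s) powr \<omega> * (?h s \<tau> + ?h t \<tau>))"
            using A C h0[of t \<tau>] h0[of s \<tau>] by (intro mult_mono) auto
          finally show ?thesis by (simp add: mult_ac)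
        qed
        ultimately show ?thesis using False \<tau> C m by (elim Lp_bound_mono_AE) (auto simp: duhamel_kernel_def)
      qed }
    have "(\<integral>\<^sup>+\<tau>. ennreal (?c \<tau>) \<partial>lborel) = (\<integral>\<^sup>+\<tau>. ennreal (A * C * (t - s) powr \<omega>) * (ennreal (?h s \<tau>) + ennreal (?h t \<tau>)) \<partial>lborel)"
      using AC by (intro nn_integral_cong) (simp add: ennreal_mult[symmetric] ennreal_plus[symmetric] del: ennreal_plus)
    also have "\<dots> = ennreal (A * C * (t - s) powr \<omega>) * ((\<integral>\<^sup>+\<tau>. ennreal (?h s \<tau>) \<partial>lborel) + (\<integral>\<^sup>+\<tau>. ennreal (?h t \<tau>) \<partial>lborel))"
      by (subst nn_integral_cmult, measurable, subst nn_integral_add) auto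
    also have "\<dots> \<le> ennreal (A * C * (t - s) powr \<omega>) * (ennreal (B0 * s powr (1 - (\<gamma> + \<omega>) - \<kappa>)) + ennreal (B0 * t powr (1 - (\<gamma> + \<omega>) - \<kappa>)))"
      using s by (intro mult_left_mono add_mono B0(2)) auto
    also have "\<dots> = ennreal (B * C * (t - s) powr \<omega> * (s powr (1 - \<gamma> - \<omega> - \<kappa>) + t powr (1 - \<gamma> - \<omega> - \<kappa>)))"
      using AC B0 by (simp add: ennreal_mult[symmetric] ennreal_plus[symmetric] B_def algebra_simps del: ennreal_plus)
    finally show "(\<integral>\<^sup>+\<tau>. ennreal (?c \<tau>) \<partial>lborel) \<le> ennreal (B * C * (t - s) powr \<omega> * (s powr (1 - \<gamma> - \<omega> - \<kappa>) + t powr (1 - \<gamma> - \<omega> - \<kappa>)))" .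
    show "0 < B * C * (t - s) powr \<omega> * (s powr (1 - \<gamma> - \<omega> - \<kappa>) + t powr (1 - \<gamma> - \<omega> - \<kappa>))"
      using B C s by (intro mult_pos_pos add_pos_pos) auto
  qed (use m in \<open>auto intro: sigma_finite_lborel\<close>)
  from that[OF B this] show thesis .
qed


section \<open>The signed Duhamel operator and its control by the nonnegative one\<close>

abbreviation lborel2 :: "(real \<times> 'a::euclidean_space) measure" where
  "lborel2 \<equiv> lborel \<Otimes>\<^sub>M lborel"

text \<open>A single integral over the product space: measurability in (t, x) and additivity are
  immediate, and the iterated form of the mild formulation is recovered by Fubini in
  \<open>Duhamel_iterated\<close>.\<close>

definition Duhamel :: "(real \<Rightarrow> 'a::euclidean_space \<Rightarrow> real) \<Rightarrow> real \<Rightarrow> 'a \<Rightarrow> real" where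
  "Duhamel F t x = (LINT z|lborel2. duhamel_kernel t (fst z) (x - snd z) * F (fst z) (snd z))"

lemma Duhamel_nn_measurable [measurable]:
  fixes F :: "real \<Rightarrow> 'a::euclidean_space \<Rightarrow> ennreal"
  assumes [measurable]: "case_prod F \<in> borel_measurable lborel2"
  shows "case_prod (Duhamel_nn F) \<in> borel_measurable lborel2"
  unfolding Duhamel_nn_def by measurable

lemma Duhamel_measurable [measurable]:
  fixes F :: "real \<Rightarrow> 'a::euclidean_space \<Rightarrow> real"
  assumes [measurable]: "case_prod F \<in> borel_measurable lborel2"
  shows "case_prod (Duhamel F) \<in> borel_measurable lborel2"
  unfolding Duhamel_def by measurable

lemma Duhamel_nn_pair:
  fixes F :: "real \<Rightarrow> 'a::euclidean_space \<Rightarrow> ennreal"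
  assumes [measurable]: "case_prod F \<in> borel_measurable lborel2"
  shows "Duhamel_nn F t x = (\<integral>\<^sup>+z. ennreal (duhamel_kernel t (fst z) (x - snd z)) * F (fst z) (snd z) \<partial>lborel2)"
  unfolding Duhamel_nn_def by (subst lborel.nn_integral_fst[symmetric]) auto

lemma Duhamel_nn_mono:
  assumes "\<And>\<tau>. 0 < \<tau> \<Longrightarrow> \<tau> < t \<Longrightarrow> AE y in lborel. F \<tau> y \<le> G \<tau> y"
  shows "Duhamel_nn F t x \<le> Duhamel_nn G t x"
  unfolding Duhamel_nn_def
proof (rule nn_integral_mono)
  fix \<tau> :: real
  show "(\<integral>\<^sup>+ y. ennreal (duhamel_kernel t \<tau> (x - y)) * F \<tau> y \<partial>lborel) \<le> (\<integral>\<^sup>+ y. ennreal (duhamel_kernel t \<tau> (x - y)) * G \<tau> y \<partial>lborel)"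
  proof (cases "0 < \<tau> \<and> \<tau> < t")
    case True
    then have "AE y in lborel. F \<tau> y \<le> G \<tau> y" using assms by auto
    then show ?thesis by (intro nn_integral_mono_AE) (auto elim!: eventually_mono intro!: mult_left_mono)
  qed (auto simp: duhamel_kernel_def)
qed

lemma Duhamel_cong:
  assumes "\<And>\<tau>. 0 < \<tau> \<Longrightarrow> \<tau> < t \<Longrightarrow> F \<tau> = G \<tau>"
  shows "Duhamel F t x = Duhamel G t x"
  unfolding Duhamel_def using assms by (intro Bochner_Integration.integral_cong) (auto simp: duhamel_kernel_def)

lemma Duhamel_nn_eq_0:
  assumes "\<And>\<tau>. 0 < \<tau> \<Longrightarrow> \<tau> < t \<Longrightarrow> AE y in lborel. F \<tau> y = 0"
  shows "Duhamel_nn F t x = 0"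
proof -
  have "Duhamel_nn F t x \<le> Duhamel_nn (\<lambda>_ _. 0) t x"
    by (intro Duhamel_nn_mono) (use assms in \<open>auto elim!: eventually_mono\<close>)
  then show ?thesis by (simp add: Duhamel_nn_def)
qed

lemma Duhamel_nn_SUP:
  fixes F :: "nat \<Rightarrow> real \<Rightarrow> 'a::euclidean_space \<Rightarrow> ennreal"
  assumes [measurable]: "\<And>i. case_prod (F i) \<in> borel_measurable lborel2" and inc: "\<And>\<tau> y. incseq (\<lambda>i. F i \<tau> y)"
  shows "Duhamel_nn (\<lambda>\<tau> y. SUP i. F i \<tau> y) t x = (SUP i. Duhamel_nn (F i) t x)"
proof -
  have "Duhamel_nn (\<lambda>\<tau> y. SUP i. F i \<tau> y) t x
    = (\<integral>\<^sup>+z. (SUP i. ennreal (duhamel_kernel t (fst z) (x - snd z)) * F i (fst z) (snd z)) \<partial>lborel2)"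
    by (subst Duhamel_nn_pair, measurable) (simp add: SUP_mult_left_ennreal)
  also have "\<dots> = (SUP i. \<integral>\<^sup>+z. ennreal (duhamel_kernel t (fst z) (x - snd z)) * F i (fst z) (snd z) \<partial>lborel2)"
    using inc by (intro nn_integral_monotone_convergence_SUP) (auto simp: incseq_def le_fun_def intro!: mult_left_mono)
  finally show ?thesis by (simp add: Duhamel_nn_pair)
qed

text \<open>For c > 0 multiplication can be undone by 1/c. Finiteness of the factor is essential:
  with an infinite factor the sequence 1/n would be a counterexample.\<close>

lemma INF_cmult_ennreal:
  fixes f :: "nat \<Rightarrow> ennreal"
  assumes "0 \<le> c"
  shows "ennreal c * (INF i. f i) = (INF i. ennreal c * f i)"
proof (cases "c = 0")
  case False
  then have c: "ennreal c * ennreal (1 / c) = 1" using assms by (simp add: ennreal_mult[symmetric])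
  show ?thesis
  proof (rule antisym)
    have "ennreal (1 / c) * (INF i. ennreal c * f i) \<le> (INF i. f i)"
    proof (rule INF_greatest)
      fix i
      have "ennreal (1 / c) * (INF i. ennreal c * f i) \<le> ennreal (1 / c) * (ennreal c * f i)"
        by (intro mult_left_mono INF_lower) auto
      also have "\<dots> = f i" using c by (simp add: mult.assoc[symmetric] mult.commute)
      finally show "ennreal (1 / c) * (INF i. ennreal c * f i) \<le> f i" .
    qed
    then have "ennreal c * (ennreal (1 / c) * (INF i. ennreal c * f i)) \<le> ennreal c * (INF i. f i)"
      by (rule mult_left_mono) simp
    then show "(INF i. ennreal c * f i) \<le> ennreal c * (INF i. f i)"
      using c by (simp add: mult.assoc[symmetric])
  qed (auto intro!: INF_greatest mult_left_mono INF_lower)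
qed simp

lemma Duhamel_nn_INF:
  fixes F :: "nat \<Rightarrow> real \<Rightarrow> 'a::euclidean_space \<Rightarrow> ennreal"
  assumes [measurable]: "\<And>i. case_prod (F i) \<in> borel_measurable lborel2" and dec: "\<And>\<tau> y. decseq (\<lambda>i. F i \<tau> y)"
    and fin: "Duhamel_nn (F 0) t x < \<infinity>"
  shows "Duhamel_nn (\<lambda>\<tau> y. INF i. F i \<tau> y) t x = (INF i. Duhamel_nn (F i) t x)"
proof -
  have "Duhamel_nn (\<lambda>\<tau> y. INF i. F i \<tau> y) t x
    = (\<integral>\<^sup>+z. (INF i. ennreal (duhamel_kernel t (fst z) (x - snd z)) * F i (fst z) (snd z)) \<partial>lborel2)"
    by (subst Duhamel_nn_pair, measurable) (simp add: INF_cmult_ennreal)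
  also have "\<dots> = (INF i. \<integral>\<^sup>+z. ennreal (duhamel_kernel t (fst z) (x - snd z)) * F i (fst z) (snd z) \<partial>lborel2)"
  proof (rule nn_integral_monotone_convergence_INF_AE')
    show "AE z in lborel2. ennreal (duhamel_kernel t (fst z) (x - snd z)) * F (Suc i) (fst z) (snd z)
      \<le> ennreal (duhamel_kernel t (fst z) (x - snd z)) * F i (fst z) (snd z)" for i
      using dec by (intro AE_I2 mult_left_mono) (auto simp: decseq_Suc_iff)
  qed (use fin in \<open>auto simp: Duhamel_nn_pair\<close>)
  finally show ?thesis by (simp add: Duhamel_nn_pair)
qed

lemma Duhamel_integrable:
  fixes F :: "real \<Rightarrow> 'a::euclidean_space \<Rightarrow> real"
  assumes [measurable]: "case_prod F \<in> borel_measurable lborel2"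
    and fin: "Duhamel_nn (\<lambda>\<tau> y. ennreal \<bar>F \<tau> y\<bar>) t x < \<infinity>"
  shows "integrable lborel2 (\<lambda>z. duhamel_kernel t (fst z) (x - snd z) * F (fst z) (snd z))"
proof (rule integrableI_bounded)
  have "(\<integral>\<^sup>+z. ennreal (norm (duhamel_kernel t (fst z) (x - snd z) * F (fst z) (snd z))) \<partial>lborel2)
    = Duhamel_nn (\<lambda>\<tau> y. ennreal \<bar>F \<tau> y\<bar>) t x"
    by (subst Duhamel_nn_pair, measurable) (simp add: abs_mult ennreal_mult)
  then show "(\<integral>\<^sup>+z. ennreal (norm (duhamel_kernel t (fst z) (x - snd z) * F (fst z) (snd z))) \<partial>lborel2) < \<infinity>"
    using fin by simp
qed measurable

text \<open>Integrability is not assumed: the Bochner integral of a non-integrable function is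
  0.\<close>

lemma abs_integral_le_nn_integral:
  fixes f :: "'b \<Rightarrow> real"
  shows "ennreal \<bar>integral\<^sup>L M f\<bar> \<le> (\<integral>\<^sup>+x. ennreal \<bar>f x\<bar> \<partial>M)"
  using integral_norm_bound_ennreal[of M f] by (cases "integrable M f") (auto simp: not_integrable_integral_eq)

lemma Duhamel_le:
  fixes F :: "real \<Rightarrow> 'a::euclidean_space \<Rightarrow> real"
  assumes [measurable]: "case_prod F \<in> borel_measurable lborel2"
  shows "ennreal \<bar>Duhamel F t x\<bar> \<le> Duhamel_nn (\<lambda>\<tau> y. ennreal \<bar>F \<tau> y\<bar>) t x"
proof -
  have "Duhamel_nn (\<lambda>\<tau> y. ennreal \<bar>F \<tau> y\<bar>) t x
     = (\<integral>\<^sup>+z. ennreal \<bar>duhamel_kernel t (fst z) (x - snd z) * F (fst z) (snd z)\<bar> \<partial>lborel2)"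
    by (subst Duhamel_nn_pair, measurable) (simp add: abs_mult ennreal_mult)
  then show ?thesis unfolding Duhamel_def using abs_integral_le_nn_integral by simp
qed

lemma Duhamel_diff_le:
  fixes F :: "real \<Rightarrow> 'a::euclidean_space \<Rightarrow> real"
  assumes [measurable]: "case_prod F \<in> borel_measurable lborel2" "case_prod G \<in> borel_measurable lborel2"
    and fin: "Duhamel_nn (\<lambda>\<tau> y. ennreal \<bar>F \<tau> y\<bar>) t x < \<infinity>" "Duhamel_nn (\<lambda>\<tau> y. ennreal \<bar>G \<tau> y\<bar>) t x < \<infinity>"
  shows "ennreal \<bar>Duhamel F t x - Duhamel G t x\<bar> \<le> Duhamel_nn (\<lambda>\<tau> y. ennreal \<bar>F \<tau> y - G \<tau> y\<bar>) t x"
proof -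
  have "Duhamel F t x - Duhamel G t x = Duhamel (\<lambda>\<tau> y. F \<tau> y - G \<tau> y) t x"
    unfolding Duhamel_def using fin
    by (subst Bochner_Integration.integral_diff[symmetric]) (auto intro!: Duhamel_integrable simp: right_diff_distrib)
  then show ?thesis using Duhamel_le[of "\<lambda>\<tau> y. F \<tau> y - G \<tau> y" t x] by simp
qed

lemma Duhamel_time_diff_le:
  fixes F :: "real \<Rightarrow> 'a::euclidean_space \<Rightarrow> real"
  assumes [measurable]: "case_prod F \<in> borel_measurable lborel2"
    and fin: "Duhamel_nn (\<lambda>\<tau> y. ennreal \<bar>F \<tau> y\<bar>) t x < \<infinity>" "Duhamel_nn (\<lambda>\<tau> y. ennreal \<bar>F \<tau> y\<bar>) s x < \<infinity>"
  shows "ennreal \<bar>Duhamel F t x - Duhamel F s x\<bar> \<le> Duhamel_nn_diff (\<lambda>\<tau> y. ennreal \<bar>F \<tau> y\<bar>) s t x"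
proof -
  have "Duhamel F t x - Duhamel F s x = (LINT z|lborel2. (duhamel_kernel t (fst z) (x - snd z) - duhamel_kernel s (fst z) (x - snd z)) * F (fst z) (snd z))"
    unfolding Duhamel_def using fin
    by (subst Bochner_Integration.integral_diff[symmetric]) (auto intro!: Duhamel_integrable simp: left_diff_distrib)
  then have "ennreal \<bar>Duhamel F t x - Duhamel F s x\<bar>
    \<le> (\<integral>\<^sup>+z. ennreal \<bar>(duhamel_kernel t (fst z) (x - snd z) - duhamel_kernel s (fst z) (x - snd z)) * F (fst z) (snd z)\<bar> \<partial>lborel2)"
    using abs_integral_le_nn_integral by simp
  also have "\<dots> = Duhamel_nn_diff (\<lambda>\<tau> y. ennreal \<bar>F \<tau> y\<bar>) s t x"
    unfolding Duhamel_nn_diff_def by (subst lborel.nn_integral_fst[symmetric]) (auto simp: abs_mult ennreal_mult)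
  finally show ?thesis .
qed

text \<open>Finiteness of the nonnegative integral at one point (t, x) yields, by Fubini, every
  convergence statement that the mild formulation makes at that point.\<close>

lemma Duhamel_iterated:
  fixes F :: "real \<Rightarrow> 'a::euclidean_space \<Rightarrow> real"
  assumes [measurable]: "case_prod F \<in> borel_measurable lborel2"
    and fin: "Duhamel_nn (\<lambda>\<tau> y. ennreal \<bar>F \<tau> y\<bar>) t x < \<infinity>"
  shows "AE \<tau> in lborel. \<tau> \<in> {0<..<t} \<longrightarrow> heat_semigroup_defined (t - \<tau>) (F \<tau>) x"
    and "set_integrable lborel {0<..<t} (\<lambda>\<tau>. heat_semigroup (t - \<tau>) (F \<tau>) x)"
    and "Duhamel F t x = (LINT \<tau>:{0<..<t}|lborel. heat_semigroup (t - \<tau>) (F \<tau>) x)"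
proof -
  have int: "integrable lborel2 (\<lambda>(\<tau>, y). duhamel_kernel t \<tau> (x - y) * F \<tau> y)"
    using Duhamel_integrable[OF assms] by (simp add: case_prod_beta')
  show "AE \<tau> in lborel. \<tau> \<in> {0<..<t} \<longrightarrow> heat_semigroup_defined (t - \<tau>) (F \<tau>) x"
    using lborel_pair.AE_integrable_fst'[OF int]
    by eventually_elim (auto simp: heat_semigroup_defined_def duhamel_kernel_def)
  have eq: "(\<lambda>\<tau>. indicator {0<..<t} \<tau> *\<^sub>R heat_semigroup (t - \<tau>) (F \<tau>) x) = (\<lambda>\<tau>. LINT y|lborel. duhamel_kernel t \<tau> (x - y) * F \<tau> y)"
  proof
    fix \<tau>
    show "indicator {0<..<t} \<tau> *\<^sub>R heat_semigroup (t - \<tau>) (F \<tau>) x = (LINT y|lborel. duhamel_kernel t \<tau> (x - y) * F \<tau> y)"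
      by (cases "0 < \<tau> \<and> \<tau> < t") (auto simp: heat_semigroup_def duhamel_kernel_def indicator_def)
  qed
  show "set_integrable lborel {0<..<t} (\<lambda>\<tau>. heat_semigroup (t - \<tau>) (F \<tau>) x)"
    unfolding set_integrable_def eq using lborel_pair.integrable_fst'[OF int] by simp
  show "Duhamel F t x = (LINT \<tau>:{0<..<t}|lborel. heat_semigroup (t - \<tau>) (F \<tau>) x)"
    unfolding set_lebesgue_integral_def eq Duhamel_def using lborel_pair.integral_fst'[OF int]
    by (simp add: case_prod_beta')
qed

text \<open>The mean value inequality in a form that includes 0: it is p z <= z^p + p - 1 for z = a
  / b, multiplied by b^p. It makes |u|^p Lipschitz below a majorant v.\<close>

lemma powr_diff_le:
  fixes x y v :: real
  assumes "1 < p" "\<bar>x\<bar> \<le> v" "\<bar>y\<bar> \<le> v"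
  shows "\<bar>\<bar>x\<bar> powr p - \<bar>y\<bar> powr p\<bar> \<le> p * v powr (p - 1) * \<bar>x - y\<bar>"
proof -
  have *: "b powr p - a powr p \<le> p * v powr (p - 1) * (b - a)" if ab: "0 \<le> a" "a \<le> b" "b \<le> v" for a b
  proof (cases "b = 0")
    case False
    then have b: "0 < b" using ab by simp
    have "((a / b) powr p) powr (1/p) * 1 powr (1 - 1/p) \<le> 1/p * (a / b) powr p + (1 - 1/p) * 1"
      using assms by (intro weighted_AM_GM) auto
    then have "a / b \<le> 1/p * (a / b) powr p + (1 - 1/p)"
      using assms ab b by (simp add: powr_powr)
    then have "p * (a / b) \<le> p * (1/p * (a / b) powr p + (1 - 1/p))"
      using assms by (intro mult_left_mono) auto
    then have "p * (a / b) \<le> (a / b) powr p + p - 1" using assms by (simp add: distrib_left right_diff_distrib)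
    then have "b powr p * (p * (a / b)) \<le> b powr p * ((a / b) powr p + p - 1)"
      by (intro mult_left_mono) auto
    moreover have "b powr p * (a / b) powr p = a powr p" using b ab by (simp add: powr_divide)
    moreover have "b powr p * (p * (a / b)) = p * b powr (p - 1) * a" using b by (simp add: powr_diff)
    moreover have "b powr p * ((a / b) powr p + p - 1) = b powr p * (a / b) powr p + b powr p * p - b powr p"
      by (simp add: algebra_simps)
    moreover have "b powr p * p = p * b powr (p - 1) * b" using b by (simp add: powr_diff)
    moreover have "p * b powr (p - 1) * (b - a) = p * b powr (p - 1) * b - p * b powr (p - 1) * a"
      by (rule right_diff_distrib)
    ultimately have "b powr p - a powr p \<le> p * b powr (p - 1) * (b - a)" by linarith
    also have "\<dots> \<le> p * v powr (p - 1) * (b - a)"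
      using assms ab b by (intro mult_right_mono mult_left_mono powr_mono2) auto
    finally show ?thesis .
  qed (use ab in auto)
  have nn: "0 \<le> p * v powr (p - 1)" using assms by simp
  have "\<bar>\<bar>x\<bar> powr p - \<bar>y\<bar> powr p\<bar> \<le> p * v powr (p - 1) * \<bar>\<bar>x\<bar> - \<bar>y\<bar>\<bar>"
  proof (cases "\<bar>x\<bar> \<le> \<bar>y\<bar>")
    case True
    then have "\<bar>x\<bar> powr p \<le> \<bar>y\<bar> powr p" using assms by (intro powr_mono2) auto
    then show ?thesis using *[of "\<bar>x\<bar>" "\<bar>y\<bar>"] True assms by simp
  next
    case False
    then have "\<bar>y\<bar> powr p \<le> \<bar>x\<bar> powr p" using assms by (intro powr_mono2) auto
    then show ?thesis using *[of "\<bar>y\<bar>" "\<bar>x\<bar>"] False assms by simp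
  qed
  also have "\<dots> \<le> p * v powr (p - 1) * \<bar>x - y\<bar>"
    by (intro mult_left_mono nn) (simp add: abs_triangle_ineq3)
  finally show ?thesis .
qed

section \<open>The majorant and the limit procedure\<close>

text \<open>Monotone iteration from 0. The bound M t^-\<open>\<beta>\<close> survives each step
  because U and the Duhamel term contribute at most half of it each, and monotone convergence passes
  to the supremum. The equation is obtained at every (t, x), the value infinity being
  allowed.\<close>

lemma majorant_exists:
  fixes U :: "real \<Rightarrow> 'a::euclidean_space \<Rightarrow> ennreal" and c :: "real \<Rightarrow> real"
  assumes [measurable]: "case_prod U \<in> borel_measurable lborel2" "c \<in> borel_measurable borel"
    and p: "0 < p" and M: "0 < M" and r: "1 \<le> r"
    and U: "\<And>t. 0 < t \<Longrightarrow> Lp_bound r (M / 2 * t powr - \<beta>) (U t)"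
    and step: "\<And>(F :: real \<Rightarrow> 'a \<Rightarrow> ennreal) t. case_prod F \<in> borel_measurable lborel2 \<Longrightarrow> (\<And>\<tau>. 0 < \<tau> \<Longrightarrow> Lp_bound r (M * \<tau> powr - \<beta>) (F \<tau>))
      \<Longrightarrow> 0 < t \<Longrightarrow> Lp_bound r (M / 2 * t powr - \<beta>) (Duhamel_nn (\<lambda>\<tau> y. ennreal (c \<tau>) * epow p (F \<tau> y)) t)"
  shows "\<exists>V. case_prod V \<in> borel_measurable lborel2 \<and> (\<forall>t>0. Lp_bound r (M * t powr - \<beta>) (V t)) \<and>
    (\<forall>t x. V t x = U t x + Duhamel_nn (\<lambda>\<tau> y. ennreal (c \<tau>) * epow p (V \<tau> y)) t x)"
proof -
  define W where "W = rec_nat (\<lambda>_ _. 0) (\<lambda>_ F t x. U t x + Duhamel_nn (\<lambda>\<tau> y. ennreal (c \<tau>) * epow p (F \<tau> y)) t x)"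
  have W0: "W 0 = (\<lambda>_ _. 0)" and WS: "W (Suc j) = (\<lambda>t x. U t x + Duhamel_nn (\<lambda>\<tau> y. ennreal (c \<tau>) * epow p (W j \<tau> y)) t x)" for j
    by (auto simp: W_def)
  have meas [measurable]: "case_prod (W j) \<in> borel_measurable lborel2" for j
    by (induction j) (simp_all add: W0 WS)
  have bound: "Lp_bound r (M * t powr - \<beta>) (W j t)" if "0 < t" for j t
    using that
  proof (induction j arbitrary: t)
    case 0
    then show ?case using r by (simp add: W0 Lp_bound_def)
  next
    case (Suc j)
    have "Lp_bound r (M / 2 * t powr - \<beta>) (Duhamel_nn (\<lambda>\<tau> y. ennreal (c \<tau>) * epow p (W j \<tau> y)) t)"
      by (rule step) (use Suc in auto)
    then have "Lp_bound r (M / 2 * t powr - \<beta> + M / 2 * t powr - \<beta>) (W (Suc j) t)"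
      unfolding WS using Suc.prems M r by (intro Lp_bound_add U) auto
    then show ?case by simp
  qed
  have inc: "W j t x \<le> W (Suc j) t x" for j t x
  proof (induction j arbitrary: t x)
    case (Suc j)
    then show ?case unfolding WS[of j] WS[of "Suc j"] using p
      by (intro add_left_mono Duhamel_nn_mono AE_I2 mult_left_mono epow_mono) auto
  qed (simp add: W0)
  then have inc': "incseq (\<lambda>j. W j t x)" for t x by (intro incseq_SucI)
  define V where "V t x = (SUP j. W j t x)" for t x
  have [measurable]: "case_prod V \<in> borel_measurable lborel2" unfolding V_def by measurable
  have "Lp_bound r (M * t powr - \<beta>) (V t)" if "0 < t" for t
    unfolding V_def using bound[OF that] inc' r
    by (intro Lp_bound_SUP) (auto simp: incseq_def le_fun_def)
  moreover have "V t x = U t x + Duhamel_nn (\<lambda>\<tau> y. ennreal (c \<tau>) * epow p (V \<tau> y)) t x" for t x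
  proof -
    have "Duhamel_nn (\<lambda>\<tau> y. ennreal (c \<tau>) * epow p (V \<tau> y)) t x = Duhamel_nn (\<lambda>\<tau> y. SUP j. ennreal (c \<tau>) * epow p (W j \<tau> y)) t x"
      unfolding V_def using p by (simp add: epow_SUP SUP_mult_left_ennreal)
    also have "\<dots> = (SUP j. Duhamel_nn (\<lambda>\<tau> y. ennreal (c \<tau>) * epow p (W j \<tau> y)) t x)"
      using inc' p by (intro Duhamel_nn_SUP) (auto simp: incseq_def intro!: mult_left_mono epow_mono)
    finally have "U t x + Duhamel_nn (\<lambda>\<tau> y. ennreal (c \<tau>) * epow p (V \<tau> y)) t x = (SUP j. W (Suc j) t x)"
      by (simp add: WS ennreal_SUP_add_right)
    also have "\<dots> = V t x" unfolding V_def
    proof (rule antisym)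
      show "(SUP j. W (Suc j) t x) \<le> (SUP j. W j t x)" by (intro SUP_least SUP_upper) simp
      show "(SUP j. W j t x) \<le> (SUP j. W (Suc j) t x)"
        by (intro SUP_mono) (use inc in blast)
    qed
    finally show ?thesis ..
  qed
  ultimately show ?thesis using \<open>case_prod V \<in> borel_measurable lborel2\<close> by blast
qed

text \<open>\<open>U\<close> dominates the free part \<open>U0\<close> of the solution.
  \<open>contraction\<close> concerns the linearisation p c V^(p-1) F of the source at the majorant:
  it halves every bound of rate \<open>\<beta>\<close> in L^r.\<close>

locale majorized =
  fixes U0 :: "real \<Rightarrow> 'a::euclidean_space \<Rightarrow> real" and U V :: "real \<Rightarrow> 'a \<Rightarrow> ennreal" and c :: "real \<Rightarrow> real"
    and p r M \<beta> :: real
  assumes U0_measurable [measurable]: "case_prod U0 \<in> borel_measurable lborel2"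
    and V_measurable [measurable]: "case_prod V \<in> borel_measurable lborel2"
    and c_measurable [measurable]: "c \<in> borel_measurable borel"
    and U0_le: "\<And>t x. ennreal \<bar>U0 t x\<bar> \<le> U t x"
    and V_eq: "\<And>t x. V t x = U t x + Duhamel_nn (\<lambda>\<tau> y. ennreal (c \<tau>) * epow p (V \<tau> y)) t x"
    and V_bound: "\<And>t. 0 < t \<Longrightarrow> Lp_bound r (M * t powr - \<beta>) (V t)"
    and c_nonneg: "\<And>t. 0 < t \<Longrightarrow> 0 \<le> c t"
    and p: "1 < p" and r: "1 \<le> r" and M: "0 < M"
    and contraction: "\<And>F K t. case_prod F \<in> borel_measurable lborel2 \<Longrightarrow> 0 < K \<Longrightarrow>
      (\<And>\<tau>. 0 < \<tau> \<Longrightarrow> Lp_bound r (K * \<tau> powr - \<beta>) (F \<tau>)) \<Longrightarrow> 0 < t \<Longrightarrow>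
      Lp_bound r (K / 2 * t powr - \<beta>) (Duhamel_nn (\<lambda>\<tau> y. ennreal (c \<tau> * p) * (epow (p - 1) (V \<tau> y) * F \<tau> y)) t)"
begin

lemma V_section [measurable]: "V t \<in> borel_measurable lborel"
  using measurable_Pair2[OF V_measurable, of t] by simp

lemma V_AE_finite: "0 < t \<Longrightarrow> AE x in lborel. V t x < \<infinity>"
  by (rule Lp_bound_AE_finite[OF V_bound])

lemma Duhamel_nn_le_V: "Duhamel_nn (\<lambda>\<tau> y. ennreal (c \<tau>) * epow p (V \<tau> y)) t x \<le> V t x"
  by (subst (2) V_eq) simp

definition admissible :: "(real \<Rightarrow> real) \<Rightarrow> bool" where
  "admissible a \<longleftrightarrow> a \<in> borel_measurable borel \<and> (\<forall>t>0. 0 \<le> a t \<and> a t \<le> c t)"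

definition source :: "(real \<Rightarrow> real) \<Rightarrow> (real \<Rightarrow> 'a \<Rightarrow> real) \<Rightarrow> real \<Rightarrow> 'a \<Rightarrow> real" where
  "source a u \<tau> y = a \<tau> * \<bar>u \<tau> y\<bar> powr p"

lemma source_measurable [measurable]:
  assumes [measurable]: "a \<in> borel_measurable borel" "case_prod u \<in> borel_measurable lborel2"
  shows "case_prod (source a u) \<in> borel_measurable lborel2"
  unfolding source_def by measurable

lemma source_bounds:
  assumes "admissible a" "0 < \<tau>" "ennreal \<bar>u \<tau> y\<bar> \<le> V \<tau> y"
  shows "0 \<le> source a u \<tau> y" "ennreal (source a u \<tau> y) \<le> ennreal (c \<tau>) * epow p (V \<tau> y)"
proof -
  have a: "0 \<le> a \<tau>" "a \<tau> \<le> c \<tau>" using assms by (auto simp: admissible_def)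
  then show "0 \<le> source a u \<tau> y" by (simp add: source_def)
  have "epow p (ennreal \<bar>u \<tau> y\<bar>) \<le> epow p (V \<tau> y)" using assms p by (intro epow_mono) auto
  then show "ennreal (source a u \<tau> y) \<le> ennreal (c \<tau>) * epow p (V \<tau> y)"
    using a by (simp add: source_def ennreal_mult mult_mono ennreal_leI)
qed

lemma Duhamel_nn_source_le:
  assumes "admissible a" "\<And>\<tau>. 0 < \<tau> \<Longrightarrow> AE y in lborel. ennreal \<bar>u \<tau> y\<bar> \<le> V \<tau> y"
  shows "Duhamel_nn (\<lambda>\<tau> y. ennreal \<bar>source a u \<tau> y\<bar>) t x \<le> V t x"
proof (rule order_trans[OF Duhamel_nn_mono Duhamel_nn_le_V])
  fix \<tau> :: real assume \<tau>: "0 < \<tau>"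
  show "AE y in lborel. ennreal \<bar>source a u \<tau> y\<bar> \<le> ennreal (c \<tau>) * epow p (V \<tau> y)"
    using assms(2)[OF \<tau>] by eventually_elim (use source_bounds[OF assms(1) \<tau>] in auto)
qed

(* Both the Picard iterates (s n = n) and the passage to the limit of exact solutions with
   varying coefficients (s n = Suc n) are instances. *)
lemma limit_solution:
  fixes u :: "nat \<Rightarrow> real \<Rightarrow> 'a \<Rightarrow> real"
  assumes u_measurable [measurable]: "\<And>n. case_prod (u n) \<in> borel_measurable lborel2"
    and a: "\<And>n. admissible (a n)"
    and b_measurable [measurable]: "b \<in> borel_measurable borel" and ab: "\<And>t. 0 < t \<Longrightarrow> (\<lambda>n. a n t) \<longlonglongrightarrow> b t"
    and s: "\<And>n. n \<le> s n"
    and uV: "\<And>n t. 0 < t \<Longrightarrow> AE x in lborel. ennreal \<bar>u n t x\<bar> \<le> V t x"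
    and eq: "\<And>n t. 0 < t \<Longrightarrow> AE x in lborel. u (Suc n) t x = U0 t x + Duhamel (source (a n) (u (s n))) t x"
    and v_def: "v = (\<lambda>t x. if Cauchy (\<lambda>n. u n t x) then lim (\<lambda>n. u n t x) else 0)"
  shows "case_prod v \<in> borel_measurable lborel2" "admissible b"
    and "\<And>t. 0 < t \<Longrightarrow> AE x in lborel. (\<lambda>n. u n t x) \<longlonglongrightarrow> v t x"
    and "\<And>t. 0 < t \<Longrightarrow> AE x in lborel. ennreal \<bar>v t x\<bar> \<le> V t x"
    and "\<And>t. 0 < t \<Longrightarrow> AE x in lborel. v t x = U0 t x + Duhamel (source b v) t x"
proof -
  have [measurable]: "a n \<in> borel_measurable borel" for n using a by (simp add: admissible_def)
  have usec [measurable]: "u n t \<in> borel_measurable lborel" for n t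
    using measurable_Pair2[OF u_measurable, of t n] by simp
  \<comment> \<open>The limit exists only almost everywhere at each time; the test for being Cauchy
    makes v a total, jointly measurable function.\<close>
  show v_measurable [measurable]: "case_prod v \<in> borel_measurable lborel2"
    unfolding v_def by measurable
  show b: "admissible b"
    unfolding admissible_def
  proof (intro conjI allI impI)
    fix t :: real assume t: "0 < t"
    show "0 \<le> b t" using a t by (intro LIMSEQ_le_const[OF ab[OF t]]) (auto simp: admissible_def)
    show "b t \<le> c t" using a t by (intro LIMSEQ_le_const2[OF ab[OF t]]) (auto simp: admissible_def)
  qed measurable
  define F where "F n = source (a n) (u (s n))" for n
  have F_measurable [measurable]: "case_prod (F n) \<in> borel_measurable lborel2" for n unfolding F_def by measurable
  define f where "f k \<tau> y = (SUP n\<in>{k..}. SUP m\<in>{k..}. ennreal \<bar>F n \<tau> y - F m \<tau> y\<bar>)" for k \<tau> y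
  define z where "z k t x = (SUP n\<in>{k..}. SUP m\<in>{k..}. ennreal \<bar>u n t x - u m t x\<bar>)" for k t x
  define Z where "Z t x = (INF k. z k t x)" for t x
  (* Z is the oscillation of the sequence. Dominated convergence under the majorant V bounds it by
     the linearized operator applied to Z itself, which is a contraction, so Z vanishes. *)
  have [measurable]: "case_prod (f k) \<in> borel_measurable lborel2" for k unfolding f_def by measurable
  have z_measurable [measurable]: "case_prod (z k) \<in> borel_measurable lborel2" for k unfolding z_def by measurable
  have Z_measurable [measurable]: "case_prod Z \<in> borel_measurable lborel2" unfolding Z_def by measurable
  have f_ge: "ennreal \<bar>F n \<tau> y - F m \<tau> y\<bar> \<le> f k \<tau> y" if "k \<le> n" "k \<le> m" for k n m \<tau> y
    unfolding f_def using that by (intro SUP_upper2[of n] SUP_upper2[of m] order_refl) auto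
  have z_ge: "ennreal \<bar>u n t x - u m t x\<bar> \<le> z k t x" if "k \<le> n" "k \<le> m" for k n m t x
    unfolding z_def using that by (intro SUP_upper2[of n] SUP_upper2[of m] order_refl) auto
  have f_dec: "decseq (\<lambda>k. f k \<tau> y)" for \<tau> y
    unfolding f_def decseq_def by (auto intro!: SUP_least f_ge[unfolded f_def])
  have good: "AE y in lborel. (\<forall>n. ennreal \<bar>u n \<tau> y\<bar> \<le> V \<tau> y) \<and> V \<tau> y < \<infinity>" if "0 < \<tau>" for \<tau>
    using uV[OF that] V_AE_finite[OF that] by (auto simp: AE_all_countable)
  have f_le: "f k \<tau> y \<le> ennreal (c \<tau>) * epow p (V \<tau> y)"
    if "0 < \<tau>" "\<And>n. ennreal \<bar>u n \<tau> y\<bar> \<le> V \<tau> y" for k \<tau> y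
    unfolding f_def
  proof (intro SUP_least)
    fix n m
    \<comment> \<open>Both sources are nonnegative, so their difference is at most the larger one.
      Hence no factor 2 appears, and \<open>f k\<close> lies below the source of the majorant
      itself.\<close>
    have "\<bar>F n \<tau> y - F m \<tau> y\<bar> \<le> max (F n \<tau> y) (F m \<tau> y)"
      using source_bounds(1)[OF a[of n] that(1), where u="u (s n)" and y=y] source_bounds(1)[OF a[of m] that(1), where u="u (s m)" and y=y] that(2)
      by (auto simp: F_def)
    then have "ennreal \<bar>F n \<tau> y - F m \<tau> y\<bar> \<le> ennreal (max (F n \<tau> y) (F m \<tau> y))" by (rule ennreal_leI)
    also have "\<dots> \<le> ennreal (c \<tau>) * epow p (V \<tau> y)"
      using source_bounds(2)[OF a[of n] that(1), where u="u (s n)" and y=y] source_bounds(2)[OF a[of m] that(1), where u="u (s m)" and y=y] that(2)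
      by (auto simp: F_def max_def)
    finally show "ennreal \<bar>F n \<tau> y - F m \<tau> y\<bar> \<le> ennreal (c \<tau>) * epow p (V \<tau> y)" .
  qed
  have Duhamel_nn_f_le: "Duhamel_nn (f k) t x \<le> V t x" for k t x
  proof (rule order_trans[OF Duhamel_nn_mono Duhamel_nn_le_V])
    fix \<tau> :: real assume \<tau>: "0 < \<tau>"
    show "AE y in lborel. f k \<tau> y \<le> ennreal (c \<tau>) * epow p (V \<tau> y)"
      using good[OF \<tau>] by eventually_elim (use f_le[OF \<tau>] in auto)
  qed
  have Duhamel_nn_F: "Duhamel_nn (\<lambda>\<tau> y. ennreal \<bar>F n \<tau> y\<bar>) t x \<le> V t x" for n t x
    unfolding F_def by (intro Duhamel_nn_source_le a uV)
  \<comment> \<open>The index drops by one because \<open>eq\<close> builds \<open>u (Suc n)\<close>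
    from the source number n.\<close>
  have z_step: "AE x in lborel. \<forall>k. z (Suc k) t x \<le> Duhamel_nn (f k) t x" if t: "0 < t" for t
  proof -
    have "AE x in lborel. (\<forall>n. u (Suc n) t x = U0 t x + Duhamel (F n) t x) \<and> V t x < \<infinity>"
      using eq[OF t] V_AE_finite[OF t] by (auto simp: AE_all_countable F_def)
    then show ?thesis
    proof eventually_elim
      case (elim x)
      show ?case unfolding z_def
      proof (intro allI SUP_least)
        fix k n m assume "n \<in> {Suc k..}" "m \<in> {Suc k..}"
        then obtain n' m' where nm: "n = Suc n'" "m = Suc m'" "k \<le> n'" "k \<le> m'"
          by (metis atLeast_iff Suc_le_D Suc_le_mono)
        have "ennreal \<bar>u n t x - u m t x\<bar> = ennreal \<bar>Duhamel (F n') t x - Duhamel (F m') t x\<bar>"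
          using elim by (simp add: nm)
        also have "\<dots> \<le> Duhamel_nn (\<lambda>\<tau> y. ennreal \<bar>F n' \<tau> y - F m' \<tau> y\<bar>) t x"
          using elim by (intro Duhamel_diff_le F_measurable le_less_trans[OF Duhamel_nn_F]) auto
        also have "\<dots> \<le> Duhamel_nn (f k) t x"
          using nm by (intro Duhamel_nn_mono AE_I2 f_ge) auto
        finally show "ennreal \<bar>u n t x - u m t x\<bar> \<le> Duhamel_nn (f k) t x" .
      qed
    qed
  qed
  have INF_f: "(INF k. f k \<tau> y) \<le> ennreal (c \<tau> * p) * (epow (p - 1) (V \<tau> y) * Z \<tau> y)"
    if \<tau>: "0 < \<tau>" and y: "\<And>n. ennreal \<bar>u n \<tau> y\<bar> \<le> V \<tau> y" "V \<tau> y < \<infinity>" for \<tau> y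
  proof -
    obtain vv where vv: "V \<tau> y = ennreal vv" "0 \<le> vv" using y(2) by (cases "V \<tau> y") auto
    have uv: "\<bar>u n \<tau> y\<bar> \<le> vv" for n using y(1)[of n] vv by simp
    have "z 0 \<tau> y \<le> ennreal (2 * vv)"
      unfolding z_def using uv by (intro SUP_least ennreal_leI) (smt (verit))
    then have "Z \<tau> y \<le> ennreal (2 * vv)" unfolding Z_def by (meson INF_lower2 UNIV_I)
    then obtain \<zeta> where \<zeta>: "Z \<tau> y = ennreal \<zeta>" "0 \<le> \<zeta>" by (cases "Z \<tau> y") (auto simp: top_unique)
    have c0: "0 \<le> c \<tau>" using c_nonneg \<tau> by simp
    \<comment> \<open>The difference of two sources splits into a change of coefficient, which is
      small because the coefficients converge at \<open>\<tau>\<close>, and a change of u, estimated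
      by \<open>powr_diff_le\<close> with vv as majorant. Since s n >= n, the oscillation bound of
      tail k2 also applies to the indices s n and s m.\<close>
    have est: "(INF k. f k \<tau> y) \<le> ennreal (e * vv powr p + c \<tau> * (p * vv powr (p - 1) * (\<zeta> + e)))" if e: "0 < e" for e
    proof -
      have "Cauchy (\<lambda>n. a n \<tau>)" using ab[OF \<tau>] by (rule LIMSEQ_imp_Cauchy)
      then obtain k1 where k1: "\<And>n m. k1 \<le> n \<Longrightarrow> k1 \<le> m \<Longrightarrow> \<bar>a n \<tau> - a m \<tau>\<bar> < e"
        using e unfolding Cauchy_def dist_real_def by meson
      have "Z \<tau> y < ennreal (\<zeta> + e)" using \<zeta> e by (simp add: ennreal_less_iff)
      then obtain k2 where k2: "z k2 \<tau> y < ennreal (\<zeta> + e)" unfolding Z_def INF_less_iff by auto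
      define k where "k = max k1 k2"
      have "f k \<tau> y \<le> ennreal (e * vv powr p + c \<tau> * (p * vv powr (p - 1) * (\<zeta> + e)))"
        unfolding f_def
      proof (intro SUP_least ennreal_leI)
        fix n m assume "n \<in> {k..}" "m \<in> {k..}"
        then have nm: "k1 \<le> n" "k1 \<le> m" "k2 \<le> s n" "k2 \<le> s m" "k2 \<le> n" "k2 \<le> m"
          using s[of n] s[of m] by (auto simp: k_def)
        let ?x = "u (s n) \<tau> y" and ?y = "u (s m) \<tau> y"
        have am: "0 \<le> a m \<tau>" "a m \<tau> \<le> c \<tau>" using a[of m] \<tau> by (auto simp: admissible_def)
        have "F n \<tau> y - F m \<tau> y = (a n \<tau> - a m \<tau>) * \<bar>?x\<bar> powr p + a m \<tau> * (\<bar>?x\<bar> powr p - \<bar>?y\<bar> powr p)"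
          by (simp add: F_def source_def algebra_simps)
        also have "\<bar>\<dots>\<bar> \<le> \<bar>a n \<tau> - a m \<tau>\<bar> * \<bar>?x\<bar> powr p + a m \<tau> * \<bar>\<bar>?x\<bar> powr p - \<bar>?y\<bar> powr p\<bar>"
          using am by (intro order_trans[OF abs_triangle_ineq]) (simp add: abs_mult)
        also have "\<dots> \<le> e * vv powr p + c \<tau> * (p * vv powr (p - 1) * \<bar>?x - ?y\<bar>)"
          using k1[OF nm(1,2)] am c0 uv p e by (intro add_mono mult_mono powr_diff_le powr_mono2) auto
        also have "\<bar>?x - ?y\<bar> \<le> \<zeta> + e"
        proof -
          have "ennreal \<bar>?x - ?y\<bar> < ennreal (\<zeta> + e)" using z_ge[OF nm(3,4)] k2 by (rule le_less_trans)
          then show ?thesis using \<zeta> e by (simp add: ennreal_less_iff del: ennreal_plus)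
        qed
        then have "e * vv powr p + c \<tau> * (p * vv powr (p - 1) * \<bar>?x - ?y\<bar>) \<le> e * vv powr p + c \<tau> * (p * vv powr (p - 1) * (\<zeta> + e))"
          using c0 p by (intro add_left_mono mult_left_mono) auto
        finally show "\<bar>F n \<tau> y - F m \<tau> y\<bar> \<le> e * vv powr p + c \<tau> * (p * vv powr (p - 1) * (\<zeta> + e))" .
      qed
      then show ?thesis by (meson INF_lower2 UNIV_I)
    qed
    have "(\<lambda>j. ennreal (inverse (real (Suc j)) * vv powr p + c \<tau> * (p * vv powr (p - 1) * (\<zeta> + inverse (real (Suc j))))))
       \<longlonglongrightarrow> ennreal (0 * vv powr p + c \<tau> * (p * vv powr (p - 1) * (\<zeta> + 0)))"
      by (intro tendsto_intros LIMSEQ_inverse_real_of_nat)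
    then have "(INF k. f k \<tau> y) \<le> ennreal (0 * vv powr p + c \<tau> * (p * vv powr (p - 1) * (\<zeta> + 0)))"
      by (rule LIMSEQ_le_const) (auto intro!: est)
    also have "\<dots> = ennreal (c \<tau> * p) * (epow (p - 1) (V \<tau> y) * Z \<tau> y)"
      using vv \<zeta> c0 p by (simp add: ennreal_mult[symmetric] mult_ac)
    finally show ?thesis .
  qed
  have Duhamel_nn_INF_f: "Duhamel_nn (\<lambda>\<tau> y. INF k. f k \<tau> y) t x \<le> Duhamel_nn (\<lambda>\<tau> y. ennreal (c \<tau> * p) * (epow (p - 1) (V \<tau> y) * Z \<tau> y)) t x" for t x
  proof (rule Duhamel_nn_mono)
    fix \<tau> :: real assume \<tau>: "0 < \<tau>"
    show "AE y in lborel. (INF k. f k \<tau> y) \<le> ennreal (c \<tau> * p) * (epow (p - 1) (V \<tau> y) * Z \<tau> y)"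
      using good[OF \<tau>] by eventually_elim (use INF_f[OF \<tau>] in auto)
  qed
  \<comment> \<open>A decreasing limit may be taken inside the integral when the first integral is
    finite; V supplies this at almost every x.\<close>
  have INF_Duhamel_nn: "Duhamel_nn (\<lambda>\<tau> y. INF k. f k \<tau> y) t x = (INF k. Duhamel_nn (f k) t x)" if "V t x < \<infinity>" for t x
    using that f_dec by (intro Duhamel_nn_INF) (auto intro: le_less_trans[OF Duhamel_nn_f_le])
  have Z_le: "AE x in lborel. Z t x \<le> Duhamel_nn (\<lambda>\<tau> y. ennreal (c \<tau> * p) * (epow (p - 1) (V \<tau> y) * Z \<tau> y)) t x" if t: "0 < t" for t
    using z_step[OF t] V_AE_finite[OF t]
  proof eventually_elim
    case (elim x)
    have "Z t x \<le> (INF k. Duhamel_nn (f k) t x)"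
      unfolding Z_def using elim by (intro INF_greatest) (meson INF_lower2 UNIV_I)
    then show ?case using INF_Duhamel_nn elim Duhamel_nn_INF_f[of t x] by simp
  qed
  \<comment> \<open>The oscillation is at most 2 V to begin with, and each application of
    \<open>Z_le\<close> and \<open>contraction\<close> halves the bound.\<close>
  have Z_bound: "Lp_bound r (2 * M * (1/2)^k * t powr - \<beta>) (Z t)" if "0 < t" for k t
    using that
  proof (induction k arbitrary: t)
    case 0
    have Zsec: "Z t \<in> borel_measurable lborel" using measurable_Pair2[OF Z_measurable, of t] by simp
    have "Lp_bound r (2 * (M * t powr - \<beta>)) (\<lambda>x. ennreal 2 * V t x)"
      using 0 M by (intro Lp_bound_cmult V_bound) auto
    moreover have "AE x in lborel. Z t x \<le> ennreal 2 * V t x"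
      using good[OF 0]
    proof eventually_elim
      case (elim x)
      have "Z t x \<le> z 0 t x" unfolding Z_def by (intro INF_lower) auto
      also have "\<dots> \<le> ennreal 2 * V t x" unfolding z_def
      proof (intro SUP_least)
        fix n m
        have "ennreal \<bar>u n t x - u m t x\<bar> \<le> ennreal \<bar>u n t x\<bar> + ennreal \<bar>u m t x\<bar>"
          by (simp add: ennreal_plus[symmetric] ennreal_leI abs_triangle_ineq4 del: ennreal_plus)
        also have "\<dots> \<le> V t x + V t x" using elim by (intro add_mono) auto
        finally show "ennreal \<bar>u n t x - u m t x\<bar> \<le> ennreal 2 * V t x" by (simp add: mult_2)
      qed
      finally show ?case .
    qed
    ultimately show ?case using M r Zsec by (auto intro: Lp_bound_mono_AE)
  next
    case (Suc k)
    have Zsec: "Z t \<in> borel_measurable lborel" using measurable_Pair2[OF Z_measurable, of t] by simp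
    have "Lp_bound r (2 * M * (1/2)^k / 2 * t powr - \<beta>) (Duhamel_nn (\<lambda>\<tau> y. ennreal (c \<tau> * p) * (epow (p - 1) (V \<tau> y) * Z \<tau> y)) t)"
      using M Suc by (intro contraction Z_measurable) auto
    then show ?case using M r Zsec Z_le[OF Suc.prems] by (auto intro: Lp_bound_mono_AE)
  qed
  have Z0: "AE x in lborel. Z t x = 0" if t: "0 < t" for t
  proof (rule Lp_bound_tendsto_0_imp_AE_0[where m=r and A="\<lambda>k. 2 * M * (1/2)^k * t powr - \<beta>"])
    have "(\<lambda>k. 2 * M * (1/2)^k * t powr - \<beta>) \<longlonglongrightarrow> 2 * M * 0 * t powr - \<beta>"
      by (intro tendsto_intros LIMSEQ_realpow_zero) auto
    then show "(\<lambda>k. 2 * M * (1/2)^k * t powr - \<beta>) \<longlonglongrightarrow> 0" by simp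
  qed (use Z_bound t M r in auto)
  have conv_pt: "(\<lambda>n. u n t x) \<longlonglongrightarrow> v t x" if "Z t x = 0" for t x
  proof -
    have "Cauchy (\<lambda>n. u n t x)"
      unfolding Cauchy_def dist_real_def
    proof (intro allI impI)
      fix e :: real assume e: "0 < e"
      then have "Z t x < ennreal e" using that by simp
      then obtain k where k: "z k t x < ennreal e" unfolding Z_def INF_less_iff by auto
      have "\<bar>u m t x - u n t x\<bar> < e" if "k \<le> m" "k \<le> n" for m n
        using le_less_trans[OF z_ge[OF that] k] by (simp add: ennreal_less_iff)
      then show "\<exists>M. \<forall>m\<ge>M. \<forall>n\<ge>M. \<bar>u m t x - u n t x\<bar> < e" by blast
    qed
    then show ?thesis by (simp add: v_def Cauchy_convergent_iff convergent_LIMSEQ_iff)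
  qed
  show conv: "AE x in lborel. (\<lambda>n. u n t x) \<longlonglongrightarrow> v t x" if "0 < t" for t
    using Z0[OF that] by eventually_elim (rule conv_pt)
  show vV: "AE x in lborel. ennreal \<bar>v t x\<bar> \<le> V t x" if t: "0 < t" for t
    using conv[OF t] good[OF t]
  proof eventually_elim
    case (elim x)
    have "(\<lambda>n. ennreal \<bar>u n t x\<bar>) \<longlonglongrightarrow> ennreal \<bar>v t x\<bar>" using elim by (intro tendsto_intros) auto
    then show ?case by (rule LIMSEQ_le_const2) (use elim in auto)
  qed
  have Duhamel_nn_b: "Duhamel_nn (\<lambda>\<tau> y. ennreal \<bar>source b v \<tau> y\<bar>) t x \<le> V t x" for t x
    by (intro Duhamel_nn_source_le b vV)
  have s_lim: "filterlim s at_top sequentially"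
    using s by (intro filterlim_at_top_mono[OF filterlim_ident]) auto
  show "AE x in lborel. v t x = U0 t x + Duhamel (source b v) t x" if t: "0 < t" for t
  proof -
    have "AE x in lborel. (\<forall>n. u (Suc n) t x = U0 t x + Duhamel (F n) t x) \<and> V t x < \<infinity>"
      using eq[OF t] V_AE_finite[OF t] by (auto simp: AE_all_countable F_def)
    then show ?thesis using conv[OF t]
    proof eventually_elim
      case (elim x)
      have lim0: "(\<lambda>n. Duhamel_nn (f n) t x) \<longlonglongrightarrow> 0"
      proof -
        have "decseq (\<lambda>n. Duhamel_nn (f n) t x)"
          using f_dec unfolding decseq_def by (auto intro!: Duhamel_nn_mono)
        then have "(\<lambda>n. Duhamel_nn (f n) t x) \<longlonglongrightarrow> (INF n. Duhamel_nn (f n) t x)" by (rule LIMSEQ_INF)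
        moreover have "Duhamel_nn (\<lambda>\<tau> y. ennreal (c \<tau> * p) * (epow (p - 1) (V \<tau> y) * Z \<tau> y)) t x = 0"
        proof (rule Duhamel_nn_eq_0)
          fix \<tau> :: real assume "0 < \<tau>"
          from Z0[OF this] show "AE y in lborel. ennreal (c \<tau> * p) * (epow (p - 1) (V \<tau> y) * Z \<tau> y) = 0"
            by eventually_elim simp
        qed
        ultimately show ?thesis using INF_Duhamel_nn elim Duhamel_nn_INF_f[of t x] by simp
      qed
      have "ennreal \<bar>Duhamel (F n) t x - Duhamel (source b v) t x\<bar> \<le> Duhamel_nn (f n) t x" for n
      proof -
        have "ennreal \<bar>Duhamel (F n) t x - Duhamel (source b v) t x\<bar> \<le> Duhamel_nn (\<lambda>\<tau> y. ennreal \<bar>F n \<tau> y - source b v \<tau> y\<bar>) t x"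
          using elim by (intro Duhamel_diff_le F_measurable le_less_trans[OF Duhamel_nn_F] le_less_trans[OF Duhamel_nn_b]) auto
        also have "\<dots> \<le> Duhamel_nn (f n) t x"
        proof (rule Duhamel_nn_mono)
          fix \<tau> :: real assume \<tau>: "0 < \<tau>"
          show "AE y in lborel. ennreal \<bar>F n \<tau> y - source b v \<tau> y\<bar> \<le> f n \<tau> y"
            using conv[OF \<tau>]
          proof eventually_elim
            case (elim y)
            \<comment> \<open>With n fixed, m tends to infinity in |F n - F m| <= f n.\<close>
            have "(\<lambda>m. u (s m) \<tau> y) \<longlonglongrightarrow> v \<tau> y"
              using filterlim_compose[OF elim s_lim] .
            then have "(\<lambda>m. ennreal \<bar>F n \<tau> y - F m \<tau> y\<bar>) \<longlonglongrightarrow> ennreal \<bar>F n \<tau> y - source b v \<tau> y\<bar>"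
              unfolding F_def source_def using p by (intro tendsto_intros ab \<tau> tendsto_powr') auto
            then show ?case by (rule LIMSEQ_le_const2) (auto intro!: exI[of _ n] f_ge)
          qed
        qed
        finally show ?thesis .
      qed
      then have "(\<lambda>n. ennreal \<bar>Duhamel (F n) t x - Duhamel (source b v) t x\<bar>) \<longlonglongrightarrow> 0"
        by (intro tendsto_sandwich[OF _ _ tendsto_const lim0]) auto
      then have "(\<lambda>n. \<bar>Duhamel (F n) t x - Duhamel (source b v) t x\<bar>) \<longlonglongrightarrow> 0"
        by (simp add: ennreal_tendsto_0_iff)
      then have "(\<lambda>n. Duhamel (F n) t x) \<longlonglongrightarrow> Duhamel (source b v) t x"
        by (simp add: tendsto_rabs_zero_iff LIM_zero_iff)
      then have "(\<lambda>n. U0 t x + Duhamel (F n) t x) \<longlonglongrightarrow> U0 t x + Duhamel (source b v) t x" by (intro tendsto_intros)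
      moreover have "(\<lambda>n. u (Suc n) t x) \<longlonglongrightarrow> v t x" using elim(2) by (rule LIMSEQ_Suc)
      moreover have "(\<lambda>n. u (Suc n) t x) = (\<lambda>n. U0 t x + Duhamel (F n) t x)" using elim(1) by auto
      ultimately show ?case by (metis LIMSEQ_unique)
    qed
  qed
qed

end


section \<open>Bounds, differences and limits of Lebesgue norms\<close>

lemma Lp_bound_Lp_norm:
  fixes f :: "'a::euclidean_space \<Rightarrow> real"
  assumes f: "Lp_bound q C (\<lambda>x. ennreal \<bar>f x\<bar>)" and m: "f \<in> borel_measurable lborel" and C: "0 \<le> C" and q: "0 < q"
  shows "integrable lborel (\<lambda>x. \<bar>f x\<bar> powr q)" "Lp_norm q f \<le> C"
    "Lp_bound q (Lp_norm q f) (\<lambda>x. ennreal \<bar>f x\<bar>)"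
proof -
  note m [measurable]
  have le: "(\<integral>\<^sup>+x. ennreal (\<bar>f x\<bar> powr q) \<partial>lborel) \<le> ennreal (C powr q)"
    using f by (simp add: Lp_bound_def)
  show int: "integrable lborel (\<lambda>x. \<bar>f x\<bar> powr q)"
    by (rule integrableI_bounded) (use le in \<open>auto intro: le_less_trans\<close>)
  define I where "I = (LINT x|lborel. \<bar>f x\<bar> powr q)"
  have eq: "(\<integral>\<^sup>+x. ennreal (\<bar>f x\<bar> powr q) \<partial>lborel) = ennreal I"
    unfolding I_def using int by (intro nn_integral_eq_integral) auto
  have I0: "0 \<le> I" unfolding I_def by (rule Bochner_Integration.integral_nonneg) auto
  have "I \<le> C powr q" using le eq C by simp
  then have "I powr (1/q) \<le> (C powr q) powr (1/q)" using I0 q by (intro powr_mono2) auto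
  then show "Lp_norm q f \<le> C" using C q by (simp add: Lp_norm_def I_def powr_powr)
  show "Lp_bound q (Lp_norm q f) (\<lambda>x. ennreal \<bar>f x\<bar>)"
    using eq I0 q by (simp add: Lp_bound_def Lp_norm_def powr_powr flip: I_def)
qed

lemma Lp_norm_nonneg [simp]: "0 \<le> Lp_norm q f"
  by (simp add: Lp_norm_def)

lemma Lp_norm_diff_le:
  fixes f g :: "'a::euclidean_space \<Rightarrow> real"
  assumes m: "f \<in> borel_measurable lborel" "g \<in> borel_measurable lborel"
    and g: "Lp_bound q C (\<lambda>x. ennreal \<bar>g x\<bar>)" "0 \<le> C"
    and d: "Lp_bound q e (\<lambda>x. ennreal \<bar>f x - g x\<bar>)" and e: "0 < e" and q: "1 \<le> q"
  shows "Lp_norm q f \<le> Lp_norm q g + e"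
proof (rule field_le_epsilon)
  \<comment> \<open>\<open>Lp_bound_add\<close> asks for positive bounds while the norm of g may be
    0; the slack \<open>\<eta>\<close> supplies positivity.\<close>
  fix \<eta> :: real assume \<eta>: "0 < \<eta>"
  note m [measurable]
  have "Lp_bound q (Lp_norm q g) (\<lambda>x. ennreal \<bar>g x\<bar>)"
    using q by (intro Lp_bound_Lp_norm(3)[OF g(1) m(2) g(2)]) simp
  then have "Lp_bound q (Lp_norm q g + \<eta>) (\<lambda>x. ennreal \<bar>g x\<bar>)"
    using q \<eta> by (elim Lp_bound_mono_AE) auto
  then have "Lp_bound q (Lp_norm q g + \<eta> + e) (\<lambda>x. ennreal \<bar>g x\<bar> + ennreal \<bar>f x - g x\<bar>)"
    using d \<eta> e q by (intro Lp_bound_add) (auto intro!: add_nonneg_pos)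
  then have "Lp_bound q (Lp_norm q g + \<eta> + e) (\<lambda>x. ennreal \<bar>f x\<bar>)"
    using e \<eta> q Lp_norm_nonneg[of q g]
    by (elim Lp_bound_mono_AE) (auto simp: ennreal_plus[symmetric] simp del: ennreal_plus intro!: ennreal_leI)
  then have "Lp_norm q f \<le> Lp_norm q g + \<eta> + e"
    using e \<eta> q Lp_norm_nonneg[of q g] m by (intro Lp_bound_Lp_norm(2)) auto
  then show "Lp_norm q f \<le> Lp_norm q g + e + \<eta>" by simp
qed

lemma Lp_norm_dominated_convergence:
  fixes u :: "nat \<Rightarrow> 'a::euclidean_space \<Rightarrow> real"
  assumes m [measurable]: "\<And>n. u n \<in> borel_measurable lborel" "v \<in> borel_measurable lborel"
    and V: "Lp_bound q C V" and uV: "\<And>n. AE x in lborel. ennreal \<bar>u n x\<bar> \<le> V x"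
    and lim: "AE x in lborel. (\<lambda>n. u n x) \<longlonglongrightarrow> v x" and q: "1 \<le> q"
  shows "(\<lambda>n. Lp_norm q (u n)) \<longlonglongrightarrow> Lp_norm q v"
proof -
  have [measurable]: "V \<in> borel_measurable lborel" using V by (simp add: Lp_bound_def)
  have fin: "AE x in lborel. V x < \<infinity>" by (rule Lp_bound_AE_finite[OF V])
  have "(\<integral>\<^sup>+x. ennreal (enn2real (V x) powr q) \<partial>lborel) \<le> (\<integral>\<^sup>+x. epow q (V x) \<partial>lborel)"
    by (intro nn_integral_mono) (simp add: epow_def)
  also have "\<dots> < \<infinity>" using V by (auto simp: Lp_bound_def intro: le_less_trans)
  finally have int: "integrable lborel (\<lambda>x. enn2real (V x) powr q)"
    by (intro integrableI_bounded) auto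
  have "(\<lambda>n. LINT x|lborel. \<bar>u n x\<bar> powr q) \<longlonglongrightarrow> (LINT x|lborel. \<bar>v x\<bar> powr q)"
  proof (rule integral_dominated_convergence[OF _ _ int])
    show "AE x in lborel. (\<lambda>n. \<bar>u n x\<bar> powr q) \<longlonglongrightarrow> \<bar>v x\<bar> powr q"
      using lim by eventually_elim (use q in \<open>auto intro!: tendsto_powr' tendsto_rabs\<close>)
    show "AE x in lborel. norm (\<bar>u n x\<bar> powr q) \<le> enn2real (V x) powr q" for n
      using uV[of n] fin
    proof eventually_elim
      case (elim x)
      then show ?case using q by (cases "V x") (auto intro!: powr_mono2)
    qed
  qed measurable
  then show ?thesis unfolding Lp_norm_def using q by (intro tendsto_powr') auto
qed

section \<open>Solving the nonlocal problem\<close>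

(* Equal to s powr \<alpha> except that 0 powr 0 is taken to be 1, which makes it continuous at s = 0. *)
definition norm_power :: "real \<Rightarrow> real \<Rightarrow> real" where
  "norm_power \<alpha> s = (if \<alpha> = 0 then 1 else s powr \<alpha>)"

lemma norm_power_nonneg [simp]: "0 \<le> norm_power \<alpha> s"
  by (simp add: norm_power_def)

lemma norm_power_mono: "0 \<le> \<alpha> \<Longrightarrow> 0 \<le> s \<Longrightarrow> s \<le> t \<Longrightarrow> norm_power \<alpha> s \<le> norm_power \<alpha> t"
  by (auto simp: norm_power_def intro!: powr_mono2)

lemma norm_power_tendsto:
  "0 \<le> \<alpha> \<Longrightarrow> (\<And>n. 0 \<le> s n) \<Longrightarrow> s \<longlonglongrightarrow> l \<Longrightarrow> (\<lambda>n. norm_power \<alpha> (s n)) \<longlonglongrightarrow> norm_power \<alpha> l"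
  by (auto simp: norm_power_def intro!: tendsto_powr')

lemma norm_power_measurable [measurable]:
  "f \<in> borel_measurable M \<Longrightarrow> (\<lambda>x. norm_power \<alpha> (f x)) \<in> borel_measurable M"
  by (simp add: norm_power_def)

text \<open>By \<open>c_eq\<close>, c is the largest coefficient that a function below V can
  produce, given the bound of V in L^q. \<open>equi\<close> speaks of \<open>U0\<close> and the
  source of the majorant only, so it holds uniformly over all admissible coefficients.\<close>

locale nonlocal_problem = majorized +
  fixes q \<alpha> b :: real
  assumes q: "1 < q" and \<alpha>: "0 \<le> \<alpha>"
    and V_bound_q: "\<And>t. 0 < t \<Longrightarrow> Lp_bound q (M * t powr - b) (V t)"
    and c_eq: "\<And>t. 0 < t \<Longrightarrow> c t = norm_power \<alpha> (M * t powr - b)"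
    and equi: "\<And>t e. 0 < t \<Longrightarrow> 0 < e \<Longrightarrow> \<exists>d>0. \<forall>s>0. \<bar>s - t\<bar> < d \<longrightarrow> s \<noteq> t \<longrightarrow>
      Lp_bound q e (\<lambda>x. ennreal \<bar>U0 t x - U0 s x\<bar> + Duhamel_nn_diff (\<lambda>\<tau> y. ennreal (c \<tau>) * epow p (V \<tau> y)) (min s t) (max s t) x)"
begin

definition solves :: "(real \<Rightarrow> real) \<Rightarrow> (real \<Rightarrow> 'a \<Rightarrow> real) \<Rightarrow> bool" where
  "solves a u \<longleftrightarrow> admissible a \<and> case_prod u \<in> borel_measurable lborel2 \<and>
     (\<forall>t>0. AE x in lborel. ennreal \<bar>u t x\<bar> \<le> V t x) \<and>
     (\<forall>t>0. AE x in lborel. u t x = U0 t x + Duhamel (source a u) t x)"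

lemma solves_section:
  assumes "solves a u"
  shows "u t \<in> borel_measurable lborel"
  using assms measurable_Pair2[of "case_prod u" lborel lborel borel t] by (simp add: solves_def)

lemma solves_bound:
  assumes u: "solves a u" and t: "0 < t"
  shows "Lp_bound q (M * t powr - b) (\<lambda>x. ennreal \<bar>u t x\<bar>)" "Lp_norm q (u t) \<le> M * t powr - b"
proof -
  have [measurable]: "u t \<in> borel_measurable lborel" using u by (rule solves_section)
  have "AE x in lborel. ennreal \<bar>u t x\<bar> \<le> V t x" using u t by (simp add: solves_def)
  then show *: "Lp_bound q (M * t powr - b) (\<lambda>x. ennreal \<bar>u t x\<bar>)"
    using V_bound_q[OF t] M q by (elim Lp_bound_mono_AE) auto
  show "Lp_norm q (u t) \<le> M * t powr - b"
    using * M q by (intro Lp_bound_Lp_norm(2)) auto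
qed

lemma Duhamel_nn_diff_mono:
  assumes "\<And>\<tau>. 0 < \<tau> \<Longrightarrow> AE y in lborel. F \<tau> y \<le> G \<tau> y"
  shows "Duhamel_nn_diff F s t x \<le> Duhamel_nn_diff G s t x"
  unfolding Duhamel_nn_diff_def
proof (rule nn_integral_mono)
  fix \<tau> :: real
  show "(\<integral>\<^sup>+ y. ennreal \<bar>duhamel_kernel t \<tau> (x - y) - duhamel_kernel s \<tau> (x - y)\<bar> * F \<tau> y \<partial>lborel)
    \<le> (\<integral>\<^sup>+ y. ennreal \<bar>duhamel_kernel t \<tau> (x - y) - duhamel_kernel s \<tau> (x - y)\<bar> * G \<tau> y \<partial>lborel)"
  proof (cases "0 < \<tau>")
    case True
    then have "AE y in lborel. F \<tau> y \<le> G \<tau> y" using assms by auto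
    then show ?thesis by (intro nn_integral_mono_AE) (auto elim!: eventually_mono intro!: mult_left_mono)
  qed (auto simp: duhamel_kernel_def)
qed

lemma Duhamel_nn_diff_commute: "Duhamel_nn_diff F s t x = Duhamel_nn_diff F t s x"
  unfolding Duhamel_nn_diff_def by (simp add: abs_minus_commute)

text \<open>The change of u between s and t is dominated by the free part and by the time difference
  of the Duhamel integral of c V^p. Neither depends on a or u, hence d does not either.\<close>

lemma equicontinuity:
  assumes t: "0 < t" and e: "0 < e"
  shows "\<exists>d>0. \<forall>s>0. \<bar>s - t\<bar> < d \<longrightarrow> (\<forall>a u. solves a u \<longrightarrow> \<bar>Lp_norm q (u t) - Lp_norm q (u s)\<bar> \<le> e)"
proof -
  obtain d where d: "0 < d" "\<And>s. 0 < s \<Longrightarrow> \<bar>s - t\<bar> < d \<Longrightarrow> s \<noteq> t \<Longrightarrow>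
      Lp_bound q e (\<lambda>x. ennreal \<bar>U0 t x - U0 s x\<bar> + Duhamel_nn_diff (\<lambda>\<tau> y. ennreal (c \<tau>) * epow p (V \<tau> y)) (min s t) (max s t) x)"
    using equi[OF t e] by blast
  have "\<bar>Lp_norm q (u t) - Lp_norm q (u s)\<bar> \<le> e" if s: "0 < s" "\<bar>s - t\<bar> < d" and u: "solves a u" for s a u
  proof (cases "s = t")
    case False
    note sec [measurable] = solves_section[OF u]
    have adm: "admissible a" and um: "case_prod u \<in> borel_measurable lborel2"
      and uV: "\<And>t. 0 < t \<Longrightarrow> AE x in lborel. ennreal \<bar>u t x\<bar> \<le> V t x"
      and eq: "\<And>t. 0 < t \<Longrightarrow> AE x in lborel. u t x = U0 t x + Duhamel (source a u) t x"
      using u by (auto simp: solves_def)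
    have sm: "case_prod (source a u) \<in> borel_measurable lborel2"
      using adm um by (auto simp: admissible_def)
    have "AE x in lborel. ennreal \<bar>u t x - u s x\<bar>
       \<le> ennreal \<bar>U0 t x - U0 s x\<bar> + Duhamel_nn_diff (\<lambda>\<tau> y. ennreal (c \<tau>) * epow p (V \<tau> y)) (min s t) (max s t) x"
      using eq[OF t] eq[OF s(1)] V_AE_finite[OF t] V_AE_finite[OF s(1)]
    proof eventually_elim
      case (elim x)
      let ?D = "Duhamel (source a u)"
      have fin: "Duhamel_nn (\<lambda>\<tau> y. ennreal \<bar>source a u \<tau> y\<bar>) t x < \<infinity>" "Duhamel_nn (\<lambda>\<tau> y. ennreal \<bar>source a u \<tau> y\<bar>) s x < \<infinity>"
        using elim by (auto intro: le_less_trans[OF Duhamel_nn_source_le[OF adm uV]])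
      have "ennreal \<bar>u t x - u s x\<bar> \<le> ennreal (\<bar>U0 t x - U0 s x\<bar> + \<bar>?D t x - ?D s x\<bar>)"
        using elim by (intro ennreal_leI) simp
      also have "\<dots> = ennreal \<bar>U0 t x - U0 s x\<bar> + ennreal \<bar>?D t x - ?D s x\<bar>" by simp
      also have "ennreal \<bar>?D t x - ?D s x\<bar> \<le> Duhamel_nn_diff (\<lambda>\<tau> y. ennreal \<bar>source a u \<tau> y\<bar>) s t x"
        by (rule Duhamel_time_diff_le[OF sm fin])
      also have "\<dots> \<le> Duhamel_nn_diff (\<lambda>\<tau> y. ennreal (c \<tau>) * epow p (V \<tau> y)) s t x"
      proof (rule Duhamel_nn_diff_mono)
        fix \<tau> :: real assume \<tau>: "0 < \<tau>"
        show "AE y in lborel. ennreal \<bar>source a u \<tau> y\<bar> \<le> ennreal (c \<tau>) * epow p (V \<tau> y)"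
          using uV[OF \<tau>] by eventually_elim (use source_bounds[OF adm \<tau>] in auto)
      qed
      also have "\<dots> = Duhamel_nn_diff (\<lambda>\<tau> y. ennreal (c \<tau>) * epow p (V \<tau> y)) (min s t) (max s t) x"
        by (auto simp: min_def max_def Duhamel_nn_diff_commute)
      finally show ?case by (simp add: add_left_mono)
    qed
    then have L: "Lp_bound q e (\<lambda>x. ennreal \<bar>u t x - u s x\<bar>)"
      using d(2)[OF s False] e q by (elim Lp_bound_mono_AE) auto
    then have L': "Lp_bound q e (\<lambda>x. ennreal \<bar>u s x - u t x\<bar>)" by (simp add: abs_minus_commute)
    have "Lp_norm q (u t) \<le> Lp_norm q (u s) + e"
      using M e q by (intro Lp_norm_diff_le[OF sec sec solves_bound(1)[OF u s(1)] _ L]) auto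
    moreover have "Lp_norm q (u s) \<le> Lp_norm q (u t) + e"
      using M e q by (intro Lp_norm_diff_le[OF sec sec solves_bound(1)[OF u t] _ L']) auto
    ultimately show ?thesis by simp
  qed (use e in simp)
  then show ?thesis using d(1) by blast
qed

primrec picard :: "(real \<Rightarrow> real) \<Rightarrow> nat \<Rightarrow> real \<Rightarrow> 'a \<Rightarrow> real" where
  "picard a 0 = U0"
| "picard a (Suc n) = (\<lambda>t x. U0 t x + Duhamel (source a (picard a n)) t x)"

text \<open>An explicit solution operator rather than an arbitrary solution: its dependence on the
  coefficient can be read off from the iterates.\<close>

definition picard_limit :: "(real \<Rightarrow> real) \<Rightarrow> real \<Rightarrow> 'a \<Rightarrow> real" where
  "picard_limit a = (\<lambda>t x. if Cauchy (\<lambda>n. picard a n t x) then lim (\<lambda>n. picard a n t x) else 0)"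

lemma solves_picard_limit:
  assumes a: "admissible a"
  shows "solves a (picard_limit a)"
proof -
  have [measurable]: "a \<in> borel_measurable borel" using a by (simp add: admissible_def)
  have meas: "case_prod (picard a n) \<in> borel_measurable lborel2" for n
    by (induction n) (simp_all add: U0_measurable)
  have bound: "ennreal \<bar>picard a n t x\<bar> \<le> V t x" for n t x
  proof (induction n arbitrary: t x)
    case 0
    have "ennreal \<bar>U0 t x\<bar> \<le> U t x" by (rule U0_le)
    also have "\<dots> \<le> V t x" by (subst V_eq) simp
    finally show ?case by simp
  next
    case (Suc n)
    note meas [measurable]
    have "ennreal \<bar>picard a (Suc n) t x\<bar> \<le> ennreal (\<bar>U0 t x\<bar> + \<bar>Duhamel (source a (picard a n)) t x\<bar>)"
      by (intro ennreal_leI) simp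
    also have "\<dots> = ennreal \<bar>U0 t x\<bar> + ennreal \<bar>Duhamel (source a (picard a n)) t x\<bar>" by simp
    also have "\<dots> \<le> U t x + Duhamel_nn (\<lambda>\<tau> y. ennreal \<bar>source a (picard a n) \<tau> y\<bar>) t x"
      by (intro add_mono U0_le Duhamel_le) measurable
    also have "\<dots> \<le> U t x + Duhamel_nn (\<lambda>\<tau> y. ennreal (c \<tau>) * epow p (V \<tau> y)) t x"
      using source_bounds[OF a, where u="picard a n"] Suc.IH by (intro add_left_mono Duhamel_nn_mono AE_I2) auto
    also have "\<dots> = V t x" by (rule V_eq[symmetric])
    finally show ?case .
  qed
  have [measurable]: "case_prod (picard a n) \<in> borel_measurable lborel2" for n by (rule meas)
  have "case_prod (picard_limit a) \<in> borel_measurable lborel2"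
    "\<And>t. 0 < t \<Longrightarrow> AE x in lborel. ennreal \<bar>picard_limit a t x\<bar> \<le> V t x"
    "\<And>t. 0 < t \<Longrightarrow> AE x in lborel. picard_limit a t x = U0 t x + Duhamel (source a (picard_limit a)) t x"
    using limit_solution(1,4,5)[of "picard a" "\<lambda>_. a" a "\<lambda>n. n" "picard_limit a"] a bound meas
    by (auto simp: picard_limit_def)
  then show ?thesis using a by (simp add: solves_def)
qed

text \<open>Each Picard iterate at time s uses the coefficient only on (0, s), and the property
  passes to the limit. No uniqueness theorem for solutions is involved.\<close>

lemma picard_limit_causal:
  assumes "\<And>s. 0 < s \<Longrightarrow> s < t \<Longrightarrow> a s = a' s" "s \<le> t"
  shows "picard_limit a s = picard_limit a' s"
proof -
  have "picard a n s = picard a' n s" if "s \<le> t" for n s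
    using that
  proof (induction n arbitrary: s)
    case (Suc n)
    have "Duhamel (source a (picard a n)) s x = Duhamel (source a' (picard a' n)) s x" for x
      using Suc assms by (intro Duhamel_cong) (auto simp: source_def fun_eq_iff)
    then show ?case by simp
  qed simp
  then have "(\<lambda>n. picard a n s x) = (\<lambda>n. picard a' n s x)" for x using assms by (simp add: fun_eq_iff)
  then show ?thesis unfolding picard_limit_def by (simp cong: if_cong)
qed

(* Feeding the norm back with a delay h makes the coefficient explicit, because on (0, (j + 1) h]
   the iterate j + 1 only depends on the solution up to time j h. *)
primrec delayed :: "real \<Rightarrow> nat \<Rightarrow> real \<Rightarrow> real" where
  "delayed h 0 = (\<lambda>_. 0)"
| "delayed h (Suc j) = (\<lambda>t. if h < t then min (c t) (norm_power \<alpha> (Lp_norm q (picard_limit (delayed h j) (t - h)))) else 0)"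

lemma Lp_norm_measurable [measurable]:
  assumes [measurable]: "case_prod u \<in> borel_measurable lborel2"
  shows "(\<lambda>t. Lp_norm q (u t)) \<in> borel_measurable borel"
proof -
  have "(\<lambda>t. Lp_norm q (u t)) \<in> borel_measurable lborel"
    unfolding Lp_norm_def by measurable
  then show ?thesis by simp
qed

text \<open>The minimum with \<open>c t\<close> in \<open>delayed\<close> is needed here: the norm
  at time t - h is bounded only by M (t - h)^-b, which may exceed the bound at time t.\<close>

lemma admissible_delayed:
  assumes "0 < h"
  shows "admissible (delayed h j)"
proof (induction j)
  case 0
  then show ?case using c_nonneg by (simp add: admissible_def)
next
  case (Suc j)
  have [measurable]: "case_prod (picard_limit (delayed h j)) \<in> borel_measurable lborel2"
    using solves_picard_limit[OF Suc] by (simp add: solves_def)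
  have "(\<lambda>t. norm_power \<alpha> (Lp_norm q (picard_limit (delayed h j) (t - h)))) \<in> borel_measurable borel"
    by (intro norm_power_measurable measurable_compose[OF _ Lp_norm_measurable]) auto
  then show ?case using c_nonneg by (auto simp: admissible_def)
qed

text \<open>Induction over time slabs of length h: the coefficient at t reads the solution only at t
  - h, one slab earlier, where causality and the induction hypothesis apply.\<close>

lemma delayed_stable:
  assumes h: "0 < h" and "t \<le> real (Suc j) * h"
  shows "delayed h (Suc j) t = delayed h j t"
  using assms(2)
proof (induction j arbitrary: t)
  case (Suc j)
  show ?case
  proof (cases "h < t")
    case True
    have "picard_limit (delayed h (Suc j)) (t - h) = picard_limit (delayed h j) (t - h)"
    proof (rule picard_limit_causal)
      fix s assume "s < t - h"
      then show "delayed h (Suc j) s = delayed h j s"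
        using Suc.prems by (intro Suc.IH) (simp add: algebra_simps)
    qed simp
    then show ?thesis using True by simp
  qed simp
qed simp

lemma nonlocal_solution:
  "\<exists>v. case_prod v \<in> borel_measurable lborel2 \<and>
    (\<forall>t>0. AE x in lborel. ennreal \<bar>v t x\<bar> \<le> V t x) \<and>
    (\<forall>t>0. AE x in lborel. v t x = U0 t x + Duhamel (\<lambda>\<tau> y. norm_power \<alpha> (Lp_norm q (v \<tau>)) * \<bar>v \<tau> y\<bar> powr p) t x)"
proof -
  define h where "h n = 1 / real (Suc n)" for n
  have h: "0 < h n" for n by (simp add: h_def)
  have h0: "h \<longlonglongrightarrow> 0" unfolding h_def using LIMSEQ_inverse_real_of_nat by (simp add: inverse_eq_divide)
  \<comment> \<open>(n+1)^2 slabs of length 1/(n+1) reach time n + 1. Up to that time the delayed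
    relation holds exactly, and this horizon grows with n.\<close>
  define ak where "ak n = delayed (h n) ((Suc n)^2)" for n
  define uk where "uk n = picard_limit (ak n)" for n
  define bk where "bk n t = Lp_norm q (uk n t)" for n t
  have uk: "solves (ak n) (uk n)" for n
    unfolding uk_def ak_def by (intro solves_picard_limit admissible_delayed h)
  have ak_eq: "ak n t = min (c t) (norm_power \<alpha> (bk n (t - h n)))" if "h n < t" "t \<le> real (Suc n)" for n t
  proof -
    have "real (Suc n) \<le> real (Suc ((Suc n)^2)) * h n"
      unfolding h_def by (simp add: field_simps power2_eq_square)
    then have "ak n t = delayed (h n) (Suc ((Suc n)^2)) t"
      unfolding ak_def using that by (intro delayed_stable[symmetric] h) linarith
    then show ?thesis using that by (simp add: ak_def[symmetric] uk_def[symmetric] bk_def del: power_Suc)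
  qed
  have bk0: "0 \<le> bk n t" for n t by (simp add: bk_def)
  have bk_le: "bk n t \<le> M * t powr - b" if "0 < t" for n t
    unfolding bk_def using solves_bound(2)[OF uk that] .
  have bk_equi: "\<exists>d>0. \<forall>s>0. \<bar>s - t\<bar> < d \<longrightarrow> (\<forall>n. \<bar>bk n t - bk n s\<bar> \<le> e)" if "0 < t" "0 < e" for t e
    using equicontinuity[OF that] uk unfolding bk_def by meson
  \<comment> \<open>A diagonal argument gives convergence on a countable dense set of times;
    equicontinuity extends it to every t > 0.\<close>
  define S where "S = \<rat> \<inter> {0::real<..}"
  have cS: "countable S" unfolding S_def by (simp add: countable_rat)
  \<comment> \<open>Division by M t^-b brings the values into [0, 1], as the selection principle
    needs a bound independent of t.\<close>
  obtain k where k: "strict_mono (k :: nat \<Rightarrow> nat)"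
      "\<And>t. t \<in> S \<Longrightarrow> \<exists>l. (\<lambda>n. bk (k n) t / (M * t powr - b)) \<longlonglongrightarrow> l"
  proof (rule function_convergent_subsequence[OF cS, of "\<lambda>n t. bk n t / (M * t powr - b)" 1])
    fix n t assume "t \<in> S"
    then have "0 < t" by (simp add: S_def)
    then show "norm (bk n t / (M * t powr - b)) \<le> 1"
      using bk0[of n t] bk_le[of t n] M by (simp add: divide_le_eq)
  qed blast
  have conv_S: "convergent (\<lambda>n. bk (k n) t)" if tS: "t \<in> S" for t
  proof -
    have t: "0 < t" using tS by (simp add: S_def)
    obtain l where "(\<lambda>n. bk (k n) t / (M * t powr - b)) \<longlonglongrightarrow> l" using k(2)[OF tS] by blast
    then have "(\<lambda>n. M * t powr - b * (bk (k n) t / (M * t powr - b))) \<longlonglongrightarrow> M * t powr - b * l"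
      by (intro tendsto_intros)
    moreover have "M * t powr - b * (bk (k n) t / (M * t powr - b)) = bk (k n) t" for n
      using t M by simp
    ultimately show ?thesis by (auto simp: convergent_def)
  qed
  have conv: "convergent (\<lambda>n. bk (k n) t)" if t: "0 < t" for t
  proof -
    have "Cauchy (\<lambda>n. bk (k n) t)"
      unfolding Cauchy_def dist_real_def
    proof (intro allI impI)
      fix e :: real assume e: "0 < e"
      obtain d where d: "0 < d" "\<And>s n. 0 < s \<Longrightarrow> \<bar>s - t\<bar> < d \<Longrightarrow> \<bar>bk n t - bk n s\<bar> \<le> e / 4"
        using bk_equi[OF t, of "e/4"] e by auto
      obtain s where s: "s \<in> \<rat>" "t < s" "s < t + d" using Rats_dense_in_real[of t "t + d"] d by auto
      then have sS: "s \<in> S" using t by (simp add: S_def)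
      have "Cauchy (\<lambda>n. bk (k n) s)" using conv_S[OF sS] by (simp add: Cauchy_convergent_iff)
      then obtain n0 where n0: "\<And>m n. n0 \<le> m \<Longrightarrow> n0 \<le> n \<Longrightarrow> \<bar>bk (k m) s - bk (k n) s\<bar> < e / 4"
        unfolding Cauchy_def dist_real_def using e by (meson divide_pos_pos zero_less_numeral)
      have "\<bar>bk (k m) t - bk (k n) t\<bar> < e" if "n0 \<le> m" "n0 \<le> n" for m n
        using n0[OF that] d(2)[of s "k m"] d(2)[of s "k n"] s t by (simp add: abs_if split: if_splits)
      then show "\<exists>M. \<forall>m\<ge>M. \<forall>n\<ge>M. \<bar>bk (k m) t - bk (k n) t\<bar> < e" by blast
    qed
    then show ?thesis by (simp add: Cauchy_convergent_iff)
  qed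
  define bb where "bb t = lim (\<lambda>n. bk (k n) t)" for t
  have bb: "(\<lambda>n. bk (k n) t) \<longlonglongrightarrow> bb t" if "0 < t" for t
    using conv[OF that] by (simp add: bb_def convergent_LIMSEQ_iff)
  have k_top: "filterlim k at_top sequentially" using k(1) by (rule filterlim_subseq)
  have hk0: "(\<lambda>n. h (k n)) \<longlonglongrightarrow> 0" using filterlim_compose[OF h0 k_top] .
  \<comment> \<open>The modulus at t is uniform in n, so the vanishing delay does not change the
    limit; h (k n) < t keeps the shifted time positive.\<close>
  have bb_shift: "(\<lambda>n. bk (k n) (t - h (k n))) \<longlonglongrightarrow> bb t" if t: "0 < t" for t
  proof -
    have "(\<lambda>n. bk (k n) (t - h (k n)) - bk (k n) t) \<longlonglongrightarrow> 0"
    proof (rule LIMSEQ_I)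
      fix e :: real assume e: "0 < e"
      obtain d where d: "0 < d" "\<And>s n. 0 < s \<Longrightarrow> \<bar>s - t\<bar> < d \<Longrightarrow> \<bar>bk n t - bk n s\<bar> \<le> e / 2"
        using bk_equi[OF t, of "e/2"] e by auto
      have "\<forall>\<^sub>F n in sequentially. h (k n) < min d t"
        using hk0 d t by (intro order_tendstoD(2)[where y=0]) auto
      then obtain n0 where n0: "\<And>n. n0 \<le> n \<Longrightarrow> h (k n) < min d t" by (auto simp: eventually_sequentially)
      have "norm (bk (k n) (t - h (k n)) - bk (k n) t - 0) < e" if "n0 \<le> n" for n
        using d(2)[of "t - h (k n)" "k n"] n0[OF that] h[of "k n"] e by (simp add: abs_minus_commute)
      then show "\<exists>no. \<forall>n\<ge>no. norm (bk (k n) (t - h (k n)) - bk (k n) t - 0) < e" by blast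
    qed
    from tendsto_add[OF this bb[OF t]] show ?thesis by simp
  qed
  have bb_range: "0 \<le> bb t" "bb t \<le> M * t powr - b" if t: "0 < t" for t
    using LIMSEQ_le_const[OF bb[OF t]] LIMSEQ_le_const2[OF bb[OF t]] bk0 bk_le[OF t] by auto
  have ak_lim: "(\<lambda>n. ak (k n) t) \<longlonglongrightarrow> norm_power \<alpha> (bb t)" if t: "0 < t" for t
  proof -
    have "\<forall>\<^sub>F n in sequentially. h (k n) < t"
      using hk0 t by (intro order_tendstoD(2)[where y=0]) auto
    moreover have "\<forall>\<^sub>F n in sequentially. t \<le> real (k n)"
      using filterlim_compose[OF filterlim_real_sequentially k_top] by (simp add: filterlim_at_top)
    ultimately have "\<forall>\<^sub>F n in sequentially. min (c t) (norm_power \<alpha> (bk (k n) (t - h (k n)))) = ak (k n) t"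
      by eventually_elim (simp add: ak_eq)
    moreover have "(\<lambda>n. min (c t) (norm_power \<alpha> (bk (k n) (t - h (k n))))) \<longlonglongrightarrow> min (c t) (norm_power \<alpha> (bb t))"
      by (intro tendsto_min tendsto_const norm_power_tendsto \<alpha> bk0 bb_shift t)
    \<comment> \<open>In the limit the cut-off is inactive: bb t is again bounded by M t^-b, and c t
      is the coefficient belonging to that bound.\<close>
    moreover have "min (c t) (norm_power \<alpha> (bb t)) = norm_power \<alpha> (bb t)"
      using c_eq[OF t] norm_power_mono[OF \<alpha> bb_range[OF t]] by simp
    ultimately show ?thesis by (simp cong: filterlim_cong add: tendsto_cong)
  qed
  \<comment> \<open>Defined as a limit of the measurable functions \<open>ak (k n)\<close> and not
    through \<open>bb\<close>, so that measurability is immediate.\<close>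
  define aa where "aa t = (if 0 < t then lim (\<lambda>n. ak (k n) t) else 0)" for t
  have aa: "aa t = norm_power \<alpha> (bb t)" if "0 < t" for t
    using ak_lim[OF that] that by (simp add: aa_def limI)
  have [measurable]: "ak n \<in> borel_measurable borel" for n
    using uk[of n] by (simp add: solves_def admissible_def)
  have aam: "aa \<in> borel_measurable borel" unfolding aa_def by measurable
  define v where "v = (\<lambda>t x. if Cauchy (\<lambda>n. uk (k n) t x) then lim (\<lambda>n. uk (k n) t x) else 0)"
  have v_meas: "case_prod v \<in> borel_measurable lborel2"
    and v_conv: "\<And>t. 0 < t \<Longrightarrow> AE x in lborel. (\<lambda>n. uk (k n) t x) \<longlonglongrightarrow> v t x"
    and vV: "\<And>t. 0 < t \<Longrightarrow> AE x in lborel. ennreal \<bar>v t x\<bar> \<le> V t x"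
    and v_eq: "\<And>t. 0 < t \<Longrightarrow> AE x in lborel. v t x = U0 t x + Duhamel (source aa v) t x"
  proof -
    have 1: "case_prod (uk (k n)) \<in> borel_measurable lborel2" for n using uk by (simp add: solves_def)
    \<comment> \<open>\<open>limit_solution\<close> relates \<open>u (Suc n)\<close> to the
      coefficient with index n, whereas an exact solution carries one index throughout; hence the
      coefficients are shifted by one.\<close>
    have 2: "admissible (ak (k (Suc n)))" for n using uk by (simp add: solves_def)
    have 3: "(\<lambda>n. ak (k (Suc n)) t) \<longlonglongrightarrow> aa t" if "0 < t" for t
      using LIMSEQ_Suc[OF ak_lim[OF that]] aa[OF that] by simp
    have 4: "n \<le> Suc n" for n by simp
    have 5: "AE x in lborel. ennreal \<bar>uk (k n) t x\<bar> \<le> V t x" if "0 < t" for n t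
      using uk that by (simp add: solves_def)
    have 6: "AE x in lborel. uk (k (Suc n)) t x = U0 t x + Duhamel (source (ak (k (Suc n))) (uk (k (Suc n)))) t x"
      if "0 < t" for n t
      using uk that by (simp add: solves_def)
    note L = limit_solution[where u="\<lambda>n. uk (k n)" and a="\<lambda>n. ak (k (Suc n))" and s=Suc, OF 1 2 aam 3 4 5 6 v_def]
    show "case_prod v \<in> borel_measurable lborel2" by (rule L(1))
    show "AE x in lborel. (\<lambda>n. uk (k n) t x) \<longlonglongrightarrow> v t x" if "0 < t" for t by (rule L(3)[OF _ _ _ that])
    show "AE x in lborel. ennreal \<bar>v t x\<bar> \<le> V t x" if "0 < t" for t by (rule L(4)[OF _ _ _ that])
    show "AE x in lborel. v t x = U0 t x + Duhamel (source aa v) t x" if "0 < t" for t by (rule L(5)[OF _ _ _ that])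
  qed
  \<comment> \<open>Here the loop closes: bb is the limit of the norms, and the norms converge to
    the norm of v.\<close>
  have aav: "aa t = norm_power \<alpha> (Lp_norm q (v t))" if t: "0 < t" for t
  proof -
    have "v t \<in> borel_measurable lborel"
      using measurable_Pair2[OF v_meas, of t] by simp
    then have "(\<lambda>n. bk (k n) t) \<longlonglongrightarrow> Lp_norm q (v t)"
      unfolding bk_def using uk q t v_conv[OF t]
      by (intro Lp_norm_dominated_convergence[OF solves_section[OF uk] _ V_bound_q[OF t]]) (auto simp: solves_def)
    then have "bb t = Lp_norm q (v t)" using bb[OF t] by (rule LIMSEQ_unique[rotated])
    then show ?thesis using aa[OF t] by simp
  qed
  have "Duhamel (source aa v) t x = Duhamel (\<lambda>\<tau> y. norm_power \<alpha> (Lp_norm q (v \<tau>)) * \<bar>v \<tau> y\<bar> powr p) t x" for t x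
    by (intro Duhamel_cong) (simp add: source_def fun_eq_iff aav)
  then show ?thesis using v_meas vV v_eq by (intro exI[of _ v]) auto
qed

end


section \<open>Small data\<close>

lemma Lp_imp_Lp_bound:
  fixes f :: "'a::euclidean_space \<Rightarrow> real"
  assumes f: "f \<in> Lp m" and C: "Lp_norm m f \<le> C"
  shows "Lp_bound m C (\<lambda>x. ennreal \<bar>f x\<bar>)"
proof -
  have m: "1 \<le> m" and [measurable]: "f \<in> borel_measurable lborel"
    and int: "integrable lborel (\<lambda>x. \<bar>f x\<bar> powr m)"
    using f by (auto simp: Lp_def)
  define I where "I = (LINT x|lborel. \<bar>f x\<bar> powr m)"
  have I0: "0 \<le> I" unfolding I_def by (rule Bochner_Integration.integral_nonneg) auto
  have eq: "(\<integral>\<^sup>+x. ennreal (\<bar>f x\<bar> powr m) \<partial>lborel) = ennreal I"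
    unfolding I_def using int by (intro nn_integral_eq_integral) auto
  have "Lp_bound m (Lp_norm m f) (\<lambda>x. ennreal \<bar>f x\<bar>)"
    using eq I0 m by (simp add: Lp_bound_def Lp_norm_def powr_powr flip: I_def)
  then show ?thesis using C m by (elim Lp_bound_mono_AE) auto
qed

lemma Lp_bound_mono_factor:
  assumes "Lp_bound m (A * x) f" "A \<le> B" "0 \<le> A" "0 \<le> x" "0 \<le> m"
  shows "Lp_bound m (B * x) f"
  using assms(1) by (rule Lp_bound_mono_AE) (use assms Lp_bound_measurable in \<open>auto intro: mult_right_mono\<close>)

text \<open>The expression is continuous in s at t > 0 and vanishes at s = t because
  \<open>\<omega>\<close> > 0. The three terms are the shapes of the bounds for the initial datum,
  the forcing and the source.\<close>

lemma modulus_small: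
  fixes t e \<omega> A B C a b c :: real
  assumes t: "0 < t" and e: "0 < e" and \<omega>: "0 < \<omega>"
  shows "\<exists>d>0. \<forall>s>0. \<bar>s - t\<bar> < d \<longrightarrow> s \<noteq> t \<longrightarrow>
    (max s t - min s t) powr \<omega> * (A * min s t powr a + B * (min s t powr b + max s t powr b)
      + C * (min s t powr c + max s t powr c)) < e"
proof -
  let ?f = "\<lambda>s. (max s t - min s t) powr \<omega> * (A * min s t powr a + B * (min s t powr b + max s t powr b)
      + C * (min s t powr c + max s t powr c))"
  have "((\<lambda>s. (max s t - min s t) powr \<omega>) \<longlongrightarrow> (max t t - min t t) powr \<omega>) (at t)"
    using \<omega> by (intro tendsto_powr' tendsto_intros always_eventually) (auto simp: min_le_iff_disj le_max_iff_disj)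
  moreover have "((\<lambda>s. A * min s t powr a + B * (min s t powr b + max s t powr b)
      + C * (min s t powr c + max s t powr c)) \<longlongrightarrow> A * min t t powr a + B * (min t t powr b + max t t powr b)
      + C * (min t t powr c + max t t powr c)) (at t)"
    using t by (intro tendsto_intros) auto
  ultimately have "(?f \<longlongrightarrow> ?f t) (at t)" by (rule tendsto_mult)
  then have "\<forall>\<^sub>F s in at t. ?f s < e" using e \<omega> by (intro order_tendstoD(2)) auto
  then show ?thesis unfolding eventually_at dist_real_def by blast
qed

text \<open>\<open>bq\<close> and \<open>br\<close> are the decay rates in L^q and L^r;
  \<open>g1\<close> and \<open>g2\<close> are the smoothing exponents from L^(r/p), where the source
  lives, to L^r and L^q; \<open>\<kappa>\<close> is the singularity of the source at time 0.
  \<open>scal\<close> says that the source term reproduces the rates exactly, \<open>lpc\<close>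
  that the forcing does, and \<open>small\<close> keeps the kernel singularities of the forcing
  integrable.\<close>

lemma small_data_solution:
  fixes N q \<alpha> \<rho> p pc l r bq br :: real
  assumes N: "N = real DIM('a::euclidean_space)" "2 \<le> N"
    and q: "1 < q" and \<alpha>: "0 \<le> \<alpha>" and p: "1 < p" and \<rho>: "-1 < \<rho>"
    and pc: "1 \<le> pc" "pc \<le> q" and l: "1 \<le> l" "l \<le> q" and r: "q \<le> r" "p \<le> r" "r / p \<le> q"
    and bq: "bq = N / 2 * (1 / pc - 1 / q)" and br: "br = N / 2 * (1 / pc - 1 / r)"
    and lpc: "N / 2 * (1 / l) = N / 2 * (1 / pc) + \<rho> + 1"
    and small: "bq + \<rho> < 0" "br + \<rho> < 0"
    and g1: "g1 = N / 2 * (1 / (r / p) - 1 / r)" "g1 < 1" and g2: "g2 = N / 2 * (1 / (r / p) - 1 / q)" "g2 < 1"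
    and \<kappa>: "\<kappa> = \<alpha> * bq + p * br" "\<kappa> < 1"
    and scal: "1 - g1 - \<kappa> = - br" "1 - g2 - \<kappa> = - bq"
  shows "\<exists>\<epsilon>>0. \<forall>(u0 :: 'a \<Rightarrow> real) (w :: 'a \<Rightarrow> real).
    u0 \<in> Lp pc \<and> w \<in> Lp l \<and> Lp_norm pc u0 + Lp_norm l w < \<epsilon> \<longrightarrow> (\<exists>u. global_mild_solution q \<alpha> p \<rho> u0 w u)"
proof -
  let ?S = "\<lambda>F::real \<Rightarrow> 'a \<Rightarrow> ennreal. case_prod F \<in> borel_measurable lborel2"
  have rp: "1 \<le> r / p" "r / p \<le> r" "1 \<le> r" "pc \<le> r" "l \<le> r" using p r q pc l by (auto simp: field_simps)
  define gw where "gw = N / 2 * (1 / l - 1 / q)"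
  have gw: "gw = bq + \<rho> + 1" "gw < 1" using lpc bq small by (auto simp: gw_def algebra_simps)
  define gr where "gr = N / 2 * (1 / l - 1 / r)"
  have gr: "gr = br + \<rho> + 1" "gr < 1" using lpc br small by (auto simp: gr_def algebra_simps)
  obtain B1 where B1: "0 < B1" "\<And>C F t. 0 < C \<Longrightarrow> ?S F \<Longrightarrow> (\<And>\<tau>. 0 < \<tau> \<Longrightarrow> Lp_bound (r / p) (C * \<tau> powr - \<kappa>) (F \<tau>)) \<Longrightarrow> 0 < t
      \<Longrightarrow> Lp_bound r (B1 * C * t powr (1 - g1 - \<kappa>)) (Duhamel_nn F t)"
    by (fact Duhamel_bound[where ?'a='a, OF rp(1,2) g1[unfolded N(1)] \<kappa>(2)])
  obtain B2 where B2: "0 < B2" "\<And>C F t. 0 < C \<Longrightarrow> ?S F \<Longrightarrow> (\<And>\<tau>. 0 < \<tau> \<Longrightarrow> Lp_bound (r / p) (C * \<tau> powr - \<kappa>) (F \<tau>)) \<Longrightarrow> 0 < t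
      \<Longrightarrow> Lp_bound q (B2 * C * t powr (1 - g2 - \<kappa>)) (Duhamel_nn F t)"
    by (fact Duhamel_bound[where ?'a='a, OF rp(1) r(3) g2[unfolded N(1)] \<kappa>(2)])
  have \<rho>': "- \<rho> < 1" using \<rho> by simp
  obtain Br where Br: "0 < Br" "\<And>C F t. 0 < C \<Longrightarrow> ?S F \<Longrightarrow> (\<And>\<tau>. 0 < \<tau> \<Longrightarrow> Lp_bound l (C * \<tau> powr - (- \<rho>)) (F \<tau>)) \<Longrightarrow> 0 < t
      \<Longrightarrow> Lp_bound r (Br * C * t powr (1 - gr - (- \<rho>))) (Duhamel_nn F t)"
    by (fact Duhamel_bound[where ?'a='a, OF l(1) rp(5) gr_def[unfolded N(1)] gr(2) \<rho>'])
  obtain Bq where Bq: "0 < Bq" "\<And>C F t. 0 < C \<Longrightarrow> ?S F \<Longrightarrow> (\<And>\<tau>. 0 < \<tau> \<Longrightarrow> Lp_bound l (C * \<tau> powr - (- \<rho>)) (F \<tau>)) \<Longrightarrow> 0 < t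
      \<Longrightarrow> Lp_bound q (Bq * C * t powr (1 - gw - (- \<rho>))) (Duhamel_nn F t)"
    by (fact Duhamel_bound[where ?'a='a, OF l(1) l(2) gw_def[unfolded N(1)] gw(2) \<rho>'])
  \<comment> \<open>Half of the room left below 1, so that one Hoelder exponent in time serves the
    initial datum, the forcing and the source.\<close>
  define \<omega> where "\<omega> = 1 / 2 - max gw g2 / 2"
  have \<omega>0: "0 < \<omega>" "gw + \<omega> < 1" "g2 + \<omega> < 1"
  proof -
    define x where "x = max gw g2"
    have x: "gw \<le> x" "g2 \<le> x" "x < 1" using gw(2) g2(2) by (simp_all add: x_def)
    show "0 < \<omega>" using x(3) unfolding \<omega>_def x_def[symmetric] by linarith
    show "gw + \<omega> < 1" using x(1,3) unfolding \<omega>_def x_def[symmetric] by linarith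
    show "g2 + \<omega> < 1" using x(2,3) unfolding \<omega>_def x_def[symmetric] by linarith
  qed
  \<comment> \<open>\<open>heat_time_difference\<close> restricts \<open>\<omega>\<close> in terms
    of x = 1/m - 1/q, not of the smoothing exponent N x / 2. As N >= 2, the condition on the latter
    is the stronger one.\<close>
  have \<omega>le: "\<omega> \<le> 1 - x" if "0 \<le> x" "N / 2 * x + \<omega> < 1" for x
  proof -
    have "1 * x \<le> N / 2 * x" using N that by (intro mult_right_mono) auto
    then show ?thesis using that by simp
  qed
  have nn: "0 \<le> 1 / pc - 1 / q" "0 \<le> 1 / l - 1 / q" "0 \<le> 1 / (r / p) - 1 / q"
    using smoothing_exponent_nonneg(1)[OF pc refl] smoothing_exponent_nonneg(1)[OF l refl]
      smoothing_exponent_nonneg(1)[OF rp(1) r(3) refl] by auto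
  have \<omega>: "\<omega> \<le> 1 - (1 / pc - 1 / q)" "\<omega> \<le> 1 - (1 / l - 1 / q)" "\<omega> \<le> 1 - (1 / (r / p) - 1 / q)"
  proof -
    have "bq + \<omega> < 1" using \<omega>0(2) gw(1) \<rho> by linarith
    then show "\<omega> \<le> 1 - (1 / pc - 1 / q)" unfolding bq by (rule \<omega>le[OF nn(1)])
    show "\<omega> \<le> 1 - (1 / l - 1 / q)" using \<omega>0(2) unfolding gw_def by (rule \<omega>le[OF nn(2)])
    show "\<omega> \<le> 1 - (1 / (r / p) - 1 / q)" using \<omega>0(3) unfolding g2(1) by (rule \<omega>le[OF nn(3)])
  qed
  obtain Ds where Ds: "0 < Ds" "\<And>C F s t. 0 < C \<Longrightarrow> ?S F \<Longrightarrow> (\<And>\<tau>. 0 < \<tau> \<Longrightarrow> Lp_bound (r / p) (C * \<tau> powr - \<kappa>) (F \<tau>)) \<Longrightarrow> 0 < s \<Longrightarrow> s < t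
      \<Longrightarrow> Lp_bound q (Ds * C * (t - s) powr \<omega> * (s powr (1 - g2 - \<omega> - \<kappa>) + t powr (1 - g2 - \<omega> - \<kappa>))) (Duhamel_nn_diff F s t)"
    by (fact Duhamel_time_difference[where ?'a='a, OF rp(1) r(3) g2(1)[unfolded N(1)] \<kappa>(2) less_imp_le[OF \<omega>0(1)] \<omega>(3) \<omega>0(3)])
  obtain Dw where Dw: "0 < Dw" "\<And>C F s t. 0 < C \<Longrightarrow> ?S F \<Longrightarrow> (\<And>\<tau>. 0 < \<tau> \<Longrightarrow> Lp_bound l (C * \<tau> powr - (- \<rho>)) (F \<tau>)) \<Longrightarrow> 0 < s \<Longrightarrow> s < t
      \<Longrightarrow> Lp_bound q (Dw * C * (t - s) powr \<omega> * (s powr (1 - gw - \<omega> - (- \<rho>)) + t powr (1 - gw - \<omega> - (- \<rho>)))) (Duhamel_nn_diff F s t)"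
    by (fact Duhamel_time_difference[where ?'a='a, OF l gw_def[unfolded N(1)] \<rho>' less_imp_le[OF \<omega>0(1)] \<omega>(2) \<omega>0(2)])
  \<comment> \<open>Chosen so that M^(\<open>\<alpha>\<close> + p - 1) = 1 / (2 p (B1 + B2)). With
    the factor p this makes the linearised operator halve bounds; without it, the source term uses
    at most half of M.\<close>
  define M where "M = (1 / (2 * p * (B1 + B2))) powr (1 / (\<alpha> + p - 1))"
  have M: "0 < M" using p B1(1) B2(1) by (simp add: M_def)
  define m0 where "m0 = M powr (\<alpha> + p - 1)"
  have m0: "0 < m0" "m0 = 1 / (2 * p * (B1 + B2))"
    using p \<alpha> B1(1) B2(1) by (simp_all add: m0_def M_def powr_powr)
  have m0le: "B1 * p * m0 \<le> 1 / 2" "B2 * p * m0 \<le> 1 / 2"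
  proof -
    have *: "x * p * m0 = 1 / 2 * (x / (B1 + B2))" for x using p unfolding m0(2) by simp
    show "B1 * p * m0 \<le> 1 / 2" "B2 * p * m0 \<le> 1 / 2"
      unfolding * using B1(1) B2(1) by (simp_all add: divide_le_eq)
  qed
  have Bm: "B1 * m0 \<le> 1 / 2" "B2 * m0 \<le> 1 / 2"
  proof -
    have "B1 * m0 * 1 \<le> B1 * m0 * p" "B2 * m0 * 1 \<le> B2 * m0 * p"
      using p B1(1) B2(1) m0 by (intro mult_left_mono; simp)+
    then show "B1 * m0 \<le> 1 / 2" "B2 * m0 \<le> 1 / 2" using m0le by (simp_all add: mult_ac)
  qed
  have MM: "M powr (\<alpha> + p) = m0 * M" using M by (simp add: m0_def powr_diff)
  \<comment> \<open>With data of size \<open>\<epsilon>\<close>, the heat flow and the forcing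
    together use at most the other half of M, in L^r as well as in L^q.\<close>
  define \<epsilon> where "\<epsilon> = (M / 2) / (1 + Br + Bq)"
  have \<epsilon>: "0 < \<epsilon>" using M Br(1) Bq(1) by (simp add: \<epsilon>_def)
  have "1 + Br + Bq \<noteq> 0" using Br(1) Bq(1) by linarith
  then have \<epsilon>M: "(1 + Br + Bq) * \<epsilon> = M / 2"
    unfolding \<epsilon>_def by (subst times_divide_eq_right) (rule nonzero_mult_div_cancel_left)
  have \<epsilon>le: "\<epsilon> + Br * \<epsilon> \<le> M / 2" "\<epsilon> + Bq * \<epsilon> \<le> M / 2"
    using \<epsilon>M \<epsilon> Br(1) Bq(1) by (simp_all add: distrib_right flip: \<epsilon>M)
  define c where "c t = norm_power \<alpha> (M * t powr - bq)" for t
  have c: "c t = M powr \<alpha> * t powr (- (\<alpha> * bq))" if "0 < t" for t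
    using that M by (simp add: c_def norm_power_def powr_mult powr_powr mult.commute)
  have [measurable]: "c \<in> borel_measurable borel" unfolding c_def by measurable
  have cnn: "0 \<le> c t" for t by (simp add: c_def)
  have src: "Lp_bound (r / p) (M powr (\<alpha> + p) * \<tau> powr - \<kappa>) (\<lambda>y. ennreal (c \<tau>) * epow p (F y))"
    if "0 < \<tau>" and F: "Lp_bound r (M * \<tau> powr - br) F" for \<tau> and F :: "'a \<Rightarrow> ennreal"
  proof -
    have "Lp_bound (r / p) (c \<tau> * (M * \<tau> powr - br) powr p) (\<lambda>y. ennreal (c \<tau>) * epow p (F y))"
      using F M p cnn by (intro Lp_bound_cmult Lp_bound_epow) auto
    also have "c \<tau> * (M * \<tau> powr - br) powr p = (M powr \<alpha> * M powr p) * (\<tau> powr (- (\<alpha> * bq)) * \<tau> powr (- br * p))"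
      using that M by (simp add: c powr_mult powr_powr)
    also have "\<dots> = M powr (\<alpha> + p) * \<tau> powr - \<kappa>"
      unfolding powr_add[symmetric] \<kappa>(1) by (simp add: algebra_simps)
    finally show ?thesis .
  qed
  have "\<exists>u. global_mild_solution q \<alpha> p \<rho> u0 w u"
    if u0: "u0 \<in> Lp pc" and w: "w \<in> Lp l" and le: "Lp_norm pc u0 + Lp_norm l w < \<epsilon>" for u0 w :: "'a \<Rightarrow> real"
  proof -
    have [measurable]: "u0 \<in> borel_measurable lborel" "w \<in> borel_measurable lborel"
      using u0 w by (auto simp: Lp_def)
    have u0b: "Lp_bound pc \<epsilon> (\<lambda>x. ennreal \<bar>u0 x\<bar>)"
      using le Lp_norm_nonneg[of l w] by (intro Lp_imp_Lp_bound u0) linarith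
    have wb: "Lp_bound l \<epsilon> (\<lambda>x. ennreal \<bar>w x\<bar>)"
      using le Lp_norm_nonneg[of pc u0] by (intro Lp_imp_Lp_bound w) linarith
    define H where "H = (\<lambda>t x. \<integral>\<^sup>+y. ennreal (heat_kernel t (x - y)) * ennreal \<bar>u0 y\<bar> \<partial>lborel)"
    define f where "f = (\<lambda>\<tau> y. \<tau> powr \<rho> * w y)"
    define W where "W = (\<lambda>\<tau> y. ennreal (\<tau> powr \<rho>) * ennreal \<bar>w y\<bar>)"
    define U0 where "U0 = (\<lambda>t x. heat_semigroup t u0 x + Duhamel f t x)"
    define U where "U = (\<lambda>t x. H t x + Duhamel_nn W t x)"
    have [measurable]: "case_prod H \<in> borel_measurable lborel2" "case_prod f \<in> borel_measurable lborel2"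
      "case_prod W \<in> borel_measurable lborel2"
      unfolding H_def f_def W_def by measurable
    have [measurable]: "case_prod U0 \<in> borel_measurable lborel2" "case_prod U \<in> borel_measurable lborel2"
      unfolding U0_def U_def heat_semigroup_def by measurable
    have Wf: "W = (\<lambda>\<tau> y. ennreal \<bar>f \<tau> y\<bar>)" by (simp add: W_def f_def abs_mult ennreal_mult)
    have Wb: "Lp_bound l (\<epsilon> * \<tau> powr - (- \<rho>)) (W \<tau>)" for \<tau>
    proof -
      have "Lp_bound l (\<tau> powr \<rho> * \<epsilon>) (\<lambda>x. ennreal (\<tau> powr \<rho>) * ennreal \<bar>w x\<bar>)"
        using wb \<epsilon> by (intro Lp_bound_cmult) auto
      then show ?thesis by (simp add: W_def mult.commute)
    qed
    have U_r: "Lp_bound r (M / 2 * t powr - br) (U t)" if t: "0 < t" for t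
    proof -
      have "Lp_bound r (t powr - br * \<epsilon>) (H t)"
        unfolding H_def using t \<epsilon> u0b pc rp br N by (intro heat_smoothing) auto
      moreover have "Lp_bound r (Br * \<epsilon> * t powr (1 - gr - (- \<rho>))) (Duhamel_nn W t)"
        using t \<epsilon> Wb by (intro Br(2)) auto
      ultimately have "Lp_bound r (t powr - br * \<epsilon> + Br * \<epsilon> * t powr (1 - gr - (- \<rho>))) (U t)"
        unfolding U_def using \<epsilon> Br(1) t rp by (intro Lp_bound_add) auto
      also have "t powr - br * \<epsilon> + Br * \<epsilon> * t powr (1 - gr - (- \<rho>)) = (\<epsilon> + Br * \<epsilon>) * t powr - br"
        using gr by (simp add: algebra_simps)
      finally have "Lp_bound r ((\<epsilon> + Br * \<epsilon>) * t powr - br) (U t)" .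
      then show ?thesis
        by (rule Lp_bound_mono_factor) (use \<epsilon>le(1) \<epsilon> Br(1) rp in auto)
    qed
    have H_q: "Lp_bound q (t powr - bq * \<epsilon>) (H t)" if t: "0 < t" for t
      unfolding H_def using t \<epsilon> u0b pc bq N by (intro heat_smoothing) auto
    have U_q: "Lp_bound q (M / 2 * t powr - bq) (U t)" if t: "0 < t" for t
    proof -
      have "Lp_bound q (Bq * \<epsilon> * t powr (1 - gw - (- \<rho>))) (Duhamel_nn W t)"
        using t \<epsilon> Wb by (intro Bq(2)) auto
      with H_q[OF t] have "Lp_bound q (t powr - bq * \<epsilon> + Bq * \<epsilon> * t powr (1 - gw - (- \<rho>))) (U t)"
        unfolding U_def using \<epsilon> Bq(1) t q by (intro Lp_bound_add) auto
      also have "t powr - bq * \<epsilon> + Bq * \<epsilon> * t powr (1 - gw - (- \<rho>)) = (\<epsilon> + Bq * \<epsilon>) * t powr - bq"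
        using gw by (simp add: algebra_simps)
      finally have "Lp_bound q ((\<epsilon> + Bq * \<epsilon>) * t powr - bq) (U t)" .
      then show ?thesis
        by (rule Lp_bound_mono_factor) (use \<epsilon>le(2) \<epsilon> Bq(1) q in auto)
    qed
    have U_fin: "AE x in lborel. U t x < \<infinity>" if "0 < t" for t
      by (rule Lp_bound_AE_finite[OF U_q[OF that]])
    have U0U: "ennreal \<bar>U0 t x\<bar> \<le> U t x" for t x
    proof -
      have "ennreal \<bar>U0 t x\<bar> \<le> ennreal (\<bar>heat_semigroup t u0 x\<bar> + \<bar>Duhamel f t x\<bar>)"
        unfolding U0_def by (intro ennreal_leI) simp
      also have "\<dots> = ennreal \<bar>heat_semigroup t u0 x\<bar> + ennreal \<bar>Duhamel f t x\<bar>" by simp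
      also have "\<dots> \<le> (\<integral>\<^sup>+y. ennreal \<bar>heat_kernel t (x - y) * u0 y\<bar> \<partial>lborel) + Duhamel_nn W t x"
        unfolding heat_semigroup_def Wf by (intro add_mono abs_integral_le_nn_integral Duhamel_le) measurable
      also have "\<dots> = U t x" by (simp add: U_def H_def abs_mult ennreal_mult)
      finally show ?thesis .
    qed
    have stepM: "Lp_bound r (M / 2 * t powr - br) (Duhamel_nn (\<lambda>\<tau> y. ennreal (c \<tau>) * epow p (F \<tau> y)) t)"
      and stepMq: "Lp_bound q (M / 2 * t powr - bq) (Duhamel_nn (\<lambda>\<tau> y. ennreal (c \<tau>) * epow p (F \<tau> y)) t)"
      if [measurable]: "?S F" and F: "\<And>\<tau>. 0 < \<tau> \<Longrightarrow> Lp_bound r (M * \<tau> powr - br) (F \<tau>)" and t: "0 < t" for F t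
    proof -
      let ?F = "\<lambda>\<tau> y. ennreal (c \<tau>) * epow p (F \<tau> y)"
      have FF: "Lp_bound (r / p) (M powr (\<alpha> + p) * \<tau> powr - \<kappa>) (?F \<tau>)" if "0 < \<tau>" for \<tau>
        by (rule src[OF that F[OF that]])
      have [measurable]: "?S ?F" by measurable
      have 1: "Lp_bound r (B1 * M powr (\<alpha> + p) * t powr (1 - g1 - \<kappa>)) (Duhamel_nn ?F t)"
        by (rule B1(2)) (use FF t M in auto)
      have 2: "Lp_bound q (B2 * M powr (\<alpha> + p) * t powr (1 - g2 - \<kappa>)) (Duhamel_nn ?F t)"
        by (rule B2(2)) (use FF t M in auto)
      have "B1 * M powr (\<alpha> + p) \<le> M / 2" "B2 * M powr (\<alpha> + p) \<le> M / 2"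
        using mult_right_mono[OF Bm(1), of M] mult_right_mono[OF Bm(2), of M] M by (simp_all add: MM mult_ac)
      note le = this
      show "Lp_bound r (M / 2 * t powr - br) (Duhamel_nn ?F t)"
        using 1 unfolding scal by (rule Lp_bound_mono_factor) (use le B1(1) rp(3) in auto)
      show "Lp_bound q (M / 2 * t powr - bq) (Duhamel_nn ?F t)"
        using 2 unfolding scal by (rule Lp_bound_mono_factor) (use le B2(1) q in auto)
    qed
    obtain V where V [measurable]: "?S V" and V_r: "\<And>t. 0 < t \<Longrightarrow> Lp_bound r (M * t powr - br) (V t)"
      and V_eq: "\<And>t x. V t x = U t x + Duhamel_nn (\<lambda>\<tau> y. ennreal (c \<tau>) * epow p (V \<tau> y)) t x"
      using majorant_exists[of U c p M r br] p M rp U_r stepM by auto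
    have V_q: "Lp_bound q (M * t powr - bq) (V t)" if t: "0 < t" for t
    proof -
      have "Lp_bound q (M / 2 * t powr - bq + M / 2 * t powr - bq) (\<lambda>x. U t x + Duhamel_nn (\<lambda>\<tau> y. ennreal (c \<tau>) * epow p (V \<tau> y)) t x)"
        using t M q by (intro Lp_bound_add U_q stepMq V V_r) auto
      then show ?thesis by (simp flip: V_eq)
    qed
    have nonl: "nonlocal_problem U0 U V c p r M br q \<alpha> bq"
    proof
      fix F :: "real \<Rightarrow> 'a \<Rightarrow> ennreal" and K t :: real
      assume F [measurable]: "?S F" and K: "0 < K" and FK: "\<And>\<tau>. 0 < \<tau> \<Longrightarrow> Lp_bound r (K * \<tau> powr - br) (F \<tau>)" and t: "0 < t"
      let ?F = "\<lambda>\<tau> y. ennreal (c \<tau> * p) * (epow (p - 1) (V \<tau> y) * F \<tau> y)"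
      have [measurable]: "?S ?F" by measurable
      \<comment> \<open>Hoelder's inequality with p - 1 factors V and one factor F. The powers of
        time add up to -\<open>\<kappa>\<close>, just as for the source itself, and the powers of M
        to m0.\<close>
      have FF: "Lp_bound (r / p) ((p * m0 * K) * \<tau> powr - \<kappa>) (?F \<tau>)" if \<tau>: "0 < \<tau>" for \<tau>
      proof -
        have "Lp_bound (r / p) ((c \<tau> * p) * ((M * \<tau> powr - br) powr (p - 1) * (K * \<tau> powr - br))) (?F \<tau>)"
          using V_r[OF \<tau>] FK[OF \<tau>] M K p r \<tau> cnn by (intro Lp_bound_cmult Lp_bound_Holder) auto
        also have "(c \<tau> * p) * ((M * \<tau> powr - br) powr (p - 1) * (K * \<tau> powr - br))
          = p * (M powr \<alpha> * M powr (p - 1)) * K * (\<tau> powr (- (\<alpha> * bq)) * \<tau> powr (- br * (p - 1)) * \<tau> powr - br)"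
          using \<tau> M by (simp add: c powr_mult powr_powr)
        also have "\<dots> = (p * m0 * K) * \<tau> powr - \<kappa>"
          unfolding powr_add[symmetric] \<kappa>(1) m0_def by (simp add: algebra_simps)
        finally show ?thesis .
      qed
      have 1: "Lp_bound r (B1 * (p * m0 * K) * t powr (1 - g1 - \<kappa>)) (Duhamel_nn ?F t)"
        by (rule B1(2)) (use FF t K p m0(1) in auto)
      have "B1 * (p * m0 * K) \<le> K / 2" using mult_right_mono[OF m0le(1), of K] K by (simp add: mult_ac)
      then show "Lp_bound r (K / 2 * t powr - br) (Duhamel_nn ?F t)"
        by (rule Lp_bound_mono_factor[OF 1[unfolded scal]]) (use B1(1) rp(3) m0(1) K p in auto)
    next
      fix t e :: real assume t: "0 < t" and e: "0 < e"
      let ?F = "\<lambda>\<tau> y. ennreal (c \<tau>) * epow p (V \<tau> y)"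
      have [measurable]: "?S ?F" by measurable
      define A where "A = 2 * real DIM('a) powr \<omega> * \<epsilon>"
      have A: "0 < A" using \<epsilon> by (simp add: A_def)
      obtain d where d: "0 < d" "\<And>s. 0 < s \<Longrightarrow> \<bar>s - t\<bar> < d \<Longrightarrow> s \<noteq> t \<Longrightarrow>
        (max s t - min s t) powr \<omega> * (A * min s t powr (- bq - \<omega>)
          + (Dw * \<epsilon>) * (min s t powr (1 - gw - \<omega> - (- \<rho>)) + max s t powr (1 - gw - \<omega> - (- \<rho>)))
          + (Ds * M powr (\<alpha> + p)) * (min s t powr (1 - g2 - \<omega> - \<kappa>) + max s t powr (1 - g2 - \<omega> - \<kappa>))) < e"
        using modulus_small[OF t e \<omega>0(1)] by blast
      have "Lp_bound q e (\<lambda>x. ennreal \<bar>U0 t x - U0 s x\<bar> + Duhamel_nn_diff ?F (min s t) (max s t) x)"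
        if s: "0 < s" "\<bar>s - t\<bar> < d" "s \<noteq> t" for s
      proof -
        define a b where "a = min s t" and "b = max s t"
        have ab: "0 < a" "a < b" using s t by (auto simp: a_def b_def)
        let ?H = "\<lambda>x. \<integral>\<^sup>+y. ennreal \<bar>heat_kernel b (x - y) - heat_kernel a (x - y)\<bar> * ennreal \<bar>u0 y\<bar> \<partial>lborel"
        have L1: "Lp_bound q (2 * real DIM('a) powr \<omega> * (b - a) powr \<omega> * a powr (- bq - \<omega>) * \<epsilon>) ?H"
          using ab \<epsilon> u0b pc bq N \<omega>0 \<omega>(1) by (intro heat_time_difference) auto
        have L2: "Lp_bound q (Dw * \<epsilon> * (b - a) powr \<omega> * (a powr (1 - gw - \<omega> - (- \<rho>)) + b powr (1 - gw - \<omega> - (- \<rho>)))) (Duhamel_nn_diff W a b)"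
          using ab \<epsilon> Wb by (intro Dw(2)) auto
        have L3: "Lp_bound q (Ds * M powr (\<alpha> + p) * (b - a) powr \<omega> * (a powr (1 - g2 - \<omega> - \<kappa>) + b powr (1 - g2 - \<omega> - \<kappa>))) (Duhamel_nn_diff ?F a b)"
          by (rule Ds(2)) (use ab M src V_r in auto)
        have pos: "0 < 2 * real DIM('a) powr \<omega> * (b - a) powr \<omega> * a powr (- bq - \<omega>) * \<epsilon>"
          "0 < Dw * \<epsilon> * (b - a) powr \<omega> * (a powr (1 - gw - \<omega> - (- \<rho>)) + b powr (1 - gw - \<omega> - (- \<rho>)))"
          "0 < Ds * M powr (\<alpha> + p) * (b - a) powr \<omega> * (a powr (1 - g2 - \<omega> - \<kappa>) + b powr (1 - g2 - \<omega> - \<kappa>))"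
          using ab \<epsilon> Dw(1) Ds(1) M by (auto intro!: mult_pos_pos add_pos_pos)
        note L = Lp_bound_add[OF Lp_bound_add[OF L1 L2 pos(1,2) less_imp_le[OF q]] L3 add_pos_pos[OF pos(1,2)] pos(3) less_imp_le[OF q]]
        have "AE x in lborel. ennreal \<bar>U0 t x - U0 s x\<bar> \<le> ?H x + Duhamel_nn_diff W a b x"
          using U_fin[OF t] U_fin[OF s(1)]
        proof eventually_elim
          case (elim x)
          then have fin: "H b x < \<infinity>" "H a x < \<infinity>" "Duhamel_nn W b x < \<infinity>" "Duhamel_nn W a x < \<infinity>"
            by (auto simp: U_def a_def b_def min_def max_def)
          have int: "integrable lborel (\<lambda>y. heat_kernel z (x - y) * u0 y)" if "H z x < \<infinity>" for z
            by (rule integrableI_bounded) (use that in \<open>auto simp: H_def abs_mult ennreal_mult\<close>)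
          have "heat_semigroup b u0 x - heat_semigroup a u0 x = (LINT y|lborel. (heat_kernel b (x - y) - heat_kernel a (x - y)) * u0 y)"
            unfolding heat_semigroup_def
            by (subst Bochner_Integration.integral_diff[symmetric]) (use int fin in \<open>auto simp: left_diff_distrib\<close>)
          then have 1: "ennreal \<bar>heat_semigroup b u0 x - heat_semigroup a u0 x\<bar> \<le> ?H x"
            using abs_integral_le_nn_integral[of lborel "\<lambda>y. (heat_kernel b (x - y) - heat_kernel a (x - y)) * u0 y"]
            by (simp add: abs_mult ennreal_mult)
          have 2: "ennreal \<bar>Duhamel f b x - Duhamel f a x\<bar> \<le> Duhamel_nn_diff W a b x"
            unfolding Wf by (rule Duhamel_time_diff_le) (use fin Wf in auto)
          have "\<bar>U0 t x - U0 s x\<bar> = \<bar>U0 b x - U0 a x\<bar>" by (auto simp: a_def b_def min_def max_def)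
          also have "\<dots> \<le> \<bar>heat_semigroup b u0 x - heat_semigroup a u0 x\<bar> + \<bar>Duhamel f b x - Duhamel f a x\<bar>"
            by (simp add: U0_def)
          finally have "ennreal \<bar>U0 t x - U0 s x\<bar> \<le> ennreal \<bar>heat_semigroup b u0 x - heat_semigroup a u0 x\<bar> + ennreal \<bar>Duhamel f b x - Duhamel f a x\<bar>"
            by (simp add: ennreal_plus[symmetric] ennreal_leI del: ennreal_plus)
          also have "\<dots> \<le> ?H x + Duhamel_nn_diff W a b x" by (intro add_mono 1 2)
          finally show ?case .
        qed
        then have AE: "AE x in lborel. ennreal \<bar>U0 t x - U0 s x\<bar> + Duhamel_nn_diff ?F a b x \<le> ?H x + Duhamel_nn_diff W a b x + Duhamel_nn_diff ?F a b x"
          by eventually_elim (rule add_right_mono)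
        have U0sec: "U0 z \<in> borel_measurable lborel" for z
          using measurable_Pair2[of "case_prod U0" lborel lborel borel z] by simp
        have Fsec: "Duhamel_nn_diff ?F a b \<in> borel_measurable lborel" using Lp_bound_measurable[OF L3] .
        show ?thesis unfolding a_def[symmetric] b_def[symmetric]
        proof (rule Lp_bound_mono_AE[OF L])
          show "AE x in lborel. ennreal \<bar>U0 t x - U0 s x\<bar> + Duhamel_nn_diff ?F a b x \<le> ?H x + Duhamel_nn_diff W a b x + Duhamel_nn_diff ?F a b x" by (rule AE)
          show "(\<lambda>x. ennreal \<bar>U0 t x - U0 s x\<bar> + Duhamel_nn_diff ?F a b x) \<in> borel_measurable lborel"
            using U0sec Fsec by measurable
          have "2 * real DIM('a) powr \<omega> * (b - a) powr \<omega> * a powr (- bq - \<omega>) * \<epsilon>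
             + Dw * \<epsilon> * (b - a) powr \<omega> * (a powr (1 - gw - \<omega> - (- \<rho>)) + b powr (1 - gw - \<omega> - (- \<rho>)))
             + Ds * M powr (\<alpha> + p) * (b - a) powr \<omega> * (a powr (1 - g2 - \<omega> - \<kappa>) + b powr (1 - g2 - \<omega> - \<kappa>))
           = (b - a) powr \<omega> * (A * a powr (- bq - \<omega>)
             + (Dw * \<epsilon>) * (a powr (1 - gw - \<omega> - (- \<rho>)) + b powr (1 - gw - \<omega> - (- \<rho>)))
             + (Ds * M powr (\<alpha> + p)) * (a powr (1 - g2 - \<omega> - \<kappa>) + b powr (1 - g2 - \<omega> - \<kappa>)))"
            unfolding A_def distrib_left by (simp only: mult_ac)
          also have "\<dots> < e" using d(2)[OF s] by (simp only: a_def b_def)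
          finally show "2 * real DIM('a) powr \<omega> * (b - a) powr \<omega> * a powr (- bq - \<omega>) * \<epsilon>
             + Dw * \<epsilon> * (b - a) powr \<omega> * (a powr (1 - gw - \<omega> - (- \<rho>)) + b powr (1 - gw - \<omega> - (- \<rho>)))
             + Ds * M powr (\<alpha> + p) * (b - a) powr \<omega> * (a powr (1 - g2 - \<omega> - \<kappa>) + b powr (1 - g2 - \<omega> - \<kappa>)) \<le> e"
            by (rule less_imp_le)
        qed (use pos q in auto)
      qed
      then show "\<exists>d>0. \<forall>s>0. \<bar>s - t\<bar> < d \<longrightarrow> s \<noteq> t \<longrightarrow>
        Lp_bound q e (\<lambda>x. ennreal \<bar>U0 t x - U0 s x\<bar> + Duhamel_nn_diff ?F (min s t) (max s t) x)"
        using d(1) by blast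
    next
      show "V t x = U t x + Duhamel_nn (\<lambda>\<tau> y. ennreal (c \<tau>) * epow p (V \<tau> y)) t x" for t x by (rule V_eq)
      show "c t = norm_power \<alpha> (M * t powr - bq)" for t by (simp add: c_def)
    qed (use V_r V_q U0U cnn p rp M q \<alpha> in auto)
    interpret nonlocal_problem U0 U V c p r M br q \<alpha> bq by (rule nonl)
    obtain v where v [measurable]: "case_prod v \<in> borel_measurable lborel2"
      and vV: "\<And>t. 0 < t \<Longrightarrow> AE x in lborel. ennreal \<bar>v t x\<bar> \<le> V t x"
      and v_eq: "\<And>t. 0 < t \<Longrightarrow> AE x in lborel. v t x = U0 t x
          + Duhamel (\<lambda>\<tau> y. norm_power \<alpha> (Lp_norm q (v \<tau>)) * \<bar>v \<tau> y\<bar> powr p) t x"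
      using nonlocal_solution by blast
    have vsec [measurable]: "v t \<in> borel_measurable lborel" for t
      using measurable_Pair2[of "case_prod v" lborel lborel borel t] by simp
    have vb: "Lp_bound q (M * t powr - bq) (\<lambda>x. ennreal \<bar>v t x\<bar>)" if t: "0 < t" for t
      using V_q[OF t] vV[OF t] M q by (elim Lp_bound_mono_AE) auto
    have Mt: "0 \<le> M * t powr - bq" for t using M by simp
    have q0: "0 < q" using q by simp
    note vn = Lp_bound_Lp_norm[OF vb vsec Mt q0]
    define F1 where "F1 = (\<lambda>\<tau> y. norm_power \<alpha> (Lp_norm q (v \<tau>)) * \<bar>v \<tau> y\<bar> powr p)"
    define F2 where "F2 = (\<lambda>\<tau>. nonlocal_source q \<alpha> p (v \<tau>))"
    have [measurable]: "(\<lambda>t. Lp_norm q (v t)) \<in> borel_measurable borel" by (rule Lp_norm_measurable[OF v])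
    have F1m [measurable]: "case_prod F1 \<in> borel_measurable lborel2" and F2m [measurable]: "case_prod F2 \<in> borel_measurable lborel2"
      unfolding F1_def F2_def nonlocal_source_def by measurable
    \<comment> \<open>\<open>norm_power\<close> and \<open>powr\<close> disagree only when
      \<open>\<alpha>\<close> = 0 and the norm vanishes; then v(\<open>\<tau>\<close>) = 0 almost
      everywhere and both sources are 0.\<close>
    have F12: "AE y in lborel. F1 \<tau> y = F2 \<tau> y" if \<tau>: "0 < \<tau>" for \<tau>
    proof (cases "\<alpha> = 0 \<and> Lp_norm q (v \<tau>) = 0")
      case True
      then have "Lp_bound q 0 (\<lambda>x. ennreal \<bar>v \<tau> x\<bar>)" using vn(3)[OF \<tau>] by simp
      then have "AE x in lborel. ennreal \<bar>v \<tau> x\<bar> = 0"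
        using q by (intro Lp_bound_tendsto_0_imp_AE_0[where A="\<lambda>_. 0" and m=q]) auto
      then show ?thesis by eventually_elim (auto simp: F1_def F2_def nonlocal_source_def)
    qed (auto simp: F1_def F2_def nonlocal_source_def norm_power_def)
    have F1V: "Duhamel_nn (\<lambda>\<tau> y. ennreal \<bar>F1 \<tau> y\<bar>) t x \<le> V t x" for t x
    proof (rule order_trans[OF Duhamel_nn_mono Duhamel_nn_le_V])
      fix \<tau> :: real assume \<tau>: "0 < \<tau>"
      have g: "norm_power \<alpha> (Lp_norm q (v \<tau>)) \<le> c \<tau>"
        unfolding c_def using vn(2)[OF \<tau>] \<alpha> by (intro norm_power_mono) auto
      show "AE y in lborel. ennreal \<bar>F1 \<tau> y\<bar> \<le> ennreal (c \<tau>) * epow p (V \<tau> y)"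
        using vV[OF \<tau>]
      proof eventually_elim
        case (elim y)
        have "epow p (ennreal \<bar>v \<tau> y\<bar>) \<le> epow p (V \<tau> y)" using elim p by (intro epow_mono) auto
        then show ?case using g by (simp add: F1_def abs_mult ennreal_mult mult_mono ennreal_leI)
      qed
    qed
    have F2V: "Duhamel_nn (\<lambda>\<tau> y. ennreal \<bar>F2 \<tau> y\<bar>) t x \<le> V t x" for t x
    proof (rule order_trans[OF Duhamel_nn_mono F1V])
      fix \<tau> :: real assume "0 < \<tau>"
      from F12[OF this] show "AE y in lborel. ennreal \<bar>F2 \<tau> y\<bar> \<le> ennreal \<bar>F1 \<tau> y\<bar>" by eventually_elim simp
    qed
    have Duhamel_F12: "Duhamel F1 t x = Duhamel F2 t x" if "V t x < \<infinity>" for t x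
    proof -
      have "ennreal \<bar>Duhamel F1 t x - Duhamel F2 t x\<bar> \<le> Duhamel_nn (\<lambda>\<tau> y. ennreal \<bar>F1 \<tau> y - F2 \<tau> y\<bar>) t x"
        by (rule Duhamel_diff_le[OF F1m F2m le_less_trans[OF F1V that] le_less_trans[OF F2V that]])
      also have "\<dots> = 0"
      proof (rule Duhamel_nn_eq_0)
        fix \<tau> :: real assume "0 < \<tau>"
        from F12[OF this] show "AE y in lborel. ennreal \<bar>F1 \<tau> y - F2 \<tau> y\<bar> = 0" by eventually_elim simp
      qed
      finally show ?thesis by (simp add: ennreal_eq_0_iff)
    qed
    have fs: "heat_semigroup z (f \<tau>) x = \<tau> powr \<rho> * heat_semigroup z w x" for z \<tau> x
      unfolding heat_semigroup_def f_def
      by (subst integral_mult_right_zero[symmetric]) (simp add: mult.left_commute)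
    have "global_mild_solution q \<alpha> p \<rho> u0 w v"
      unfolding global_mild_solution_def
    proof (intro conjI allI impI)
      have "sets (borel :: (real \<times> 'a) measure) = sets lborel2"
        by (simp add: borel_prod[symmetric] cong: sets_pair_measure_cong)
      then have vm: "case_prod v \<in> borel_measurable borel" using v by (simp cong: measurable_cong_sets)
      have "open ({0<..} \<times> UNIV :: (real \<times> 'a) set)" by (intro open_Times) auto
      then have "({0<..} \<times> UNIV :: (real \<times> 'a) set) \<in> sets borel" by (rule borel_open)
      then show "set_borel_measurable borel ({0<..} \<times> UNIV) (\<lambda>(t, x). v t x)"
        unfolding set_borel_measurable_def by (intro borel_measurable_scaleR borel_measurable_indicator vm)
    next
      fix t :: real assume "0 < t"
      then show "v t \<in> Lp q" using vn(1) q by (simp add: Lp_def)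
    next
      fix t :: real assume t: "0 < t"
      show "AE x in lborel. heat_semigroup_defined t u0 x \<and>
        (AE \<tau> in lborel. \<tau> \<in> {0<..<t} \<longrightarrow>
           heat_semigroup_defined (t - \<tau>) (nonlocal_source q \<alpha> p (v \<tau>)) x \<and> heat_semigroup_defined (t - \<tau>) w x) \<and>
        set_integrable lborel {0<..<t} (\<lambda>\<tau>. heat_semigroup (t - \<tau>) (nonlocal_source q \<alpha> p (v \<tau>)) x) \<and>
        set_integrable lborel {0<..<t} (\<lambda>\<tau>. \<tau> powr \<rho> * heat_semigroup (t - \<tau>) w x) \<and>
        v t x = heat_semigroup t u0 x
          + (LINT \<tau>:{0<..<t}|lborel. heat_semigroup (t - \<tau>) (nonlocal_source q \<alpha> p (v \<tau>)) x)
          + (LINT \<tau>:{0<..<t}|lborel. \<tau> powr \<rho> * heat_semigroup (t - \<tau>) w x)"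
        using V_AE_finite[OF t] U_fin[OF t] v_eq[OF t]
      proof eventually_elim
        case (elim x)
        have fin: "H t x < \<infinity>" "Duhamel_nn (\<lambda>\<tau> y. ennreal \<bar>f \<tau> y\<bar>) t x < \<infinity>" "Duhamel_nn (\<lambda>\<tau> y. ennreal \<bar>F2 \<tau> y\<bar>) t x < \<infinity>"
          using elim by (auto simp: U_def Wf intro: le_less_trans[OF F2V])
        note I2 = Duhamel_iterated[OF F2m fin(3)]
        note If = Duhamel_iterated[OF \<open>case_prod f \<in> borel_measurable lborel2\<close> fin(2)]
        have "heat_semigroup_defined t u0 x"
          unfolding heat_semigroup_defined_def
          by (rule integrableI_bounded) (use fin(1) in \<open>auto simp: H_def abs_mult ennreal_mult\<close>)
        moreover have "AE \<tau> in lborel. \<tau> \<in> {0<..<t} \<longrightarrow>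
           heat_semigroup_defined (t - \<tau>) (nonlocal_source q \<alpha> p (v \<tau>)) x \<and> heat_semigroup_defined (t - \<tau>) w x"
          using I2(1) If(1)
        proof eventually_elim
          case (elim \<tau>)
          have "heat_semigroup_defined (t - \<tau>) w x" if "0 < \<tau>" "heat_semigroup_defined (t - \<tau>) (f \<tau>) x"
          proof -
            have "integrable lborel (\<lambda>y. \<tau> powr \<rho> * (heat_kernel (t - \<tau>) (x - y) * w y))"
              using that by (simp add: heat_semigroup_defined_def f_def mult.left_commute)
            then show ?thesis using that by (simp add: heat_semigroup_defined_def)
          qed
          then show ?case using elim by (auto simp: F2_def)
        qed
        moreover have "set_integrable lborel {0<..<t} (\<lambda>\<tau>. heat_semigroup (t - \<tau>) (nonlocal_source q \<alpha> p (v \<tau>)) x)"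
          using I2(2) by (simp add: F2_def)
        moreover have "set_integrable lborel {0<..<t} (\<lambda>\<tau>. \<tau> powr \<rho> * heat_semigroup (t - \<tau>) w x)"
          using If(2) by (simp add: fs)
        moreover have "v t x = heat_semigroup t u0 x
          + (LINT \<tau>:{0<..<t}|lborel. heat_semigroup (t - \<tau>) (nonlocal_source q \<alpha> p (v \<tau>)) x)
          + (LINT \<tau>:{0<..<t}|lborel. \<tau> powr \<rho> * heat_semigroup (t - \<tau>) w x)"
        proof -
          have "v t x = U0 t x + Duhamel F1 t x" using elim by (simp add: F1_def)
          also have "\<dots> = heat_semigroup t u0 x + Duhamel F2 t x + Duhamel f t x"
            using Duhamel_F12 elim by (simp add: U0_def)
          finally show ?thesis using I2(3) If(3) by (simp add: fs F2_def)
        qed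
        ultimately show ?case by blast
      qed
    qed
    then show ?thesis by blast
  qed
  then show ?thesis using \<epsilon> by blast
qed


section \<open>The exponents\<close>

theorem theorem1p4:
  fixes N q \<alpha> \<rho> \<delta> p p\<^sub>c l :: real
  assumes "N = real CARD('n::finite)"
    and "N \<ge> 2"
    and "q > 1"
    and "\<alpha> \<ge> 0"
    and "-1 < \<rho>" and "\<rho> < 0"
    and "\<delta> = \<alpha> * (1 - 1 / q)"
    and "\<delta> < 2 / N"
    and "p \<ge> (N - 2 * \<rho> - N * \<delta>) / (N - 2 * \<rho> - 2)"
    and "N * (p - 1) / 2 \<le> q" and "q \<le> p"
    and "p\<^sub>c = N * ((p - 1) * (q - 1) + \<delta> * q) / (2 * (q - 1) + N * \<delta>)"
    and "l = N * ((p - 1) * (q - 1) + \<delta> * q) /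
             (2 * (q - 1) + N * \<delta> + 2 * (\<rho> + 1) * (p - 1) * (q - 1) + 2 * (\<rho> + 1) * \<delta> * q)"
  shows "\<exists>\<epsilon>>0. \<forall>(u0 :: real ^ 'n \<Rightarrow> real) (w :: real ^ 'n \<Rightarrow> real).
           u0 \<in> Lp p\<^sub>c \<and> w \<in> Lp l \<and> Lp_norm p\<^sub>c u0 + Lp_norm l w < \<epsilon>
           \<longrightarrow> (\<exists>u. global_mild_solution q \<alpha> p \<rho> u0 w u)"
proof (cases "1 \<le> l")
  case False
  \<comment> \<open>\<open>Lp l\<close> is empty here, so any \<open>\<epsilon>\<close> will
    do.\<close>
  then show ?thesis by (intro exI[of _ 1]) (simp add: Lp_def)
next
  case l1: True
  note N = assms(1,2) and q = assms(3) and \<alpha> = assms(4) and \<rho> = assms(5,6)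
  have p: "1 < p" using assms by simp
  have dim: "N = real DIM(real ^ 'n)" using N by simp
  have dq: "\<delta> * q = \<alpha> * (q - 1)" "N * \<delta> = (q - 1) * (N * \<alpha> / q)"
    unfolding assms(7) using q by (simp_all add: field_simps)
  \<comment> \<open>X and Y remain of the numerator and denominator of \<open>p\<^sub>c\<close>
    after the common factor q - 1, visible from \<open>dq\<close>, is removed.\<close>
  define X where "X = p - 1 + \<alpha>"
  define Y where "Y = 2 + N * \<alpha> / q"
  have XY: "0 < X" "0 < Y" using p \<alpha> N q by (auto simp: X_def Y_def intro!: add_pos_nonneg)
  have "p\<^sub>c = ((q - 1) * (N * X)) / ((q - 1) * Y)"
    unfolding assms(12) dq X_def Y_def by (simp add: algebra_simps)
  then have pc: "p\<^sub>c = N * X / Y" using q by simp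
  have "l = ((q - 1) * (N * X)) / ((q - 1) * (Y + 2 * (\<rho> + 1) * X))"
    unfolding assms(13) dq mult.assoc X_def Y_def by (simp add: algebra_simps)
  then have l: "l = N * X / (Y + 2 * (\<rho> + 1) * X)" using q by simp
  define K where "K = Y / (2 * X)"
  have K: "0 < K" using XY by (simp add: K_def)
  have NK: "N / 2 * (1 / p\<^sub>c) = K" using N XY by (simp add: pc K_def)
  have Nl: "N / 2 * (1 / l) = K + \<rho> + 1" using N XY by (simp add: l K_def field_simps)
  \<comment> \<open>The scaling identity: the equation is invariant under u(x,t) -> s^(2K) u(s x,
    s^2 t) exactly for this K, when there is no forcing.\<close>
  have KX: "K * (p - 1 + \<alpha>) = 1 + N * \<alpha> / (2 * q)"
    unfolding X_def[symmetric] using XY by (simp add: K_def Y_def field_simps)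
  have pc0: "0 < p\<^sub>c" using N XY by (simp add: pc)
  have le1: "K + \<rho> + 1 \<le> N / 2"
    unfolding Nl[symmetric] using l1 N by (simp add: field_simps)
  have hq: "N * (p - 1) / (2 * q) \<le> 1" using assms(10) q by (simp add: field_simps)
  have Kq: "N / (2 * q) \<le> K"
  proof -
    have "N / (2 * q) * (p - 1 + \<alpha>) = N * (p - 1) / (2 * q) + N * \<alpha> / (2 * q)"
      by (simp add: distrib_left add_divide_distrib)
    also have "\<dots> \<le> K * (p - 1 + \<alpha>)" unfolding KX using hq by simp
    finally show ?thesis by (rule mult_right_le_imp_le) (use XY in \<open>simp add: X_def\<close>)
  qed
  \<comment> \<open>\<open>KX\<close> rearranged; N / (2q) <= K makes the correction
    nonpositive.\<close>
  have Kp: "K * (p - 1) \<le> 1"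
  proof -
    have "K * (p - 1) = 1 + \<alpha> * (N / (2 * q) - K)" using KX by (simp add: algebra_simps)
    moreover have "\<alpha> * (N / (2 * q) - K) \<le> 0" using \<alpha> Kq by (intro mult_nonneg_nonpos) auto
    ultimately show ?thesis by simp
  qed
  have pp: "N * (p - 1) / 2 \<le> p" using assms(10,11) by simp
  have Npq: "N / (2 * p) \<le> N / (2 * q)" using assms(11) q p N by (intro divide_left_mono) auto
  have pN: "p * (N / 2 - 1) \<le> N / 2" using pp by (simp add: field_simps)
  \<comment> \<open>The borderline case: N/2 - 1 = N/(2p), so \<open>le1\<close> yields no strict
    inequality. It forces q = p and determines K, and the strictness in \<open>A\<close> and
    \<open>B\<close> then comes from \<open>\<rho>\<close> < 0.\<close>
  have eqcase: "K = N / (2 * p)" if "N * (p - 1) / 2 = p"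
  proof -
    have "q = p" using that assms(10,11) by simp
    then have "K * (p - 1 + \<alpha>) = N / (2 * p) * (p - 1 + \<alpha>)"
      using KX that p by (simp add: field_simps)
    moreover have "p - 1 + \<alpha> \<noteq> 0" using XY by (simp add: X_def)
    ultimately show ?thesis by (metis mult_right_cancel)
  qed
  have A: "K + \<rho> < N / (2 * p)"
  proof (cases "N * (p - 1) / 2 = p")
    case True
    then show ?thesis using eqcase \<rho> by simp
  next
    case False
    then have "N * (p - 1) / 2 < p" using pp by simp
    then have "N / 2 - 1 < N / (2 * p)" using p by (simp add: field_simps)
    then show ?thesis using le1 by simp
  qed
  have B: "p * (K + \<rho>) < 1 + N / (2 * q)"
  proof -
    have *: "N / 2 \<le> 1 + N / (2 * p)" using pN p by (simp add: field_simps)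
    have "p * (K + \<rho>) < N / 2"
    proof (cases "N * (p - 1) / 2 = p")
      case True
      have "p * (K + \<rho>) = N / 2 + p * \<rho>" using eqcase[OF True] p by (simp add: field_simps)
      moreover have "p * \<rho> < 0" using p \<rho> by (intro mult_pos_neg) auto
      ultimately show ?thesis by linarith
    next
      case False
      then have "p * (N / 2 - 1) < N / 2" using pp by (simp add: field_simps)
      moreover have "p * (K + \<rho>) \<le> p * (N / 2 - 1)" using le1 p by (intro mult_left_mono) auto
      ultimately show ?thesis by simp
    qed
    then show ?thesis using * Npq by simp
  qed
  (* The auxiliary exponent r is determined by y = N / (2 r). The bound K / p < y makes the source
     integrable at time 0; K + \<rho> < y and the last two upper bounds make the kernel singularities at
     the final time integrable; the first two upper bounds give p \<le> r and decay in L^r. *)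
  define lo where "lo = max (K + \<rho>) (K / p)"
  define hi where "hi = min (min (N / (2 * p)) K) (min (1 / (p - 1)) ((1 + N / (2 * q)) / p))"
  \<comment> \<open>Each of the two lower bounds has to lie below each of the four upper ones. For K
    + \<open>\<rho>\<close> this is \<open>A\<close>, \<open>\<rho>\<close> < 0, \<open>Kp\<close>
    and \<open>B\<close>; for K / p it rests mainly on K < N/2 and \<open>Kp\<close>.\<close>
  have "lo < hi"
  proof -
    have "K / p < N / (2 * p)" using p le1 \<rho> by (simp add: field_simps)
    moreover have "K / p < K" using p K by (simp add: field_simps)
    moreover have "K / p < 1 / (p - 1)" using p Kp by (simp add: field_simps)
    moreover have "K / p < (1 + N / (2 * q)) / p"
      using A Npq \<rho> p by (intro divide_strict_right_mono) auto
    moreover have "K \<le> 1 / (p - 1)" using p Kp by (simp add: field_simps)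
    moreover have "K + \<rho> < (1 + N / (2 * q)) / p" using B p by (simp add: field_simps)
    ultimately show ?thesis using A \<rho> unfolding lo_def hi_def by auto
  qed
  then obtain y where y: "lo < y" "y < hi" using dense by blast
  then have y1: "K + \<rho> < y" "K / p < y" and y2: "y < N / (2 * p)" "y < K" "y < 1 / (p - 1)" "y < (1 + N / (2 * q)) / p"
    by (auto simp: lo_def hi_def)
  have y0: "0 < y" using y1(2) K p by (meson divide_pos_pos less_trans zero_less_one)
  define r where "r = N / (2 * y)"
  have r0: "0 < r" using y0 N by (simp add: r_def)
  have yr: "N / 2 * (1 / r) = y" using N y0 by (simp add: r_def)
  have py: "K < p * y" "(p - 1) * y < 1" "p * y < 1 + N / (2 * q)"
    using y1 y2 p by (simp_all add: field_simps)
  have Nq: "N / 2 * (1 / q) = N / (2 * q)" by simp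
  define bq where "bq = N / 2 * (1 / p\<^sub>c - 1 / q)"
  define br where "br = N / 2 * (1 / p\<^sub>c - 1 / r)"
  define g1 where "g1 = N / 2 * (1 / (r / p) - 1 / r)"
  define g2 where "g2 = N / 2 * (1 / (r / p) - 1 / q)"
  have bq: "bq = K - N / (2 * q)" and br: "br = K - y"
    unfolding bq_def br_def right_diff_distrib NK yr Nq by auto
  have Nrp: "N / 2 * (1 / (r / p)) = p * y" unfolding yr[symmetric] by simp
  then have g1: "g1 = p * y - y" and g2: "g2 = p * y - N / (2 * q)"
    unfolding g1_def g2_def right_diff_distrib yr Nq by auto
  define \<kappa> where "\<kappa> = \<alpha> * bq + p * br"
  \<comment> \<open>\<open>KX\<close> cancels the contribution of \<open>\<alpha>\<close>; with this
    form both identities in \<open>scal\<close> become linear.\<close>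
  have \<kappa>: "\<kappa> = K + 1 - p * y"
    using KX unfolding \<kappa>_def bq br by (simp add: algebra_simps)
  \<comment> \<open>Exponents a are ordered through N / (2 a), the scale in which K, y and all
    constraints are expressed.\<close>
  have inv: "a \<le> b" if "N / 2 * (1 / a) = A" "N / 2 * (1 / b) = B" "B \<le> A" "0 < a" "0 < b" for a b A B
  proof -
    have "1 / b \<le> 1 / a"
    proof (rule mult_left_le_imp_le)
      show "N / 2 * (1 / b) \<le> N / 2 * (1 / a)" using that by (simp only:)
    qed (use N in simp)
    then show ?thesis using that(4,5) by (simp add: field_simps)
  qed
  have Np: "N / 2 * (1 / p) = N / (2 * p)" and N1: "N / 2 * (1 / 1) = N / 2" by simp_all
  have p0: "0 < p" using p by simp
  have pr: "p \<le> r" by (rule inv[OF Np yr less_imp_le[OF y2(1)] p0 r0])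
  have "K \<le> N / 2" using le1 \<rho> by linarith
  then have pc1: "1 \<le> p\<^sub>c" by (rule inv[OF N1 NK _ zero_less_one pc0])
  show ?thesis
  proof (rule small_data_solution[where N=N and r=r and bq=bq and br=br and ?g1.0=g1 and ?g2.0=g2 and \<kappa>=\<kappa>])
    show "1 \<le> p\<^sub>c" by (rule pc1)
    show "p\<^sub>c \<le> q" using inv[OF NK Nq] Kq q pc0 by linarith
    show "l \<le> q" using inv[OF Nl Nq] Kq q l1 \<rho> by linarith
    show "p \<le> r" by (rule pr)
    show "q \<le> r" using pr assms(11) by simp
    show "r / p \<le> q"
    proof -
      have "N / (2 * q) \<le> p * y" using Kq py by simp
      then show ?thesis using inv[OF Nrp Nq] r0 p q by simp
    qed
    show "bq + \<rho> < 0" using A Npq unfolding bq by simp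
    show "br + \<rho> < 0" using y1 unfolding br by simp
    show "g1 < 1" using py(2) unfolding g1 by (simp add: algebra_simps)
    show "g2 < 1" using py(3) unfolding g2 by simp
    show "\<kappa> < 1" using py(1) unfolding \<kappa> by simp
    show "1 - g1 - \<kappa> = - br" "1 - g2 - \<kappa> = - bq" unfolding g1 g2 \<kappa> br bq by auto
    show "N / 2 * (1 / l) = N / 2 * (1 / p\<^sub>c) + \<rho> + 1" unfolding Nl NK ..
  qed (use dim N q \<alpha> p \<rho> l1 in \<open>auto simp: bq_def br_def g1_def g2_def \<kappa>_def\<close>)
qed

end
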